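(* Let $\alpha\in(0,4)$, let $X_{11}$ be symmetric and regularly varying with index $\alpha$, i.e. $\mathbb P(|X_{11}|>x)=x^{-\alpha}L(x)$ for $x>0$ with $L$ slowly varying at infinity, and let $p=p_n\to\infty$ as $n\to\infty$. If $\alpha\in(0,3]$, assume additionally that there is some $\delta>\delta^*(\alpha)$ with $p_n/n^{\delta}\to\infty$. Then, as $n\to\infty$, $$\frac{\operatorname{tr}(\mathbf R^2)-\mu_n}{\sigma_n}\ \longrightarrow\ N(0,1)\quad\text{in distribution.}$$
   Context: For each $n$, $(X_{ij})_{1\le i\le p,1\le j\le n}$ are iid copies of a non-degenerate real random variable $X_{11}$ which is symmetric ($X_{11}$ and $-X_{11}$ have the same law) and satisfies $\mathbb P(X_{11}=0)=0$; $p=p_n$ is a positive integer depending on $n$. Put $Y_{ij}=X_{ij}/\sqrt{X_{i1}^2+\cdots+X_{in}^2}$ (depends on $n$), $\mathbf Y=(Y_{ij})\in\mathbb R^{p\times n}$ and let $\mathbf R=\mathbf Y\mathbf Y^{\top}$ be the $p\times p$ sample correlation matrix. Let $\beta_4=\mathbb E[Y_{11}^4]$ (depends on $n$), $$\mu_n=p+\frac{p(p-1)}{n},\qquad \sigma_n^2=2p^2n\,(\beta_4^2+2n^{-3}),\quad \sigma_n>0,$$ and $$\delta^*(\alpha)=\begin{cases}1/2,&\alpha\in(0,2),\\ (\alpha-1)/2,&\alpha\in[2,3],\\ (5-\alpha)/2,&\alpha\in(3,4).\end{cases}$$ A function $L:(0,\infty)\to(0,\infty)$ is slowly varying at infinity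 if $L(tx)/L(x)\to1$ as $x\to\infty$ for every $t>0$. Without loss of generality (the $Y_{ij}$ are scale invariant) $\mathbb E[X_{11}^2]=1$ whenever this second moment is finite. *)

theory Defs
  imports "HOL-Probability.Probability" "Jordan_Normal_Form.Matrix"
begin

text \<open>Arrays are indexed from 0, so the entry written \<open>(1,1)\<close> on paper is \<open>(0,0)\<close> here.\<close>

definition slowly_varying :: "(real \<Rightarrow> real) \<Rightarrow> bool" where
  "slowly_varying L \<longleftrightarrow>
     (\<forall>x>0. L x > 0) \<and> (\<forall>t>0. ((\<lambda>x. L (t * x) / L x) \<longlongrightarrow> 1) at_top)"

definition regularly_varying :: "'a measure \<Rightarrow> ('a \<Rightarrow> real) \<Rightarrow> real \<Rightarrow> bool" where
  "regularly_varying M \<xi> \<alpha> \<longleftrightarrow>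
     (\<exists>L. slowly_varying L \<and>
          (\<forall>x>0. measure M {\<omega> \<in> space M. \<bar>\<xi> \<omega>\<bar> > x} = x powr (-\<alpha>) * L x))"

definition nondegenerate :: "'a measure \<Rightarrow> ('a \<Rightarrow> real) \<Rightarrow> bool" where
  "nondegenerate M \<xi> \<longleftrightarrow> \<not> (\<exists>c. AE \<omega> in M. \<xi> \<omega> = c)"

definition symmetric_rv :: "'a measure \<Rightarrow> ('a \<Rightarrow> real) \<Rightarrow> bool" where
  "symmetric_rv M \<xi> \<longleftrightarrow> distr M borel \<xi> = distr M borel (\<lambda>\<omega>. - \<xi> \<omega>)"

definition iid_copies ::
  "'a measure \<Rightarrow> 'i set \<Rightarrow> ('i \<Rightarrow> 'a \<Rightarrow> real) \<Rightarrow> 'b measure \<Rightarrow> ('b \<Rightarrow> real) \<Rightarrow> bool" where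
  "iid_copies M I X N \<xi> \<longleftrightarrow>
     prob_space.indep_vars M (\<lambda>_. borel) X I \<and>
     (\<forall>i\<in>I. distr M borel (X i) = distr N borel \<xi>)"

definition Y_mat :: "nat \<Rightarrow> nat \<Rightarrow> (nat \<times> nat \<Rightarrow> 'a \<Rightarrow> real) \<Rightarrow> 'a \<Rightarrow> real mat" where
  "Y_mat p n X \<omega> = mat p n (\<lambda>(i, j). X (i, j) \<omega> / sqrt (\<Sum>k<n. (X (i, k) \<omega>)\<^sup>2))"

definition R_mat :: "nat \<Rightarrow> nat \<Rightarrow> (nat \<times> nat \<Rightarrow> 'a \<Rightarrow> real) \<Rightarrow> 'a \<Rightarrow> real mat" where
  "R_mat p n X \<omega> = Y_mat p n X \<omega> * transpose_mat (Y_mat p n X \<omega>)"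

definition tr :: "real mat \<Rightarrow> real" where
  "tr A = (\<Sum>i<dim_row A. A $$ (i, i))"

text \<open>The matrix entry is meaningful only if \<open>p\<close> and \<open>n\<close> are positive.\<close>

definition \<beta>\<^sub>4 :: "'a measure \<Rightarrow> nat \<Rightarrow> nat \<Rightarrow> (nat \<times> nat \<Rightarrow> 'a \<Rightarrow> real) \<Rightarrow> real" where
  "\<beta>\<^sub>4 M p n X = (LINT \<omega>|M. (Y_mat p n X \<omega> $$ (0, 0)) ^ 4)"

definition centering :: "nat \<Rightarrow> nat \<Rightarrow> real" where
  "centering p n = real p + real p * (real p - 1) / real n"

definition scaling :: "'a measure \<Rightarrow> nat \<Rightarrow> nat \<Rightarrow> (nat \<times> nat \<Rightarrow> 'a \<Rightarrow> real) \<Rightarrow> real" where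
  "scaling M p n X =
     sqrt (2 * (real p)\<^sup>2 * real n * ((\<beta>\<^sub>4 M p n X)\<^sup>2 + 2 / real n ^ 3))"

text \<open>Only the values at \<open>0 < \<alpha> < 4\<close> are meaningful.\<close>

definition \<delta>_star :: "real \<Rightarrow> real" where
  "\<delta>_star \<alpha> =
     (if \<alpha> < 2 then 1 / 2 else if \<alpha> \<le> 3 then (\<alpha> - 1) / 2 else (5 - \<alpha>) / 2)"

end

theory Submission
  imports Defs "HOL-Real_Asymp.Real_Asymp"
begin

text \<open>
  Up to centering, the trace of \<open>R\<^sup>2\<close> is twice the U-statistic \<open>W\<close>, the sum over pairs of rows of
  \<open>h(x, y) = \<langle>x, y\<rangle>\<^sup>2 - 1/n\<close>, where the normalised rows are independent random unit vectors. By symmetry of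
  the entries \<open>h\<close> is degenerate: it integrates to \<open>0\<close> in each argument.

  For a degenerate kernel, the characteristic function \<open>\<phi>\<close> of the normalised \<open>W\<close> almost satisfies
  \<open>\<phi>'(t) = - t \<phi>(t)\<close>, as one sees by expanding the contribution of one observation given the others. The
  error is small if \<open>E |h|\<^sup>q\<close> (for some \<open>2 < q \<le> 3\<close>), \<open>E G(x, x)\<^bsup>q/2\<^esup>\<close> and \<open>E G(x, y)\<^sup>2\<close> are small against
  powers of \<open>V = E h\<^sup>2\<close>, where \<open>G(x, y) = E\<^sub>z h(x, z) h(y, z)\<close>.

  Here \<open>G = 2 g h + (b - 2 g) D\<close>, with \<open>D(x, y) = \<Sum>\<^sub>j x\<^sub>j\<^sup>2 y\<^sub>j\<^sup>2 - 1/n\<close>, \<open>g = E Y\<^sub>1\<^sup>2 Y\<^sub>2\<^sup>2\<close> and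
  \<open>b = \<beta>\<^sub>4 - g\<close>, so all second moments are explicit and the term with \<open>E G(x, y)\<^sup>2\<close> is always negligible.
  A Khintchine inequality for the random signs bounds \<open>E |h|\<^sup>q\<close> by a multiple of \<open>n \<beta>\<^sub>4\<^sup>2 + n\<^bsup>-q\<^esup>\<close>.
  Regular variation enters only through the size of \<open>\<beta>\<^sub>4\<close>: if \<open>\<alpha> \<le> 3\<close>, the growth condition on \<open>p\<close> makes
  \<open>p n\<^bsup>1/2\<^esup> \<beta>\<^sub>4\<close> tend to infinity (take \<open>q = 3\<close>); if \<open>\<alpha> > 3\<close>, then \<open>n\<^bsup>1+q\<^esup> \<beta>\<^sub>4\<^sup>2\<close> is bounded for some
  \<open>q > 2\<close>, and \<open>p \<rightarrow> \<infinity>\<close> suffices.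
\<close>

subsection \<open>Inequalities for real powers\<close>

text \<open>The entries may have few moments, but normalised rows are bounded: for fixed n every
  integral exists, and the whole difficulty is uniformity in n. Fourth moments, the classical input
  for degenerate U-statistics, are too coarse here. For \<alpha> > 3, where
  \<open>\<beta>\<^sub>4\<close> is roughly n^(-\<alpha>/2) and V is of order n^(-2), the bound on E
  h^4 is small against p^2 V^2 only if p^2 is large against n^(5 - \<alpha>). Moments of order q <
  \<alpha> - 1 do not see this restriction; the price is a non-integer q, hence the real-power forms
  of the von Bahr-Esseen and Rosenthal inequalities. The differential equation also avoids any order
  on the rows: each one in turn plays the role of the last, and its conditional variance given the
  others is an explicit quadratic expression in G. Its diagonal part is an iid sum with few moments,
  its off-diagonal part is again a degenerate U-statistic, now with kernel G, so the same calculus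
  applies twice.\<close>

lemma powr_one_plus_le:
  fixes q t :: real
  assumes q: "1 \<le> q" "q \<le> 3" and t: "\<bar>t\<bar> \<le> 1/2"
  shows "(1 + t) powr q \<le> 1 + q * t + 12 * t\<^sup>2"
proof -
  have D: "((\<lambda>t. (1 + t) powr q) has_real_derivative q * (1 + x) powr (q - 1)) (at x)"
    if "\<bar>x\<bar> \<le> 1/2" for x
    using that by (auto intro!: derivative_eq_intros)
  have D2: "((\<lambda>t. q * (1 + t) powr (q - 1)) has_real_derivative q * (q - 1) * (1 + x) powr (q - 2)) (at x)"
    if "\<bar>x\<bar> \<le> 1/2" for x
    using that by (auto intro!: derivative_eq_intros)
  define diff where "diff = (\<lambda>m::nat. if m = 0 then (\<lambda>t. (1 + t) powr q) else
     if m = 1 then (\<lambda>t. q * (1 + t) powr (q - 1)) else (\<lambda>t. q * (q - 1) * (1 + t) powr (q - 2)))"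
  show ?thesis
  proof (cases "t = 0")
    case False
    have "\<exists>x. (if t < 0 then t < x \<and> x < 0 else 0 < x \<and> x < t) \<and>
      (1 + t) powr q = (\<Sum>m<2. diff m 0 / fact m * (t - 0) ^ m) + diff 2 x / fact 2 * (t - 0) ^ 2"
    proof (rule Taylor[where n = 2 and a = "-1/2" and b = "1/2" and diff = diff])
      show "\<forall>m t. m < 2 \<and> - 1 / 2 \<le> t \<and> t \<le> 1 / 2 \<longrightarrow> (diff m has_real_derivative diff (Suc m) t) (at t)"
      proof (intro allI impI)
        fix m :: nat and x :: real assume a: "m < 2 \<and> - 1 / 2 \<le> x \<and> x \<le> 1 / 2"
        then have "m = 0 \<or> m = 1" "\<bar>x\<bar> \<le> 1/2" by auto
        then show "(diff m has_real_derivative diff (Suc m) x) (at x)"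
          using D[of x] D2[of x] by (auto simp: diff_def)
      qed
    qed (use t False in \<open>auto simp: diff_def\<close>)
    then obtain x where x': "if t < 0 then t < x \<and> x < 0 else 0 < x \<and> x < t" and
      eq': "(1 + t) powr q = (\<Sum>m<2. diff m 0 / fact m * (t - 0) ^ m) + diff 2 x / fact 2 * (t - 0) ^ 2"
      by blast
    have x: "\<bar>x\<bar> \<le> 1/2" using x' t by (auto split: if_splits)
    have eq: "(1 + t) powr q = 1 + q * t + q * (q - 1) * (1 + x) powr (q - 2) / 2 * t\<^sup>2"
      unfolding eq' by (simp add: diff_def numeral_2_eq_2)
    have "(1 + x) powr (q - 2) \<le> 2"
    proof (cases "q \<ge> 2")
      case True
      have "(1 + x) powr (q - 2) \<le> 2 powr (q - 2)"
        using x True by (intro powr_mono2) auto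
      also have "\<dots> \<le> 2 powr 1" using q by (intro powr_mono) auto
      finally show ?thesis by simp
    next
      case False
      have "(1 + x) powr (q - 2) \<le> (1/2) powr (q - 2)"
        using x False by (intro powr_mono2') auto
      also have "\<dots> = 2 powr (2 - q)" by (simp add: powr_divide powr_minus_divide[symmetric])
      also have "\<dots> \<le> 2 powr 1" using q by (intro powr_mono) auto
      finally show ?thesis by simp
    qed
    moreover have "q * (q - 1) \<le> 3 * 2" using q by (intro mult_mono) auto
    ultimately have "q * (q - 1) * (1 + x) powr (q - 2) \<le> 6 * 2"
      using q by (intro mult_mono) auto
    then have "q * (q - 1) * (1 + x) powr (q - 2) / 2 * t\<^sup>2 \<le> 12 * t\<^sup>2"
      by (intro mult_right_mono) auto
    then show ?thesis using eq by simp
  qed simp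
qed

text \<open>When z dominates, smoothness is irrelevant: |s + z| <= 3 |z| gives 27 |z|^q, and the
  linear term is at most 12 |z|^q in size.\<close>

lemma abs_powr_add_le_large:
  fixes q s z :: real
  assumes q: "1 \<le> q" "q \<le> 3" and z: "\<bar>z\<bar> > \<bar>s\<bar> / 2"
  shows "\<bar>s + z\<bar> powr q \<le> \<bar>s\<bar> powr q + q * (sgn s * \<bar>s\<bar> powr (q - 1)) * z + 40 * \<bar>z\<bar> powr q"
proof -
  have "\<bar>s + z\<bar> powr q \<le> (3 * \<bar>z\<bar>) powr q" using q z by (intro powr_mono2) auto
  also have "\<dots> = 3 powr q * \<bar>z\<bar> powr q" by (simp add: powr_mult)
  also have "\<dots> \<le> 3 powr 3 * \<bar>z\<bar> powr q" using q by (intro mult_right_mono powr_mono) auto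
  finally have 1: "\<bar>s + z\<bar> powr q \<le> 27 * \<bar>z\<bar> powr q" by simp
  have "\<bar>q * (sgn s * \<bar>s\<bar> powr (q - 1)) * z\<bar> \<le> 3 * (4 * \<bar>z\<bar> powr (q - 1)) * \<bar>z\<bar>"
  proof -
    have "\<bar>s\<bar> powr (q - 1) \<le> (2 * \<bar>z\<bar>) powr (q - 1)" using q z by (intro powr_mono2) auto
    also have "\<dots> = 2 powr (q - 1) * \<bar>z\<bar> powr (q - 1)" by (simp add: powr_mult)
    also have "\<dots> \<le> 2 powr 2 * \<bar>z\<bar> powr (q - 1)" using q by (intro mult_right_mono powr_mono) auto
    finally have "\<bar>s\<bar> powr (q - 1) \<le> 4 * \<bar>z\<bar> powr (q - 1)" by simp
    moreover have "\<bar>sgn s\<bar> \<le> 1" by (auto simp: sgn_if)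
    ultimately have "\<bar>sgn s\<bar> * \<bar>s\<bar> powr (q - 1) \<le> 1 * (4 * \<bar>z\<bar> powr (q - 1))" by (intro mult_mono) auto
    then have "\<bar>sgn s * \<bar>s\<bar> powr (q - 1)\<bar> \<le> 4 * \<bar>z\<bar> powr (q - 1)" by (simp only: abs_mult abs_of_nonneg[OF powr_ge_zero])
    then show ?thesis using q unfolding abs_mult[of "q * _"] abs_mult[of q] by (intro mult_mono) auto
  qed
  also have "\<dots> = 12 * \<bar>z\<bar> powr q"
    using z by (auto simp: powr_diff)
  finally have 2: "- (12 * \<bar>z\<bar> powr q) \<le> q * (sgn s * \<bar>s\<bar> powr (q - 1)) * z" by linarith
  have "0 \<le> \<bar>s\<bar> powr q" "0 \<le> \<bar>z\<bar> powr q" by auto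
  with 1 2 show ?thesis by linarith
qed

text \<open>Scaling by s reduces this to 1 + t with |t| <= 1/2, where the power is smooth.\<close>

lemma abs_powr_add_le_small:
  fixes q s z :: real
  assumes q: "1 \<le> q" "q \<le> 3" and z: "\<bar>z\<bar> \<le> \<bar>s\<bar> / 2" "s \<noteq> 0"
  shows "\<bar>s + z\<bar> powr q \<le> \<bar>s\<bar> powr q + q * (sgn s * \<bar>s\<bar> powr (q - 1)) * z + 12 * (\<bar>s\<bar> powr (q - 2) * z\<^sup>2)"
proof -
  define t where "t = z / s"
  have t: "\<bar>t\<bar> \<le> 1/2" using z by (auto simp: t_def abs_divide divide_le_eq)
  have zt: "z = s * t" using z by (simp add: t_def)
  have "\<bar>s + z\<bar> = \<bar>s\<bar> * (1 + t)"
  proof -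
    have "s + z = s * (1 + t)" by (simp add: zt algebra_simps)
    moreover have "\<bar>1 + t\<bar> = 1 + t" using t by linarith
    ultimately show ?thesis by (metis abs_mult)
  qed
  then have "\<bar>s + z\<bar> powr q = \<bar>s\<bar> powr q * (1 + t) powr q" using t by (simp add: powr_mult)
  also have "\<dots> \<le> \<bar>s\<bar> powr q * (1 + q * t + 12 * t\<^sup>2)"
    using powr_one_plus_le[OF q t] by (intro mult_left_mono) auto
  also have "\<dots> = \<bar>s\<bar> powr q + q * (\<bar>s\<bar> powr q * t) + 12 * (\<bar>s\<bar> powr q * t\<^sup>2)"
    by (simp add: algebra_simps)
  also have "\<bar>s\<bar> powr q * t = sgn s * \<bar>s\<bar> powr (q - 1) * z"
    using z by (auto simp: powr_diff t_def sgn_if field_simps)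
  also have "\<bar>s\<bar> powr q * t\<^sup>2 = \<bar>s\<bar> powr (q - 2) * z\<^sup>2"
    using z by (auto simp: powr_diff t_def field_simps)
  finally show ?thesis by (simp add: algebra_simps)
qed

text \<open>The linear term carries the derivative of |s|^q, so it disappears when z is a centred
  variable independent of s. What remains can be absorbed by an induction over the summands.\<close>

lemma abs_powr_add_le_2_3:
  fixes q s z :: real
  assumes q: "2 \<le> q" "q \<le> 3"
  shows "\<bar>s + z\<bar> powr q \<le> \<bar>s\<bar> powr q + q * (sgn s * \<bar>s\<bar> powr (q - 1)) * z
           + 40 * (\<bar>s\<bar> powr (q - 2) * z\<^sup>2 + \<bar>z\<bar> powr q)"
proof (cases "\<bar>z\<bar> > \<bar>s\<bar> / 2")
  case True
  have "0 \<le> \<bar>s\<bar> powr (q - 2) * z\<^sup>2" by simp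
  then show ?thesis using abs_powr_add_le_large[OF _ _ True, of q] q
    unfolding distrib_left[of 40] by linarith
next
  case False
  show ?thesis
  proof (cases "s = 0")
    case True then show ?thesis using False by simp
  next
    case s: False
    have "0 \<le> \<bar>s\<bar> powr (q - 2) * z\<^sup>2" "0 \<le> \<bar>z\<bar> powr q" by auto
    then show ?thesis using abs_powr_add_le_small[of q z s] q s False
      unfolding distrib_left[of 40] by linarith
  qed
qed

lemma abs_powr_add_le_1_2:
  fixes q s z :: real
  assumes q: "1 \<le> q" "q \<le> 2"
  shows "\<bar>s + z\<bar> powr q \<le> \<bar>s\<bar> powr q + q * (sgn s * \<bar>s\<bar> powr (q - 1)) * z + 40 * \<bar>z\<bar> powr q"
proof (cases "\<bar>z\<bar> > \<bar>s\<bar> / 2")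
  case True
  then show ?thesis using abs_powr_add_le_large[OF _ _ True, of q] q by linarith
next
  case False
  show ?thesis
  proof (cases "s = 0 \<or> z = 0")
    case True then show ?thesis using False by auto
  next
    case s: False
    \<comment> \<open>For q <= 2 the exponent is nonpositive, so passing from s to the smaller z
      increases the power; the variance-type term is swallowed by |z|^q.\<close>
    have "\<bar>s\<bar> powr (q - 2) \<le> \<bar>z\<bar> powr (q - 2)"
      using q s False by (intro powr_mono2') auto
    then have "\<bar>s\<bar> powr (q - 2) * z\<^sup>2 \<le> \<bar>z\<bar> powr (q - 2) * z\<^sup>2" by (intro mult_right_mono) auto
    also have "\<dots> = \<bar>z\<bar> powr q" using s by (simp add: powr_diff)
    finally have "12 * (\<bar>s\<bar> powr (q - 2) * z\<^sup>2) \<le> 40 * \<bar>z\<bar> powr q"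
      using powr_ge_zero[of "\<bar>z\<bar>" q] by linarith
    then show ?thesis using abs_powr_add_le_small[of q z s] q s False by linarith
  qed
qed

text \<open>A stand-in for Jensen's inequality: if \<open>a\<close> bounds the second moment of x,
  integration gives E |x|^(2 \<theta>) <= 2 a^\<theta>, with only a factor 2 lost.\<close>

lemma powr_le_scaled:
  fixes a x \<theta> :: real
  assumes "0 < a" "0 \<le> \<theta>" "\<theta> \<le> 1"
  shows "\<bar>x\<bar> powr (2 * \<theta>) \<le> a powr \<theta> * (1 + x\<^sup>2 / a)"
proof -
  have "\<bar>x\<bar> powr (2 * \<theta>) = (\<bar>x\<bar> powr 2) powr \<theta>" by (simp only: powr_powr)
  also have "\<bar>x\<bar> powr 2 = a * (x\<^sup>2 / a)" using assms by (cases "x = 0") (auto simp: powr_numeral)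
  also have "\<dots> powr \<theta> = a powr \<theta> * (x\<^sup>2 / a) powr \<theta>" by (rule powr_mult)
  also have "(x\<^sup>2 / a) powr \<theta> \<le> (1 + x\<^sup>2 / a) powr \<theta>" using assms by (intro powr_mono2) auto
  also have "(1 + x\<^sup>2 / a) powr \<theta> \<le> (1 + x\<^sup>2 / a) powr 1" using assms by (intro powr_mono) auto
  finally show ?thesis using assms by (simp add: add_nonneg_nonneg mult_left_mono)
qed

text \<open>Interpolates between the quadratic bound near 0 and the linear one far away, so that a
  moment of order r of the argument suffices.\<close>

lemma cmod_iexp_diff_le:
  fixes a r :: real
  assumes "1 \<le> r" "r \<le> 2"
  shows "cmod (iexp a - 1 - \<i> * a) \<le> 2 * \<bar>a\<bar> powr r"
proof (cases "\<bar>a\<bar> \<le> 1")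
  case True
  have "cmod (iexp a - 1 - \<i> * a) \<le> \<bar>a\<bar>\<^sup>2 / 2"
    using iexp_approx1[of a 1] by (simp add: numeral_2_eq_2 algebra_simps)
  also have "\<dots> \<le> \<bar>a\<bar>\<^sup>2" by simp
  also have "\<bar>a\<bar>\<^sup>2 = \<bar>a\<bar> powr 2" by (cases "a = 0") (auto simp: powr_numeral)
  also have "\<bar>a\<bar> powr 2 \<le> \<bar>a\<bar> powr r"
  proof (cases "a = 0")
    case False
    then show ?thesis using True assms by (intro powr_mono') auto
  qed simp
  also have "\<bar>a\<bar> powr r \<le> 2 * \<bar>a\<bar> powr r" by simp
  finally show ?thesis .
next
  case False
  have "cmod (iexp a - 1 - \<i> * a) \<le> 2 * \<bar>a\<bar>"
    using iexp_approx2[of a 1] by (simp add: numeral_2_eq_2 algebra_simps)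
  also have "\<bar>a\<bar> = \<bar>a\<bar> powr 1" by simp
  also have "\<dots> \<le> \<bar>a\<bar> powr r" using False assms by (intro powr_mono) auto
  finally show ?thesis by simp
qed

text \<open>After division by a + b both terms lie in [0, 1], where x <= x^\<theta>.\<close>

lemma powr_add_le_add_powr:
  fixes a b \<theta> :: real
  assumes "0 \<le> a" "0 \<le> b" "0 \<le> \<theta>" "\<theta> \<le> 1"
  shows "(a + b) powr \<theta> \<le> a powr \<theta> + b powr \<theta>"
proof (cases "a + b = 0")
  case False
  then have pos: "a + b > 0" using assms by auto
  have *: "x / (a + b) \<le> (x / (a + b)) powr \<theta>" if "0 \<le> x" "x \<le> a + b" for x
  proof (cases "x = 0")
    case False
    then have "(x / (a + b)) powr 1 \<le> (x / (a + b)) powr \<theta>"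
      using that pos assms by (intro powr_mono') auto
    then show ?thesis using that pos by simp
  qed simp
  have "1 = a / (a + b) + b / (a + b)" using pos by (simp flip: add_divide_distrib)
  also have "\<dots> \<le> (a / (a + b)) powr \<theta> + (b / (a + b)) powr \<theta>"
    using assms by (intro add_mono *) auto
  finally have "1 \<le> (a powr \<theta> + b powr \<theta>) / (a + b) powr \<theta>"
    using assms by (simp add: powr_divide add_divide_distrib)
  then show ?thesis using pos by (simp add: le_divide_eq)
qed auto

lemma powr_sum_le_sum_powr:
  fixes f :: "'i \<Rightarrow> real" and \<theta> :: real
  assumes "finite A" "\<And>i. i \<in> A \<Longrightarrow> 0 \<le> f i" "0 < \<theta>" "\<theta> \<le> 1"
  shows "(\<Sum>i\<in>A. f i) powr \<theta> \<le> (\<Sum>i\<in>A. f i powr \<theta>)"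
  using assms(1,2)
proof (induction A rule: finite_induct)
  case (insert i A)
  have "(f i + (\<Sum>i\<in>A. f i)) powr \<theta> \<le> f i powr \<theta> + (\<Sum>i\<in>A. f i) powr \<theta>"
    using insert assms by (intro powr_add_le_add_powr sum_nonneg) auto
  then show ?case using insert by fastforce
qed simp

lemma powr_add_le_scaled:
  fixes a b q :: real
  assumes "0 \<le> a" "0 \<le> b" "0 \<le> q"
  shows "(a + b) powr q \<le> 2 powr q * (a powr q + b powr q)"
proof -
  have "(a + b) powr q \<le> (2 * max a b) powr q" using assms by (intro powr_mono2) auto
  also have "\<dots> = 2 powr q * max a b powr q" using assms by (simp add: powr_mult)
  also have "max a b powr q \<le> a powr q + b powr q" by (auto simp: max_def)
  finally show ?thesis by (simp add: mult_left_mono)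
qed

subsection \<open>Sums of independent centred variables\<close>

context prob_space
begin

abbreviation iid :: "'i set \<Rightarrow> ('i \<Rightarrow> 'a) measure" where
  "iid J \<equiv> PiM J (\<lambda>_. M)"

lemma prob_space_iid: "prob_space (iid J)"
  by (intro prob_space_PiM prob_space_axioms)

lemma integrable_bounded:
  fixes f :: "'a \<Rightarrow> 'b::{banach,second_countable_topology}"
  assumes "f \<in> borel_measurable M" "\<And>x. x \<in> space M \<Longrightarrow> norm (f x) \<le> B"
  shows "integrable M f"
  using assms by (intro integrable_const_bound[of _ B] AE_I2) auto

lemma integral_iid_insert:
  fixes f :: "('i \<Rightarrow> 'a) \<Rightarrow> 'b::{banach,second_countable_topology}"
  assumes "finite J" "i \<notin> J" "f \<in> borel_measurable (iid (insert i J))"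
    and "\<And>y. y \<in> space (iid (insert i J)) \<Longrightarrow> norm (f y) \<le> B"
  shows "(\<integral>y. f y \<partial>iid (insert i J)) = (\<integral>y. (\<integral>x. f (y(i := x)) \<partial>M) \<partial>iid J)"
proof -
  interpret P: product_prob_space "\<lambda>_. M" by unfold_locales
  show ?thesis
    using assms by (intro P.product_integral_insert prob_space.integrable_bounded[OF prob_space_iid]) auto
qed

lemma abs_integral_le_bound:
  fixes f :: "'a \<Rightarrow> real"
  assumes "f \<in> borel_measurable M" "\<And>x. x \<in> space M \<Longrightarrow> \<bar>f x\<bar> \<le> B"
  shows "\<bar>\<integral>x. f x \<partial>M\<bar> \<le> B"
proof -
  have "\<bar>\<integral>x. f x \<partial>M\<bar> \<le> (\<integral>x. \<bar>f x\<bar> \<partial>M)" by (rule integral_abs_bound)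
  also have "\<dots> \<le> B"
    using assms by (intro integral_le_const integrable_bounded[of _ B] AE_I2) auto
  finally show ?thesis .
qed

lemma integral_nonneg_le_bound:
  fixes f :: "'a \<Rightarrow> real"
  assumes "f \<in> borel_measurable M" "\<And>x. x \<in> space M \<Longrightarrow> 0 \<le> f x" "\<And>x. x \<in> space M \<Longrightarrow> f x \<le> B"
  shows "(\<integral>x. f x \<partial>M) \<le> B"
  using abs_integral_le_bound[of f B] assms by simp

end

text \<open>The sample is a point y of a product space rather than a family of random variables.
  Adding an observation is then \<open>integral_iid_insert\<close>, and conditioning on the others
  is an inner integral.\<close>

locale centred_rv = prob_space M for M :: "'a measure" +
  fixes f :: "'a \<Rightarrow> real" and B :: real
  assumes f_meas [measurable]: "f \<in> borel_measurable M"
    and f_bdd: "\<And>x. x \<in> space M \<Longrightarrow> \<bar>f x\<bar> \<le> B"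
    and f_mean: "(\<integral>x. f x \<partial>M) = 0"
begin

definition S :: "'i set \<Rightarrow> ('i \<Rightarrow> 'a) \<Rightarrow> real" where
  "S J y = (\<Sum>k\<in>J. f (y k))"

lemma S_measurable [measurable]: "finite J \<Longrightarrow> S J \<in> borel_measurable (iid J)"
  unfolding S_def by measurable

lemma S_bdd: "finite J \<Longrightarrow> y \<in> space (iid J) \<Longrightarrow> \<bar>S J y\<bar> \<le> card J * B"
  unfolding S_def
  by (rule order_trans[OF sum_abs], rule order_trans[OF sum_bounded_above[where K = B]])
     (auto intro!: f_bdd simp: space_PiM)

lemma S_insert:
  assumes "finite J" "i \<notin> J"
  shows "S (insert i J) (y(i := x)) = S J y + f x"
proof -
  have "(\<Sum>k\<in>J. f ((y(i := x)) k)) = (\<Sum>k\<in>J. f (y k))"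
    using assms by (intro sum.cong) auto
  then show ?thesis using assms by (simp add: S_def)
qed

lemma integrable_f: "integrable M f"
  using f_bdd by (intro integrable_bounded[of _ B]) auto

lemma integrable_f_sq: "integrable M (\<lambda>x. (f x)\<^sup>2)"
  using power_mono[OF f_bdd abs_ge_zero, of _ 2] by (intro integrable_bounded[of _ "B\<^sup>2"]) auto

lemma abs_f_powr_bdd: "0 \<le> q \<Longrightarrow> x \<in> space M \<Longrightarrow> \<bar>f x\<bar> powr q \<le> B powr q"
  using f_bdd by (intro powr_mono2) auto

lemma integrable_f_powr: "0 \<le> q \<Longrightarrow> integrable M (\<lambda>x. \<bar>f x\<bar> powr q)"
  using abs_f_powr_bdd by (intro integrable_bounded[of _ "B powr q"]) auto

lemma integrable_S_powr:
  assumes "finite J" "0 \<le> q"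
  shows "integrable (iid J) (\<lambda>y. \<bar>S J y\<bar> powr q)"
  using assms S_bdd
  by (intro prob_space.integrable_bounded[OF prob_space_iid, of _ _ "(card J * B) powr q"])
     (auto intro!: powr_mono2)

lemma integrable_S_sq:
  assumes "finite J"
  shows "integrable (iid J) (\<lambda>y. (S J y)\<^sup>2)"
  using assms power_mono[OF S_bdd abs_ge_zero, of J _ 2]
  by (intro prob_space.integrable_bounded[OF prob_space_iid, of _ _ "(card J * B)\<^sup>2"]) auto

lemma integral_S_sq:
  assumes "finite J"
  shows "(\<integral>y. (S J y)\<^sup>2 \<partial>iid J) = card J * (\<integral>x. (f x)\<^sup>2 \<partial>M)"
  using assms
proof (induction J rule: finite_induct)
  case empty
  then show ?case by (simp add: S_def)
next
  case (insert i J)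
  interpret J: prob_space "iid J" by (rule prob_space_iid)
  have "(\<integral>y. (S (insert i J) y)\<^sup>2 \<partial>iid (insert i J)) = (\<integral>y. (\<integral>x. (S J y + f x)\<^sup>2 \<partial>M) \<partial>iid J)"
    using insert power_mono[OF S_bdd abs_ge_zero, of "insert i J" _ 2]
    by (subst integral_iid_insert[where B = "(card (insert i J) * B)\<^sup>2"]) (auto simp: S_insert)
  also have "\<dots> = (\<integral>y. (S J y)\<^sup>2 + (\<integral>x. (f x)\<^sup>2 \<partial>M) \<partial>iid J)"
  proof (rule Bochner_Integration.integral_cong[OF refl])
    fix y
    have "(\<integral>x. (S J y + f x)\<^sup>2 \<partial>M) = (\<integral>x. (S J y)\<^sup>2 + (2 * S J y * f x + (f x)\<^sup>2) \<partial>M)"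
      by (simp add: power2_eq_square algebra_simps)
    also have "\<dots> = (S J y)\<^sup>2 + (\<integral>x. (f x)\<^sup>2 \<partial>M)"
      using integrable_f integrable_f_sq by (simp add: f_mean prob_space)
    finally show "(\<integral>x. (S J y + f x)\<^sup>2 \<partial>M) = (S J y)\<^sup>2 + (\<integral>x. (f x)\<^sup>2 \<partial>M)" .
  qed
  also have "\<dots> = card (insert i J) * (\<integral>x. (f x)\<^sup>2 \<partial>M)"
    using insert integrable_S_sq[of J] by (simp add: J.prob_space algebra_simps)
  finally show ?case .
qed

text \<open>The von Bahr-Esseen inequality. Each new summand costs 40 E |f|^r, because the linear
  term integrates to 0.\<close>

lemma integral_S_powr_1_2:
  assumes J: "finite J" and r: "1 \<le> r" "r \<le> 2"
  shows "(\<integral>y. \<bar>S J y\<bar> powr r \<partial>iid J) \<le> 40 * (card J * (\<integral>x. \<bar>f x\<bar> powr r \<partial>M))"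
  using J
proof (induction J rule: finite_induct)
  case empty
  then show ?case by (simp add: S_def)
next
  case (insert i J)
  interpret J: prob_space "iid J" by (rule prob_space_iid)
  let ?A = "\<integral>x. \<bar>f x\<bar> powr r \<partial>M"
  have le: "(\<integral>x. \<bar>S J y + f x\<bar> powr r \<partial>M) \<le> \<bar>S J y\<bar> powr r + 40 * ?A" if y: "y \<in> space (iid J)" for y
  proof -
    let ?d = "r * (sgn (S J y) * \<bar>S J y\<bar> powr (r - 1))"
    have "(\<integral>x. \<bar>S J y + f x\<bar> powr r \<partial>M) \<le> (\<integral>x. \<bar>S J y\<bar> powr r + ?d * f x + 40 * \<bar>f x\<bar> powr r \<partial>M)"
    proof (rule integral_mono)
      show "integrable M (\<lambda>x. \<bar>S J y + f x\<bar> powr r)"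
        using r f_bdd by (intro integrable_bounded[of _ "(\<bar>S J y\<bar> + B) powr r"])
          (auto intro!: powr_mono2 order_trans[OF abs_triangle_ineq])
    qed (use abs_powr_add_le_1_2[OF r] integrable_f integrable_f_powr[of r] r in auto)
    also have "\<dots> = \<bar>S J y\<bar> powr r + 40 * ?A"
      using r integrable_f integrable_f_powr[of r] by (simp add: f_mean prob_space)
    finally show ?thesis .
  qed
  have "(\<integral>y. \<bar>S (insert i J) y\<bar> powr r \<partial>iid (insert i J)) = (\<integral>y. (\<integral>x. \<bar>S J y + f x\<bar> powr r \<partial>M) \<partial>iid J)"
    using insert r S_bdd[of "insert i J"]
    by (subst integral_iid_insert[where B = "(card (insert i J) * B) powr r"])
       (auto simp: S_insert simp del: card_insert_disjoint intro!: powr_mono2)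
  also have "\<dots> \<le> (\<integral>y. \<bar>S J y\<bar> powr r + 40 * ?A \<partial>iid J)"
  proof (rule integral_mono)
    show "integrable (iid J) (\<lambda>y. \<integral>x. \<bar>S J y + f x\<bar> powr r \<partial>M)"
      using insert r f_bdd S_bdd[of J]
      by (intro J.integrable_bounded[of _ "(card J * B + B) powr r"])
         (auto intro!: integral_nonneg_le_bound powr_mono2 order_trans[OF abs_triangle_ineq] add_mono)
  qed (use le integrable_S_powr[of J r] insert r in auto)
  also have "\<dots> = (\<integral>y. \<bar>S J y\<bar> powr r \<partial>iid J) + 40 * ?A"
    using insert r integrable_S_powr[of J r] by (simp add: J.prob_space)
  also have "\<dots> \<le> 40 * (card J * ?A) + 40 * ?A"
    using insert by simp
  also have "\<dots> = 40 * (card (insert i J) * ?A)"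
    using insert by (simp add: algebra_simps)
  finally show ?case .
qed

text \<open>Rosenthal's inequality for exponents between 2 and 3. There the lower moment E |S|^(q -
  2) that appears in the increment has exponent at most 1 and is controlled by the variance alone,
  so a single induction suffices.\<close>

lemma integral_S_powr_2_3:
  assumes J: "finite J" and q: "2 \<le> q" "q \<le> 3"
  shows "(\<integral>y. \<bar>S J y\<bar> powr q \<partial>iid J)
    \<le> 80 * (card J * (\<integral>x. \<bar>f x\<bar> powr q \<partial>M) + (card J * (\<integral>x. (f x)\<^sup>2 \<partial>M)) powr (q / 2))"
proof -
  let ?v = "\<integral>x. (f x)\<^sup>2 \<partial>M" and ?A = "\<integral>x. \<bar>f x\<bar> powr q \<partial>M"
  have v0: "0 \<le> ?v" and A0: "0 \<le> ?A" by (auto intro!: Bochner_Integration.integral_nonneg)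
  \<comment> \<open>The size of the full index set is frozen: the bound on E |S|^(q - 2) is then the
    same at every stage of the induction, and the increments add up linearly.\<close>
  define m where "m = card J"
  define a where "a = real m * ?v"
  have bound: "(\<integral>y. \<bar>S J y\<bar> powr (q - 2) \<partial>iid J) * ?v \<le> 2 * a powr (q / 2 - 1) * ?v"
    if J: "finite J" "card J \<le> m" "J \<noteq> {}" for J :: "'b set"
  proof (cases "?v = 0")
    case False
    interpret J: prob_space "iid J" by (rule prob_space_iid)
    have "card J > 0" using J by (simp add: card_gt_0_iff)
    moreover have "?v > 0" using False v0 by linarith
    ultimately have a: "a > 0" using J unfolding a_def by (intro mult_pos_pos) linarith+
    have "(\<integral>y. \<bar>S J y\<bar> powr (q - 2) \<partial>iid J)
      \<le> (\<integral>y. a powr (q / 2 - 1) * (1 + (S J y)\<^sup>2 / a) \<partial>iid J)"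
    proof (rule integral_mono)
      show "\<bar>S J y\<bar> powr (q - 2) \<le> a powr (q / 2 - 1) * (1 + (S J y)\<^sup>2 / a)" for y
        using powr_le_scaled[of a "q / 2 - 1" "S J y"] a q by (simp add: algebra_simps)
    qed (use integrable_S_powr[of J "q - 2"] integrable_S_sq[of J] J q in auto)
    also have "\<dots> = a powr (q / 2 - 1) * (1 + card J * ?v / a)"
      using integrable_S_sq[of J] J by (simp add: J.prob_space integral_S_sq)
    also have "\<dots> \<le> a powr (q / 2 - 1) * (1 + 1)"
    proof (intro mult_left_mono add_left_mono)
      have "card J * ?v \<le> a" using J v0 by (auto simp: a_def intro!: mult_right_mono)
      then show "card J * ?v / a \<le> 1" using a by simp
    qed simp
    finally show ?thesis using v0 by (intro mult_right_mono) auto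
  qed simp
  have "(\<integral>y. \<bar>S J y\<bar> powr q \<partial>iid J) \<le> 80 * (card J * (?A + a powr (q / 2 - 1) * ?v))"
    if "card J \<le> m" "finite J" for J :: "'b set"
    using that(2,1)
  proof (induction J rule: finite_induct)
    case empty
    then show ?case by (simp add: S_def)
  next
    case (insert i J)
    interpret J: prob_space "iid J" by (rule prob_space_iid)
    have le: "(\<integral>x. \<bar>S J y + f x\<bar> powr q \<partial>M) \<le> \<bar>S J y\<bar> powr q + 40 * (\<bar>S J y\<bar> powr (q - 2) * ?v + ?A)"
      if y: "y \<in> space (iid J)" for y
    proof -
      let ?d = "q * (sgn (S J y) * \<bar>S J y\<bar> powr (q - 1))"
      have "(\<integral>x. \<bar>S J y + f x\<bar> powr q \<partial>M) \<le>
        (\<integral>x. \<bar>S J y\<bar> powr q + ?d * f x + 40 * (\<bar>S J y\<bar> powr (q - 2) * (f x)\<^sup>2 + \<bar>f x\<bar> powr q) \<partial>M)"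
      proof (rule integral_mono)
        show "integrable M (\<lambda>x. \<bar>S J y + f x\<bar> powr q)"
          using q f_bdd by (intro integrable_bounded[of _ "(\<bar>S J y\<bar> + B) powr q"])
            (auto intro!: powr_mono2 order_trans[OF abs_triangle_ineq])
      qed (use abs_powr_add_le_2_3[OF q] integrable_f integrable_f_sq integrable_f_powr[of q] q in auto)
      also have "\<dots> = \<bar>S J y\<bar> powr q + 40 * (\<bar>S J y\<bar> powr (q - 2) * ?v + ?A)"
        using q integrable_f integrable_f_sq integrable_f_powr[of q] by (simp add: f_mean prob_space)
      finally show ?thesis .
    qed
    have "(\<integral>y. \<bar>S (insert i J) y\<bar> powr q \<partial>iid (insert i J)) = (\<integral>y. (\<integral>x. \<bar>S J y + f x\<bar> powr q \<partial>M) \<partial>iid J)"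
      using insert q S_bdd[of "insert i J"]
      by (subst integral_iid_insert[where B = "(card (insert i J) * B) powr q"])
         (auto simp: S_insert simp del: card_insert_disjoint intro!: powr_mono2)
    also have "\<dots> \<le> (\<integral>y. \<bar>S J y\<bar> powr q + 40 * (\<bar>S J y\<bar> powr (q - 2) * ?v + ?A) \<partial>iid J)"
    proof (rule integral_mono)
      show "integrable (iid J) (\<lambda>y. \<integral>x. \<bar>S J y + f x\<bar> powr q \<partial>M)"
        using insert q f_bdd S_bdd[of J]
        by (intro J.integrable_bounded[of _ "(card J * B + B) powr q"])
           (auto intro!: integral_nonneg_le_bound powr_mono2 order_trans[OF abs_triangle_ineq] add_mono)
    qed (use le integrable_S_powr[of J q] integrable_S_powr[of J "q - 2"] insert q in auto)
    also have "\<dots> = (\<integral>y. \<bar>S J y\<bar> powr q \<partial>iid J) + 40 * ((\<integral>y. \<bar>S J y\<bar> powr (q - 2) \<partial>iid J) * ?v + ?A)"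
      using insert q integrable_S_powr[of J q] integrable_S_powr[of J "q - 2"] by (simp add: J.prob_space)
    also have "\<dots> \<le> 80 * (card J * (?A + a powr (q / 2 - 1) * ?v)) + 40 * (2 * a powr (q / 2 - 1) * ?v + 2 * ?A)"
    proof (cases "J = {}")
      \<comment> \<open>\<open>bound\<close> needs a nonempty set in order to have a > 0. For the
        first summand S is 0, and so is its power with exponent q - 2, even for q = 2, since 0 powr
        0 = 0.\<close>
      case True
      then show ?thesis using A0 v0 q by (simp add: S_def)
    next
      case False
      then show ?thesis using insert A0 bound[of J] by (intro add_mono mult_left_mono) auto
    qed
    also have "\<dots> = 80 * (card (insert i J) * (?A + a powr (q / 2 - 1) * ?v))"
      using insert by (simp add: algebra_simps)
    finally show ?case .
  qed
  from this[of J] have "(\<integral>y. \<bar>S J y\<bar> powr q \<partial>iid J) \<le> 80 * (card J * (?A + a powr (q / 2 - 1) * ?v))"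
    using J by (simp add: m_def)
  also have "card J * (?A + a powr (q / 2 - 1) * ?v) = card J * ?A + a powr (q / 2 - 1) * a"
    by (simp add: a_def m_def algebra_simps)
  also have "a powr (q / 2 - 1) * a = a powr (q / 2)"
    using v0 by (cases "a = 0") (auto simp: powr_diff a_def)
  finally show ?thesis by (simp add: a_def m_def)
qed

end

subsection \<open>Degenerate kernels of order two\<close>

text \<open>The bound on h is demanded on the whole type and not only on \<open>space M\<close>, so
  that the bounds for H and W carry no side condition on the sample.\<close>

locale degenerate_kernel = prob_space M for M :: "'a measure" +
  fixes h :: "'a \<Rightarrow> 'a \<Rightarrow> real" and B :: real
  assumes h_meas: "(\<lambda>(x, y). h x y) \<in> borel_measurable (M \<Otimes>\<^sub>M M)"
    and h_bdd: "\<And>x y. \<bar>h x y\<bar> \<le> B"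
    and h_sym: "\<And>x y. h x y = h y x"
    and h_degenerate: "\<And>x. x \<in> space M \<Longrightarrow> (\<integral>y. h x y \<partial>M) = 0"
begin

lemma h_compose [measurable (raw)]:
  assumes "f \<in> measurable N M" "g \<in> measurable N M"
  shows "(\<lambda>w. h (f w) (g w)) \<in> borel_measurable N"
proof -
  have "(\<lambda>w. (f w, g w)) \<in> measurable N (M \<Otimes>\<^sub>M M)" using assms by measurable
  from measurable_compose[OF this h_meas] show ?thesis by simp
qed

lemma h_measurable_right [measurable]: "x \<in> space M \<Longrightarrow> h x \<in> borel_measurable M"
  by (rule h_compose[of "\<lambda>_. x" M "\<lambda>y. y"]) auto

lemma B_nonneg: "0 \<le> B"
  using h_bdd[of undefined undefined] by linarith

text \<open>The kernel of the square of the integral operator with kernel h; equally, the covariance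
  of h(x, Z) and h(y, Z).\<close>

definition G :: "'a \<Rightarrow> 'a \<Rightarrow> real" where
  "G x y = (\<integral>z. h x z * h y z \<partial>M)"

text \<open>By the form of G this is E h(X, Y)^2, the squared Hilbert-Schmidt norm of the
  operator.\<close>

definition V :: real where
  "V = (\<integral>x. G x x \<partial>M)"

text \<open>The sum over ordered pairs, halved, needs no order on the index set, so any observation
  can be singled out.\<close>

definition W :: "'i set \<Rightarrow> ('i \<Rightarrow> 'a) \<Rightarrow> real" where
  "W I y = (1 / 2) * (\<Sum>i\<in>I. \<Sum>k\<in>I - {i}. h (y i) (y k))"

text \<open>The increment of W when x joins the sample: for a fixed sample, a centred function of
  x.\<close>

definition H :: "'i set \<Rightarrow> ('i \<Rightarrow> 'a) \<Rightarrow> 'a \<Rightarrow> real" where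
  "H J y x = (\<Sum>k\<in>J. h x (y k))"

definition charf :: "'i set \<Rightarrow> real \<Rightarrow> complex" where
  "charf I t = (\<integral>y. iexp (t * W I y) \<partial>iid I)"

lemma hh_bdd: "\<bar>h x z * h y z\<bar> \<le> B\<^sup>2"
  unfolding abs_mult power2_eq_square by (intro mult_mono h_bdd B_nonneg) auto

lemma G_bdd: "\<bar>G x y\<bar> \<le> B\<^sup>2"
proof (cases "(\<lambda>z. h x z * h y z) \<in> borel_measurable M")
  case True
  then show ?thesis unfolding G_def by (intro abs_integral_le_bound hh_bdd)
next
  \<comment> \<open>For x or y outside \<open>space M\<close> the integrand may fail to be
    measurable. The integral is then 0 by convention, which keeps the bound valid for all
    arguments.\<close>
  case False
  then have "\<not> integrable M (\<lambda>z. h x z * h y z)" using borel_measurable_integrable by blast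
  then show ?thesis by (simp add: G_def not_integrable_integral_eq)
qed

lemma G_meas: "(\<lambda>(x, y). G x y) \<in> borel_measurable (M \<Otimes>\<^sub>M M)"
  unfolding G_def by measurable

lemma G_nonneg: "0 \<le> G x x"
  unfolding G_def by (intro Bochner_Integration.integral_nonneg) auto

lemma V_nonneg: "0 \<le> V"
  unfolding V_def by (intro Bochner_Integration.integral_nonneg G_nonneg)

lemma fubini_bounded:
  fixes f :: "'b \<Rightarrow> 'c \<Rightarrow> real"
  assumes "prob_space N" "prob_space N'" "(\<lambda>(x, y). f x y) \<in> borel_measurable (N \<Otimes>\<^sub>M N')"
    and "\<And>x y. x \<in> space N \<Longrightarrow> y \<in> space N' \<Longrightarrow> \<bar>f x y\<bar> \<le> K"
  shows "(\<integral>y. (\<integral>x. f x y \<partial>N) \<partial>N') = (\<integral>x. (\<integral>y. f x y \<partial>N') \<partial>N)"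
proof -
  interpret N: prob_space N by fact
  interpret N': prob_space N' by fact
  interpret P: pair_prob_space N N' ..
  show ?thesis
    using assms by (intro P.Fubini_integral P.P.integrable_bounded[of _ K]) (auto simp: space_pair_measure)
qed

lemma G_degenerate: "x \<in> space M \<Longrightarrow> (\<integral>y. G x y \<partial>M) = 0"
proof -
  assume [measurable]: "x \<in> space M"
  have "(\<integral>y. G x y \<partial>M) = (\<integral>z. (\<integral>y. h x z * h y z \<partial>M) \<partial>M)"
    unfolding G_def using hh_bdd
    by (intro fubini_bounded[where K = "B\<^sup>2"] prob_space_axioms) auto
  also have "\<dots> = (\<integral>z. h x z * (\<integral>y. h z y \<partial>M) \<partial>M)"
    by (simp add: h_sym[of _ z for z])
  also have "\<dots> = (\<integral>z. 0 \<partial>M)"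
    by (intro Bochner_Integration.integral_cong) (auto simp: h_degenerate)
  finally show ?thesis by simp
qed

text \<open>Allows the locale to be applied to its own output: the off-diagonal part of the
  conditional variance is twice \<open>W\<close> of the kernel G, and its second moment comes from
  \<open>integral_W_sq\<close>.\<close>

lemma degenerate_kernel_G: "degenerate_kernel M G (B\<^sup>2)"
proof
  show "G x y = G y x" for x y by (simp add: G_def mult.commute)
qed (use G_meas G_bdd G_degenerate in auto)

lemma H_measurable [measurable (raw)]:
  assumes "finite J" "f \<in> measurable N (iid J)" "g \<in> measurable N M"
  shows "(\<lambda>w. H J (f w) (g w)) \<in> borel_measurable N"
  unfolding H_def using assms by measurable

lemma W_measurable [measurable]:
  assumes "finite I"
  shows "W I \<in> borel_measurable (iid I)"
  unfolding W_def using assms by measurable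

lemma centred_rv_h: "x \<in> space M \<Longrightarrow> centred_rv M (h x) B"
  by unfold_locales (auto simp: h_bdd h_degenerate)

lemma H_eq_S: "x \<in> space M \<Longrightarrow> H J y x = centred_rv.S (h x) J y"
  by (simp add: H_def centred_rv.S_def[OF centred_rv_h])

lemma H_bdd: "finite J \<Longrightarrow> \<bar>H J y x\<bar> \<le> card J * B"
  unfolding H_def
  by (rule order_trans[OF sum_abs], rule order_trans[OF sum_bounded_above[where K = B]])
     (auto intro!: h_bdd)

lemma W_bdd: "finite I \<Longrightarrow> \<bar>W I y\<bar> \<le> card I * (card I * B)"
proof -
  assume I: "finite I"
  have "\<bar>\<Sum>k\<in>I - {i}. h (y i) (y k)\<bar> \<le> card I * B" if "i \<in> I" for i
  proof -
    have "\<bar>\<Sum>k\<in>I - {i}. h (y i) (y k)\<bar> \<le> card (I - {i}) * B"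
      using H_bdd[of "I - {i}" y "y i"] I by (simp add: H_def)
    also have "\<dots> \<le> card I * B" using I B_nonneg by (intro mult_right_mono) (auto intro: card_mono)
    finally show ?thesis .
  qed
  then have "\<bar>\<Sum>i\<in>I. \<Sum>k\<in>I - {i}. h (y i) (y k)\<bar> \<le> card I * (card I * B)"
    using sum_bounded_above[of I "\<lambda>i. \<bar>\<Sum>k\<in>I - {i}. h (y i) (y k)\<bar>" "card I * B"]
    by (intro order_trans[OF sum_abs]) auto
  then show ?thesis by (simp add: W_def abs_mult)
qed

lemma H_sq_bdd: "finite J \<Longrightarrow> (H J y x)\<^sup>2 \<le> (card J * B)\<^sup>2"
  using power_mono[OF H_bdd abs_ge_zero, of J y x 2] by (simp only: power2_abs)

lemma W_sq_bdd: "finite J \<Longrightarrow> (W J y)\<^sup>2 \<le> (card J * (card J * B))\<^sup>2"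
  using power_mono[OF W_bdd abs_ge_zero, of J y 2] by (simp only: power2_abs)

lemma H_measurable_right [measurable]:
  "finite J \<Longrightarrow> y \<in> space (iid J) \<Longrightarrow> H J y \<in> borel_measurable M"
  by (rule H_measurable[of J "\<lambda>_. y" M "\<lambda>x. x"]) auto

lemma integrable_H: "finite J \<Longrightarrow> y \<in> space (iid J) \<Longrightarrow> integrable M (H J y)"
  using H_bdd[of J y] by (intro integrable_bounded[of _ "card J * B"]) auto

lemma integrable_H_sq: "finite J \<Longrightarrow> y \<in> space (iid J) \<Longrightarrow> integrable M (\<lambda>x. (H J y x)\<^sup>2)"
  using H_sq_bdd[of J y] by (intro integrable_bounded[of _ "(card J * B)\<^sup>2"]) auto

lemma v_bdd: "finite J \<Longrightarrow> y \<in> space (iid J) \<Longrightarrow> (\<integral>x. (H J y x)\<^sup>2 \<partial>M) \<le> (card J * B)\<^sup>2"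
  using H_sq_bdd[of J y] by (intro integral_nonneg_le_bound) auto

lemma v_measurable [measurable]:
  "finite J \<Longrightarrow> (\<lambda>y. \<integral>x. (H J y x)\<^sup>2 \<partial>M) \<in> borel_measurable (iid J)"
  by measurable

lemma integrable_v: "finite J \<Longrightarrow> integrable (iid J) (\<lambda>y. \<integral>x. (H J y x)\<^sup>2 \<partial>M)"
  using v_bdd[of J] by (intro prob_space.integrable_bounded[OF prob_space_iid, of _ _ "(card J * B)\<^sup>2"]) auto

lemma H_fun_upd: "i \<notin> J \<Longrightarrow> H J (y(i := x)) x' = H J y x'"
  unfolding H_def by (intro sum.cong) auto

lemma W_fun_upd: "i \<notin> J \<Longrightarrow> W J (y(i := x)) = W J y"
  unfolding W_def by (intro arg_cong[where f = "\<lambda>s. (1/2) * s"] sum.cong) auto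

lemma W_insert:
  assumes "finite J" "i \<notin> J"
  shows "W (insert i J) y = W J y + H J y (y i)"
proof -
  have "(\<Sum>j\<in>J. \<Sum>k\<in>insert i J - {j}. h (y j) (y k)) = (\<Sum>j\<in>J. h (y j) (y i) + (\<Sum>k\<in>J - {j}. h (y j) (y k)))"
  proof (rule sum.cong[OF refl])
    fix j assume "j \<in> J"
    then have "insert i J - {j} = insert i (J - {j})" using assms by auto
    then show "(\<Sum>k\<in>insert i J - {j}. h (y j) (y k)) = h (y j) (y i) + (\<Sum>k\<in>J - {j}. h (y j) (y k))"
      using assms by simp
  qed
  also have "\<dots> = H J y (y i) + (\<Sum>j\<in>J. \<Sum>k\<in>J - {j}. h (y j) (y k))"
    by (simp add: sum.distrib H_def h_sym[of _ "y i"])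
  finally show ?thesis
    using assms by (simp add: W_def H_def algebra_simps)
qed

lemma W_eq_sum_H: "W I y = (1 / 2) * (\<Sum>i\<in>I. H (I - {i}) y (y i))"
  by (simp add: W_def H_def)

lemma integral_H: "finite J \<Longrightarrow> y \<in> space (iid J) \<Longrightarrow> (\<integral>x. H J y x \<partial>M) = 0"
proof -
  assume J: "finite J" and y: "y \<in> space (iid J)"
  have "(\<integral>x. H J y x \<partial>M) = (\<Sum>k\<in>J. \<integral>x. h x (y k) \<partial>M)"
    unfolding H_def
  proof (rule Bochner_Integration.integral_sum)
    fix k assume "k \<in> J"
    then have "y k \<in> space M" using y by (auto simp: space_PiM)
    then show "integrable M (\<lambda>x. h x (y k))"
      using h_bdd by (intro integrable_bounded[of _ B]) (auto simp: h_sym[of _ "y k"])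
  qed
  also have "\<dots> = (\<Sum>k\<in>J. \<integral>x. h (y k) x \<partial>M)" by (simp add: h_sym)
  also have "\<dots> = 0"
  proof (intro sum.neutral ballI h_degenerate)
    fix k assume "k \<in> J" then show "y k \<in> space M" using y by (auto simp: space_PiM)
  qed
  finally show ?thesis .
qed

lemma integral_H_sq_sample:
  assumes "finite J" "x \<in> space M"
  shows "(\<integral>y. (H J y x)\<^sup>2 \<partial>iid J) = card J * G x x"
  using centred_rv.integral_S_sq[OF centred_rv_h[OF assms(2)] assms(1)] assms(2)
  by (simp add: H_eq_S G_def power2_eq_square)

lemma double_integral_H_sq:
  assumes J: "finite J"
  shows "(\<integral>y. (\<integral>x. (H J y x)\<^sup>2 \<partial>M) \<partial>iid J) = card J * V"
proof -
  have "(\<integral>y. (\<integral>x. (H J y x)\<^sup>2 \<partial>M) \<partial>iid J) = (\<integral>x. (\<integral>y. (H J y x)\<^sup>2 \<partial>iid J) \<partial>M)"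
  proof (rule fubini_bounded[where K = "(card J * B)\<^sup>2"])
    show "(\<lambda>(x, y). (H J y x)\<^sup>2) \<in> borel_measurable (M \<Otimes>\<^sub>M iid J)" using J by measurable
  qed (use H_sq_bdd[OF J] prob_space_iid prob_space_axioms in auto)
  also have "\<dots> = (\<integral>x. card J * G x x \<partial>M)"
    using J by (intro Bochner_Integration.integral_cong) (auto simp: integral_H_sq_sample)
  finally show ?thesis by (simp add: V_def)
qed

text \<open>For fixed x the increment is a sum of independent centred terms in the sample, so
  Rosenthal's inequality applies once the integral over the sample is taken first.\<close>

lemma double_integral_H_powr:
  assumes J: "finite J" and q: "2 \<le> q" "q \<le> 3"
  shows "(\<integral>y. (\<integral>x. \<bar>H J y x\<bar> powr q \<partial>M) \<partial>iid J)
    \<le> 80 * (card J * (\<integral>x. (\<integral>z. \<bar>h x z\<bar> powr q \<partial>M) \<partial>M) + card J powr (q / 2) * (\<integral>x. G x x powr (q / 2) \<partial>M))"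
proof -
  have le: "(\<integral>y. \<bar>H J y x\<bar> powr q \<partial>iid J)
      \<le> 80 * (card J * (\<integral>z. \<bar>h x z\<bar> powr q \<partial>M) + card J powr (q / 2) * G x x powr (q / 2))"
    if x: "x \<in> space M" for x
    using centred_rv.integral_S_powr_2_3[OF centred_rv_h[OF x] J q] G_nonneg x
    by (simp add: H_eq_S G_def power2_eq_square powr_mult)
  have [measurable]: "(\<lambda>x. G x x) \<in> borel_measurable M"
    by (rule degenerate_kernel.h_compose[OF degenerate_kernel_G]) auto
  have int1: "integrable M (\<lambda>x. \<integral>z. \<bar>h x z\<bar> powr q \<partial>M)"
    using q h_bdd by (intro integrable_bounded[of _ "B powr q"])
      (auto intro!: integral_nonneg_le_bound powr_mono2)
  have int2: "integrable M (\<lambda>x. G x x powr (q / 2))"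
    using q G_bdd G_nonneg by (intro integrable_bounded[of _ "(B\<^sup>2) powr (q / 2)"])
      (auto intro!: powr_mono2 order_trans[OF abs_ge_self G_bdd])
  interpret J: prob_space "iid J" by (rule prob_space_iid)
  have "(\<integral>y. (\<integral>x. \<bar>H J y x\<bar> powr q \<partial>M) \<partial>iid J) = (\<integral>x. (\<integral>y. \<bar>H J y x\<bar> powr q \<partial>iid J) \<partial>M)"
  proof (rule fubini_bounded[where K = "(card J * B) powr q"])
    show "(\<lambda>(x, y). \<bar>H J y x\<bar> powr q) \<in> borel_measurable (M \<Otimes>\<^sub>M iid J)" using J by measurable
  qed (use H_bdd[OF J] q prob_space_iid prob_space_axioms in \<open>auto intro!: powr_mono2\<close>)
  also have "\<dots> \<le> (\<integral>x. 80 * (card J * (\<integral>z. \<bar>h x z\<bar> powr q \<partial>M) + card J powr (q / 2) * G x x powr (q / 2)) \<partial>M)"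
  proof (rule integral_mono)
    show "integrable M (\<lambda>x. \<integral>y. \<bar>H J y x\<bar> powr q \<partial>iid J)"
      using J q H_bdd[OF J] by (intro integrable_bounded[of _ "(card J * B) powr q"])
        (auto intro!: J.integral_nonneg_le_bound powr_mono2)
  qed (use le int1 int2 in auto)
  also have "\<dots> = 80 * (card J * (\<integral>x. (\<integral>z. \<bar>h x z\<bar> powr q \<partial>M) \<partial>M) + card J powr (q / 2) * (\<integral>x. G x x powr (q / 2) \<partial>M))"
    using int1 int2 by simp
  finally show ?thesis .
qed

text \<open>The increments are centred given the earlier sample, so cross terms vanish and the
  variances k V, for k < card I, add up.\<close>

lemma integral_W_sq:
  assumes "finite I"
  shows "(\<integral>y. (W I y)\<^sup>2 \<partial>iid I) = real (card I) * (real (card I) - 1) / 2 * V"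
  using assms
proof (induction I rule: finite_induct)
  case empty
  then show ?case by (simp add: W_def)
next
  case (insert i J)
  interpret J: prob_space "iid J" by (rule prob_space_iid)
  note J = insert(1)
  have WH: "W (insert i J) (y(i := x)) = W J y + H J y x" for y x
    using insert by (simp add: W_insert W_fun_upd H_fun_upd)
  have intW: "integrable (iid J) (\<lambda>y. (W J y)\<^sup>2)"
    using J W_sq_bdd[OF J]
    by (intro J.integrable_bounded[of _ "(card J * (card J * B))\<^sup>2"]) auto
  have "(\<integral>y. (W (insert i J) y)\<^sup>2 \<partial>iid (insert i J)) = (\<integral>y. (\<integral>x. (W J y + H J y x)\<^sup>2 \<partial>M) \<partial>iid J)"
    using insert W_sq_bdd[of "insert i J"]
    by (subst integral_iid_insert[where B = "(card (insert i J) * (card (insert i J) * B))\<^sup>2"])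
       (auto simp: WH simp del: card_insert_disjoint)
  also have "\<dots> = (\<integral>y. (W J y)\<^sup>2 + (\<integral>x. (H J y x)\<^sup>2 \<partial>M) \<partial>iid J)"
  proof (rule Bochner_Integration.integral_cong[OF refl])
    fix y assume y: "y \<in> space (iid J)"
    have "(\<integral>x. (W J y + H J y x)\<^sup>2 \<partial>M) = (\<integral>x. (W J y)\<^sup>2 + (2 * W J y * H J y x + (H J y x)\<^sup>2) \<partial>M)"
      by (simp add: power2_eq_square algebra_simps)
    also have "\<dots> = (W J y)\<^sup>2 + (\<integral>x. (H J y x)\<^sup>2 \<partial>M)"
      using integrable_H[OF J y] integrable_H_sq[OF J y] by (simp add: integral_H[OF J y] prob_space)
    finally show "(\<integral>x. (W J y + H J y x)\<^sup>2 \<partial>M) = (W J y)\<^sup>2 + (\<integral>x. (H J y x)\<^sup>2 \<partial>M)" .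
  qed
  also have "\<dots> = real (card J) * (real (card J) - 1) / 2 * V + card J * V"
    using intW integrable_v[OF J] insert.IH by (simp add: double_integral_H_sq[OF J])
  also have "\<dots> = real (card (insert i J)) * (real (card (insert i J)) - 1) / 2 * V"
    unfolding card_insert_disjoint[OF insert(1,2)] by (simp add: field_simps)
  finally show ?case .
qed

text \<open>Expanding the square and integrating over x turns products of h into G. The diagonal
  terms form an iid sum, the others a degenerate U-statistic.\<close>

lemma integral_H_sq_eq:
  assumes J: "finite J" and y: "y \<in> space (iid J)"
  shows "(\<integral>x. (H J y x)\<^sup>2 \<partial>M) = (\<Sum>k\<in>J. G (y k) (y k)) + 2 * degenerate_kernel.W G J y"
proof -
  have ys: "y k \<in> space M" if "k \<in> J" for k using y that by (auto simp: space_PiM)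
  have "(\<integral>x. (H J y x)\<^sup>2 \<partial>M) = (\<integral>x. (\<Sum>k\<in>J. \<Sum>l\<in>J. h (y k) x * h (y l) x) \<partial>M)"
    unfolding H_def power2_eq_square sum_product by (simp only: h_sym[of _ "y k" for k])
  also have "\<dots> = (\<Sum>k\<in>J. \<Sum>l\<in>J. G (y k) (y l))"
  proof -
    have int: "integrable M (\<lambda>x. h (y k) x * h (y l) x)" if "k \<in> J" "l \<in> J" for k l
      using ys[OF that(1)] ys[OF that(2)] by (intro integrable_bounded[of _ "B\<^sup>2"]) (auto simp: hh_bdd)
    show ?thesis
      unfolding G_def using int
      by (simp add: Bochner_Integration.integral_sum Bochner_Integration.integrable_sum)
  qed
  also have "\<dots> = (\<Sum>k\<in>J. G (y k) (y k) + (\<Sum>l\<in>J - {k}. G (y k) (y l)))"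
    using J by (intro sum.cong refl sum.remove) auto
  finally show ?thesis
    by (simp add: sum.distrib degenerate_kernel.W_def[OF degenerate_kernel_G])
qed

end

subsection \<open>Normal approximation by leaving out one observation\<close>

text \<open>Below the threshold a the bound is trivial; above it, |s| is at most a^(1 - r)
  |s|^r.\<close>

lemma abs_le_add_powr:
  fixes a r s :: real
  assumes "0 < a" "1 \<le> r"
  shows "\<bar>s\<bar> \<le> a + a powr (1 - r) * \<bar>s\<bar> powr r"
proof (cases "\<bar>s\<bar> \<le> a")
  case True
  moreover have "0 \<le> a powr (1 - r) * \<bar>s\<bar> powr r" by simp
  ultimately show ?thesis by linarith
next
  case False
  then have "\<bar>s\<bar> = \<bar>s\<bar> powr (1 - r) * \<bar>s\<bar> powr r" using assms by (simp flip: powr_add)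
  also have "\<dots> \<le> a powr (1 - r) * \<bar>s\<bar> powr r"
    using False assms by (intro mult_right_mono powr_mono2') auto
  finally show ?thesis using assms by linarith
qed

lemma cmod_integral_mono:
  fixes f :: "'a \<Rightarrow> complex" and g :: "'a \<Rightarrow> real"
  assumes "integrable M g" "\<And>x. x \<in> space M \<Longrightarrow> cmod (f x) \<le> g x"
  shows "cmod (\<integral>x. f x \<partial>M) \<le> (\<integral>x. g x \<partial>M)"
proof (cases "integrable M f")
  case True
  show ?thesis
    using True assms by (intro order_trans[OF integral_norm_bound integral_mono]) auto
next
  case False
  have "0 \<le> (\<integral>x. g x \<partial>M)"
    using assms(2) by (intro Bochner_Integration.integral_nonneg) (meson norm_ge_zero order_trans)
  then show ?thesis using False by (simp add: not_integrable_integral_eq)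
qed

lemma norm_diff_triangle_le3:
  fixes a b c d :: "'a::real_normed_vector"
  assumes "norm (a - b) \<le> x" "norm (b - c) \<le> y" "norm (c - d) \<le> z"
  shows "norm (a - d) \<le> x + y + z"
  using norm_diff_triangle_le[OF norm_diff_triangle_le[OF assms(1,2)] assms(3)] .

lemma cmod_iexp_minus_one_le: "cmod (iexp x - 1) \<le> \<bar>x\<bar>"
  using iexp_approx1[of x 0] by simp

context degenerate_kernel
begin

definition h_moment :: "real \<Rightarrow> real" where
  "h_moment q = (\<integral>x. (\<integral>z. \<bar>h x z\<bar> powr q \<partial>M) \<partial>M)"

definition G_moment :: "real \<Rightarrow> real" where
  "G_moment r = (\<integral>x. G x x powr r \<partial>M)"

definition G_energy :: real where
  "G_energy = (\<integral>x. (\<integral>y. (G x y)\<^sup>2 \<partial>M) \<partial>M)"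

lemma h_moment_nonneg: "0 \<le> h_moment q"
  unfolding h_moment_def by (intro Bochner_Integration.integral_nonneg) auto

lemma G_moment_nonneg: "0 \<le> G_moment q"
  unfolding G_moment_def by (intro Bochner_Integration.integral_nonneg) auto

lemma G_energy_nonneg: "0 \<le> G_energy"
  unfolding G_energy_def by (intro Bochner_Integration.integral_nonneg) auto

lemma V_le: "V \<le> B\<^sup>2"
  unfolding V_def using G_bdd G_nonneg
  by (intro integral_nonneg_le_bound)
     (auto intro: order_trans[OF abs_ge_self] degenerate_kernel.h_compose[OF degenerate_kernel_G])

text \<open>The diagonal part has only a moment of order q/2 < 2 at its disposal, hence the von
  Bahr-Esseen inequality after \<open>abs_le_add_powr\<close>. The off-diagonal part has a usable
  second moment and is handled by the arithmetic-geometric mean inequality with the same threshold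
  a.\<close>

lemma integral_abs_dev_le:
  assumes J: "finite J" and q: "2 \<le> q" "q \<le> 3" and a: "0 < a"
  shows "(\<integral>y. \<bar>(\<integral>x. (H J y x)\<^sup>2 \<partial>M) - card J * V\<bar> \<partial>iid J)
    \<le> 2 * a + a powr (1 - q / 2) * (40 * (card J * (2 powr (q / 2) * (G_moment (q / 2) + V powr (q / 2)))))
      + (card J)\<^sup>2 * G_energy / (2 * a)"
proof -
  interpret GK: degenerate_kernel M G "B\<^sup>2" by (rule degenerate_kernel_G)
  interpret J: prob_space "iid J" by (rule prob_space_iid)
  have [measurable]: "(\<lambda>x. G x x) \<in> borel_measurable M" by (rule GK.h_compose) auto
  interpret D: centred_rv M "\<lambda>x. G x x - V" "B\<^sup>2 + B\<^sup>2"
  proof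
    show "\<bar>G x x - V\<bar> \<le> B\<^sup>2 + B\<^sup>2" for x
      using G_bdd[of x x] V_le V_nonneg by linarith
    have "integrable M (\<lambda>x. G x x)" using G_bdd by (intro integrable_bounded[of _ "B\<^sup>2"]) auto
    then show "(\<integral>x. G x x - V \<partial>M) = 0" by (simp add: prob_space V_def)
  qed auto
  define r where "r = q / 2"
  have r: "1 \<le> r" "r \<le> 2" using q by (auto simp: r_def)
  have "(\<integral>y. \<bar>(\<integral>x. (H J y x)\<^sup>2 \<partial>M) - card J * V\<bar> \<partial>iid J)
    \<le> (\<integral>y. (a + a powr (1 - r) * \<bar>D.S J y\<bar> powr r) + (a + (GK.W J y)\<^sup>2 / a) \<partial>iid J)"
  proof (rule integral_mono)
    show "integrable (iid J) (\<lambda>y. \<bar>(\<integral>x. (H J y x)\<^sup>2 \<partial>M) - card J * V\<bar>)"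
      using integrable_v[OF J] by simp
    have "integrable (iid J) (\<lambda>y. (GK.W J y)\<^sup>2)"
      using J GK.W_sq_bdd[OF J]
      by (intro J.integrable_bounded[of _ "(card J * (card J * B\<^sup>2))\<^sup>2"]) auto
    then show "integrable (iid J) (\<lambda>y. (a + a powr (1 - r) * \<bar>D.S J y\<bar> powr r) + (a + (GK.W J y)\<^sup>2 / a))"
      using D.integrable_S_powr[OF J, of r] r by auto
    fix y assume y: "y \<in> space (iid J)"
    have "(\<integral>x. (H J y x)\<^sup>2 \<partial>M) - card J * V = D.S J y + 2 * GK.W J y"
      by (simp add: integral_H_sq_eq[OF J y] D.S_def sum_subtractf)
    then have "\<bar>(\<integral>x. (H J y x)\<^sup>2 \<partial>M) - card J * V\<bar> \<le> \<bar>D.S J y\<bar> + 2 * \<bar>GK.W J y\<bar>" by linarith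
    also have "2 * \<bar>GK.W J y\<bar> \<le> a + (GK.W J y)\<^sup>2 / a"
    proof -
      have "0 \<le> (a - \<bar>GK.W J y\<bar>)\<^sup>2" by simp
      then have "2 * \<bar>GK.W J y\<bar> * a \<le> a * a + (GK.W J y)\<^sup>2"
        by (simp add: power2_eq_square algebra_simps flip: abs_mult)
      then show ?thesis using a by (simp add: field_simps)
    qed
    finally show "\<bar>(\<integral>x. (H J y x)\<^sup>2 \<partial>M) - card J * V\<bar>
        \<le> (a + a powr (1 - r) * \<bar>D.S J y\<bar> powr r) + (a + (GK.W J y)\<^sup>2 / a)"
      using abs_le_add_powr[OF a r(1), of "D.S J y"] by linarith
  qed
  also have "\<dots> = 2 * a + a powr (1 - r) * (\<integral>y. \<bar>D.S J y\<bar> powr r \<partial>iid J) + (\<integral>y. (GK.W J y)\<^sup>2 \<partial>iid J) / a"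
  proof -
    have "integrable (iid J) (\<lambda>y. (GK.W J y)\<^sup>2)"
      using J GK.W_sq_bdd[OF J]
      by (intro J.integrable_bounded[of _ "(card J * (card J * B\<^sup>2))\<^sup>2"]) auto
    then show ?thesis using D.integrable_S_powr[OF J, of r] r by (simp add: J.prob_space)
  qed
  also have "(\<integral>y. \<bar>D.S J y\<bar> powr r \<partial>iid J) \<le> 40 * (card J * (\<integral>x. \<bar>G x x - V\<bar> powr r \<partial>M))"
    using J r by (rule D.integral_S_powr_1_2)
  also have "(\<integral>x. \<bar>G x x - V\<bar> powr r \<partial>M) \<le> (\<integral>x. 2 powr r * (G x x powr r + V powr r) \<partial>M)"
  proof (rule integral_mono)
    show "integrable M (\<lambda>x. \<bar>G x x - V\<bar> powr r)" using D.integrable_f_powr r by auto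
    have "integrable M (\<lambda>x. G x x powr r)"
      using r G_bdd G_nonneg by (intro integrable_bounded[of _ "(B\<^sup>2) powr r"])
      (auto intro!: powr_mono2 order_trans[OF abs_ge_self G_bdd])
    then show "integrable M (\<lambda>x. 2 powr r * (G x x powr r + V powr r))" by auto
    fix x
    have "\<bar>G x x - V\<bar> powr r \<le> (G x x + V) powr r"
      using r G_nonneg[of x] V_nonneg by (intro powr_mono2) auto
    also have "\<dots> \<le> 2 powr r * (G x x powr r + V powr r)"
      using r G_nonneg V_nonneg by (intro powr_add_le_scaled) auto
    finally show "\<bar>G x x - V\<bar> powr r \<le> 2 powr r * (G x x powr r + V powr r)" .
  qed
  also have "(\<integral>x. 2 powr r * (G x x powr r + V powr r) \<partial>M) = 2 powr r * (G_moment r + V powr r)"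
  proof -
    have "integrable M (\<lambda>x. G x x powr r)"
      using r G_bdd G_nonneg by (intro integrable_bounded[of _ "(B\<^sup>2) powr r"])
      (auto intro!: powr_mono2 order_trans[OF abs_ge_self G_bdd])
    then show ?thesis by (simp add: G_moment_def prob_space)
  qed
  also have "(\<integral>y. (GK.W J y)\<^sup>2 \<partial>iid J) \<le> (card J)\<^sup>2 * G_energy / 2"
  proof -
    have "GK.V = G_energy" by (simp add: GK.V_def GK.G_def G_energy_def power2_eq_square)
    moreover have "real (card J) * (real (card J) - 1) / 2 \<le> (card J)\<^sup>2 / 2"
      by (simp add: power2_eq_square algebra_simps)
    ultimately show ?thesis
      using mult_right_mono[OF _ G_energy_nonneg, of "real (card J) * (real (card J) - 1) / 2" "(card J)\<^sup>2 / 2"]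
      by (simp add: GK.integral_W_sq[OF J])
  qed
  finally show ?thesis using a by (simp add: r_def divide_right_mono mult_left_mono)
qed

lemma integrable_iid:
  fixes f :: "('i \<Rightarrow> 'a) \<Rightarrow> complex"
  assumes "f \<in> borel_measurable (iid J)" "\<And>y. y \<in> space (iid J) \<Longrightarrow> cmod (f y) \<le> K"
  shows "integrable (iid J) f"
  using prob_space.integrable_bounded[OF prob_space_iid, of f J K] assms by auto

lemma integrable_H_powr:
  "finite J \<Longrightarrow> y \<in> space (iid J) \<Longrightarrow> 0 \<le> q \<Longrightarrow> integrable M (\<lambda>x. \<bar>H J y x\<bar> powr q)"
  using H_bdd[of J y] by (intro integrable_bounded[of _ "(card J * B) powr q"]) (auto intro!: powr_mono2)

text \<open>The exponential is preceded by a factor H, so a Taylor remainder of order q - 1, which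
  lies in [1, 2], produces exactly the q-th moment; the term linear in H integrates to 0.\<close>

lemma integral_H_iexp_approx:
  assumes J: "finite J" and y: "y \<in> space (iid J)" and q: "2 \<le> q" "q \<le> 3"
  shows "cmod ((\<integral>x. H J y x * iexp (\<tau> * H J y x) \<partial>M) - \<i> * \<tau> * (\<integral>x. (H J y x)\<^sup>2 \<partial>M))
    \<le> 2 * \<bar>\<tau>\<bar> powr (q - 1) * (\<integral>x. \<bar>H J y x\<bar> powr q \<partial>M)"
proof -
  have [measurable]: "H J y \<in> borel_measurable M" by (rule H_measurable_right[OF J y])
  have i1: "integrable M (\<lambda>x. complex_of_real (H J y x) * iexp (\<tau> * H J y x))"
    using H_bdd[OF J] by (intro integrable_bounded[of _ "card J * B"]) (auto simp: norm_mult)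
  have i2: "integrable M (\<lambda>x. complex_of_real (H J y x))"
    using integrable_H[OF J y] by simp
  have i3: "integrable M (\<lambda>x. \<i> * \<tau> * complex_of_real ((H J y x)\<^sup>2))"
    by (intro integrable_mult_right integrable_of_real integrable_H_sq J y)
  have e2: "(\<integral>x. complex_of_real (H J y x) \<partial>M) = 0"
    by (simp only: integral_complex_of_real integral_H[OF J y] of_real_0)
  have e3: "(\<integral>x. \<i> * \<tau> * complex_of_real ((H J y x)\<^sup>2) \<partial>M) = \<i> * \<tau> * complex_of_real (\<integral>x. (H J y x)\<^sup>2 \<partial>M)"
    by (simp only: integral_mult_right_zero integral_complex_of_real)
  have "(\<integral>x. H J y x * iexp (\<tau> * H J y x) \<partial>M) - \<i> * \<tau> * (\<integral>x. (H J y x)\<^sup>2 \<partial>M)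
    = (\<integral>x. H J y x * iexp (\<tau> * H J y x) \<partial>M) - (\<integral>x. complex_of_real (H J y x) \<partial>M)
      - (\<integral>x. \<i> * \<tau> * complex_of_real ((H J y x)\<^sup>2) \<partial>M)"
    unfolding e2 e3 by simp
  also have "\<dots> = (\<integral>x. H J y x * iexp (\<tau> * H J y x) - H J y x - \<i> * \<tau> * complex_of_real ((H J y x)\<^sup>2) \<partial>M)"
    by (simp only: Bochner_Integration.integral_diff[OF Bochner_Integration.integrable_diff[OF i1 i2] i3]
        Bochner_Integration.integral_diff[OF i1 i2])
  also have "cmod \<dots> \<le> (\<integral>x. 2 * \<bar>\<tau>\<bar> powr (q - 1) * \<bar>H J y x\<bar> powr q \<partial>M)"
  proof (rule cmod_integral_mono)
    show "integrable M (\<lambda>x. 2 * \<bar>\<tau>\<bar> powr (q - 1) * \<bar>H J y x\<bar> powr q)"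
      using integrable_H_powr[OF J y, of q] q by simp
    fix x
    have "H J y x * iexp (\<tau> * H J y x) - H J y x - \<i> * \<tau> * complex_of_real ((H J y x)\<^sup>2)
      = H J y x * (iexp (\<tau> * H J y x) - 1 - \<i> * (\<tau> * H J y x))"
      by (simp add: power2_eq_square algebra_simps)
    also have "cmod \<dots> \<le> \<bar>H J y x\<bar> * (2 * \<bar>\<tau> * H J y x\<bar> powr (q - 1))"
      unfolding norm_mult using cmod_iexp_diff_le[of "q - 1" "\<tau> * H J y x"] q
      by (intro mult_mono) auto
    also have "\<dots> = 2 * \<bar>\<tau>\<bar> powr (q - 1) * \<bar>H J y x\<bar> powr q"
      by (cases "H J y x = 0") (auto simp: abs_mult powr_mult powr_diff)
    finally show "cmod (H J y x * iexp (\<tau> * H J y x) - H J y x - \<i> * \<tau> * complex_of_real ((H J y x)\<^sup>2))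
      \<le> 2 * \<bar>\<tau>\<bar> powr (q - 1) * \<bar>H J y x\<bar> powr q" .
  qed
  finally show ?thesis by simp
qed

text \<open>Closes the differential equation: leaving one observation out produces
  \<open>charf J\<close>, whereas an equation for \<open>charf (insert i J)\<close> is wanted. The
  crude bound by |\<tau>| E |H| is enough.\<close>

lemma charf_insert_diff:
  assumes J: "finite J" "i \<notin> J" and pos: "0 < card J * V"
  shows "cmod (charf (insert i J) \<tau> - charf J \<tau>) \<le> \<bar>\<tau>\<bar> * sqrt (card J * V)"
proof -
  interpret J: prob_space "iid J" by (rule prob_space_iid)
  \<comment> \<open>With a the square root of E H^2, the inequality |H| <= a/2 + H^2/(2 a)
    integrates to E |H| <= a and takes the place of Cauchy-Schwarz.\<close>
  define a where "a = sqrt (card J * V)"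
  have a: "a > 0" "a\<^sup>2 = card J * V" using pos by (simp_all only: a_def real_sqrt_gt_zero real_sqrt_pow2 less_imp_le)
  have WH: "W (insert i J) (y(i := x)) = W J y + H J y x" for y x
    using J by (simp add: W_insert W_fun_upd H_fun_upd)
  have mW [measurable]: "W (insert i J) \<in> borel_measurable (iid (insert i J))" "W J \<in> borel_measurable (iid J)"
    using J by (simp_all add: W_measurable)
  have "charf (insert i J) \<tau> = (\<integral>y. (\<integral>x. iexp (\<tau> * (W J y + H J y x)) \<partial>M) \<partial>iid J)"
    unfolding charf_def
  proof (subst integral_iid_insert[where B = 1, OF J])
    show "(\<lambda>y. iexp (\<tau> * W (insert i J) y)) \<in> borel_measurable (iid (insert i J))" by measurable
    show "(\<integral>y. (\<integral>x. iexp (\<tau> * W (insert i J) (y(i := x))) \<partial>M) \<partial>iid J) =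
       (\<integral>y. (\<integral>x. iexp (\<tau> * (W J y + H J y x)) \<partial>M) \<partial>iid J)" unfolding WH ..
  qed simp
  then have "charf (insert i J) \<tau> - charf J \<tau>
      = (\<integral>y. (\<integral>x. iexp (\<tau> * (W J y + H J y x)) \<partial>M) \<partial>iid J) - (\<integral>y. iexp (\<tau> * W J y) \<partial>iid J)"
    by (simp add: charf_def)
  also have "\<dots> = (\<integral>y. (\<integral>x. iexp (\<tau> * (W J y + H J y x)) \<partial>M) - iexp (\<tau> * W J y) \<partial>iid J)"
    using J by (intro Bochner_Integration.integral_diff[symmetric] integrable_iid[of _ _ 1])
      (auto intro!: order_trans[OF cmod_integral_mono[of M "\<lambda>_. 1"]] simp: prob_space)
  also have "cmod \<dots> \<le> (\<integral>y. \<bar>\<tau>\<bar> * (a / 2 + (\<integral>x. (H J y x)\<^sup>2 \<partial>M) / (2 * a)) \<partial>iid J)"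
  proof (rule cmod_integral_mono)
    show "integrable (iid J) (\<lambda>y. \<bar>\<tau>\<bar> * (a / 2 + (\<integral>x. (H J y x)\<^sup>2 \<partial>M) / (2 * a)))"
      using integrable_v[OF J(1)] by simp
    fix y assume y: "y \<in> space (iid J)"
    have [measurable]: "H J y \<in> borel_measurable M" by (rule H_measurable_right[OF J(1) y])
    have "(\<integral>x. iexp (\<tau> * (W J y + H J y x)) \<partial>M) - iexp (\<tau> * W J y)
      = (\<integral>x. iexp (\<tau> * (W J y + H J y x)) - iexp (\<tau> * W J y) \<partial>M)"
      by (subst Bochner_Integration.integral_diff) (auto intro!: integrable_bounded[of _ 1] simp: prob_space)
    also have "cmod \<dots> \<le> (\<integral>x. \<bar>\<tau>\<bar> * (a / 2 + (H J y x)\<^sup>2 / (2 * a)) \<partial>M)"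
    proof (rule cmod_integral_mono)
      show "integrable M (\<lambda>x. \<bar>\<tau>\<bar> * (a / 2 + (H J y x)\<^sup>2 / (2 * a)))"
        using integrable_H_sq[OF J(1) y] by simp
      fix x
      have "iexp (\<tau> * (W J y + H J y x)) - iexp (\<tau> * W J y) = iexp (\<tau> * W J y) * (iexp (\<tau> * H J y x) - 1)"
        by (simp add: algebra_simps exp_add)
      also have "cmod \<dots> \<le> \<bar>\<tau> * H J y x\<bar>"
        unfolding norm_mult using cmod_iexp_minus_one_le[of "\<tau> * H J y x"] by simp
      also have "\<dots> = \<bar>\<tau>\<bar> * \<bar>H J y x\<bar>" by (simp add: abs_mult)
      also have "\<bar>H J y x\<bar> \<le> a / 2 + (H J y x)\<^sup>2 / (2 * a)"
      proof -
        have "0 \<le> (a - \<bar>H J y x\<bar>)\<^sup>2" by simp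
        then have "2 * \<bar>H J y x\<bar> * a \<le> a * a + (H J y x)\<^sup>2"
          by (simp add: power2_eq_square algebra_simps flip: abs_mult)
        then show ?thesis using a by (simp add: field_simps)
      qed
      finally show "cmod (iexp (\<tau> * (W J y + H J y x)) - iexp (\<tau> * W J y)) \<le> \<bar>\<tau>\<bar> * (a / 2 + (H J y x)\<^sup>2 / (2 * a))"
        by (simp add: mult_left_mono)
    qed
    also have "\<dots> = \<bar>\<tau>\<bar> * (a / 2 + (\<integral>x. (H J y x)\<^sup>2 \<partial>M) / (2 * a))"
      using integrable_H_sq[OF J(1) y] by (simp add: prob_space)
    finally show "cmod ((\<integral>x. iexp (\<tau> * (W J y + H J y x)) \<partial>M) - iexp (\<tau> * W J y))
      \<le> \<bar>\<tau>\<bar> * (a / 2 + (\<integral>x. (H J y x)\<^sup>2 \<partial>M) / (2 * a))" .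
  qed
  also have "\<dots> = \<bar>\<tau>\<bar> * (a / 2 + a\<^sup>2 / (2 * a))"
    using integrable_v[OF J(1)] by (simp add: J.prob_space double_integral_H_sq[OF J(1)] a(2))
  also have "a / 2 + a\<^sup>2 / (2 * a) = a" using a by (simp add: power2_eq_square field_simps)
  finally show ?thesis by (simp add: a_def)
qed

text \<open>Conditionally on the other observations, \<open>H J y\<close> is centred and \<open>W J\<close> is constant, so the first-order
  term of the expansion of \<open>exp (\<i> \<tau> H)\<close> disappears and the second-order one produces the conditional
  variance, which concentrates around \<open>card J * V\<close>.\<close>

lemma leave_one_out:
  assumes J: "finite J" "i \<notin> J" and pos: "0 < card J * V" and q: "2 \<le> q" "q \<le> 3"
  shows "cmod ((\<integral>y. H J y (y i) * iexp (\<tau> * W (insert i J) y) \<partial>iid (insert i J))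
      - \<i> * \<tau> * (card J * V) * charf (insert i J) \<tau>)
    \<le> 2 * \<bar>\<tau>\<bar> powr (q - 1) * (\<integral>y. (\<integral>x. \<bar>H J y x\<bar> powr q \<partial>M) \<partial>iid J)
      + \<bar>\<tau>\<bar> * (\<integral>y. \<bar>(\<integral>x. (H J y x)\<^sup>2 \<partial>M) - card J * V\<bar> \<partial>iid J)
      + \<tau>\<^sup>2 * (card J * V) powr (3 / 2)"
proof -
  interpret J: prob_space "iid J" by (rule prob_space_iid)
  let ?v = "\<lambda>y. \<integral>x. (H J y x)\<^sup>2 \<partial>M" and ?mV = "card J * V"
  let ?K = "card J * B"
  have Kn: "0 \<le> ?K" using B_nonneg by simp
  have "(\<integral>y. H J y (y i) * iexp (\<tau> * W (insert i J) y) \<partial>iid (insert i J))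
     = (\<integral>y. (\<integral>x. H J y x * iexp (\<tau> * (W J y + H J y x)) \<partial>M) \<partial>iid J)"
  proof (subst integral_iid_insert[where B = ?K])
    show "(\<lambda>y. complex_of_real (H J y (y i)) * iexp (\<tau> * W (insert i J) y)) \<in> borel_measurable (iid (insert i J))"
    proof -
      have "(\<lambda>y. H J y (y i)) \<in> borel_measurable (iid (insert i J))"
        unfolding H_def by measurable
      moreover have "W (insert i J) \<in> borel_measurable (iid (insert i J))"
        using J by (simp add: W_measurable)
      ultimately show ?thesis by measurable
    qed
  qed (use J H_bdd[OF J(1)] in \<open>auto simp: W_insert W_fun_upd H_fun_upd norm_mult\<close>)
  also have "\<dots> = (\<integral>y. iexp (\<tau> * W J y) * (\<integral>x. H J y x * iexp (\<tau> * H J y x) \<partial>M) \<partial>iid J)"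
    by (subst integral_mult_right_zero[symmetric], intro Bochner_Integration.integral_cong refl)
       (simp add: algebra_simps exp_add)
  finally have 1: "(\<integral>y. H J y (y i) * iexp (\<tau> * W (insert i J) y) \<partial>iid (insert i J))
    = (\<integral>y. iexp (\<tau> * W J y) * (\<integral>x. H J y x * iexp (\<tau> * H J y x) \<partial>M) \<partial>iid J)" .
  have i1: "integrable (iid J) (\<lambda>y. iexp (\<tau> * W J y) * (\<integral>x. H J y x * iexp (\<tau> * H J y x) \<partial>M))"
  proof (rule integrable_iid[where K = ?K])
    fix y assume "y \<in> space (iid J)"
    show "cmod (iexp (\<tau> * W J y) * (\<integral>x. H J y x * iexp (\<tau> * H J y x) \<partial>M)) \<le> ?K"
      using H_bdd[OF J(1)] Kn
      by (auto simp: norm_mult prob_space intro!: order_trans[OF cmod_integral_mono[of M "\<lambda>_. ?K"]])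
  qed (use J in measurable)
  have i2: "integrable (iid J) (\<lambda>y. iexp (\<tau> * W J y) * (\<i> * \<tau> * ?v y))"
  proof (rule integrable_iid[where K = "\<bar>\<tau>\<bar> * ?K\<^sup>2"])
    fix y assume "y \<in> space (iid J)"
    then show "cmod (iexp (\<tau> * W J y) * (\<i> * \<tau> * ?v y)) \<le> \<bar>\<tau>\<bar> * ?K\<^sup>2"
      using v_bdd[OF J(1)] by (auto simp: norm_mult intro!: mult_left_mono)
  qed (use J in measurable)
  have i3: "integrable (iid J) (\<lambda>y. iexp (\<tau> * W J y) * (\<i> * \<tau> * ?mV))"
    using J by (intro integrable_iid[where K = "\<bar>\<tau>\<bar> * \<bar>?mV\<bar>"]) (auto simp: norm_mult abs_mult)
  \<comment> \<open>The inner integral is replaced by its second-order term, at the cost of a q-th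
    moment.\<close>
  have A: "cmod ((\<integral>y. iexp (\<tau> * W J y) * (\<integral>x. H J y x * iexp (\<tau> * H J y x) \<partial>M) \<partial>iid J)
      - (\<integral>y. iexp (\<tau> * W J y) * (\<i> * \<tau> * ?v y) \<partial>iid J))
    \<le> (\<integral>y. 2 * \<bar>\<tau>\<bar> powr (q - 1) * (\<integral>x. \<bar>H J y x\<bar> powr q \<partial>M) \<partial>iid J)"
    unfolding Bochner_Integration.integral_diff[OF i1 i2, symmetric]
  proof (rule cmod_integral_mono)
    show "integrable (iid J) (\<lambda>y. 2 * \<bar>\<tau>\<bar> powr (q - 1) * (\<integral>x. \<bar>H J y x\<bar> powr q \<partial>M))"
    proof (intro integrable_mult_right J.integrable_bounded[of _ "?K powr q"])
      fix y assume "y \<in> space (iid J)"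
      then show "norm (\<integral>x. \<bar>H J y x\<bar> powr q \<partial>M) \<le> ?K powr q"
        using J q H_bdd[OF J(1), of y] by (auto intro!: integral_nonneg_le_bound powr_mono2)
    qed (use J in measurable)
    fix y assume y: "y \<in> space (iid J)"
    have "iexp (\<tau> * W J y) * (\<integral>x. H J y x * iexp (\<tau> * H J y x) \<partial>M) - iexp (\<tau> * W J y) * (\<i> * \<tau> * ?v y)
      = iexp (\<tau> * W J y) * ((\<integral>x. H J y x * iexp (\<tau> * H J y x) \<partial>M) - \<i> * \<tau> * ?v y)"
      by (simp only: right_diff_distrib)
    then show "cmod (iexp (\<tau> * W J y) * (\<integral>x. H J y x * iexp (\<tau> * H J y x) \<partial>M) - iexp (\<tau> * W J y) * (\<i> * \<tau> * ?v y))
      \<le> 2 * \<bar>\<tau>\<bar> powr (q - 1) * (\<integral>x. \<bar>H J y x\<bar> powr q \<partial>M)"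
      using integral_H_iexp_approx[OF J(1) y q, of \<tau>] by (simp add: norm_mult)
  qed
  \<comment> \<open>The conditional variance is replaced by its mean.\<close>
  have C: "cmod ((\<integral>y. iexp (\<tau> * W J y) * (\<i> * \<tau> * ?v y) \<partial>iid J)
      - (\<integral>y. iexp (\<tau> * W J y) * (\<i> * \<tau> * ?mV) \<partial>iid J)) \<le> (\<integral>y. \<bar>\<tau>\<bar> * \<bar>?v y - ?mV\<bar> \<partial>iid J)"
    unfolding Bochner_Integration.integral_diff[OF i2 i3, symmetric]
  proof (rule cmod_integral_mono)
    show "integrable (iid J) (\<lambda>y. \<bar>\<tau>\<bar> * \<bar>?v y - ?mV\<bar>)" using integrable_v[OF J(1)] by simp
    fix y
    have "iexp (\<tau> * W J y) * (\<i> * \<tau> * ?v y) - iexp (\<tau> * W J y) * (\<i> * \<tau> * ?mV)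
      = iexp (\<tau> * W J y) * (\<i> * \<tau> * complex_of_real (?v y - ?mV))"
      by (simp add: algebra_simps)
    then show "cmod (iexp (\<tau> * W J y) * (\<i> * \<tau> * ?v y) - iexp (\<tau> * W J y) * (\<i> * \<tau> * ?mV))
      \<le> \<bar>\<tau>\<bar> * \<bar>?v y - ?mV\<bar>"
      by (simp only: norm_mult norm_of_real) simp
  qed
  have D: "(\<integral>y. iexp (\<tau> * W J y) * (\<i> * \<tau> * ?mV) \<partial>iid J) = \<i> * \<tau> * ?mV * charf J \<tau>"
    by (simp add: charf_def mult.commute)
  \<comment> \<open>The return from the reduced sample to the full one.\<close>
  have E: "cmod (\<i> * \<tau> * ?mV * charf J \<tau> - \<i> * \<tau> * ?mV * charf (insert i J) \<tau>) \<le> \<tau>\<^sup>2 * ?mV powr (3 / 2)"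
  proof -
    have "\<i> * \<tau> * ?mV * charf J \<tau> - \<i> * \<tau> * ?mV * charf (insert i J) \<tau>
      = \<i> * \<tau> * complex_of_real ?mV * (charf J \<tau> - charf (insert i J) \<tau>)" by (simp add: algebra_simps)
    also have "cmod \<dots> = \<bar>\<tau>\<bar> * ?mV * cmod (charf (insert i J) \<tau> - charf J \<tau>)"
      using pos by (simp only: norm_mult norm_of_real norm_minus_commute) simp
    also have "\<dots> \<le> \<bar>\<tau>\<bar> * ?mV * (\<bar>\<tau>\<bar> * sqrt ?mV)"
      using pos by (intro mult_left_mono charf_insert_diff J) auto
    also have "\<dots> = \<tau>\<^sup>2 * (?mV powr 1 * ?mV powr (1/2))"
      using pos by (simp add: powr_half_sqrt power2_eq_square)
    also have "?mV powr 1 * ?mV powr (1/2) = ?mV powr (3 / 2)" by (simp only: flip: powr_add) simp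
    finally show ?thesis .
  qed
  have "cmod ((\<integral>y. H J y (y i) * iexp (\<tau> * W (insert i J) y) \<partial>iid (insert i J)) - \<i> * \<tau> * ?mV * charf (insert i J) \<tau>)
    \<le> (\<integral>y. 2 * \<bar>\<tau>\<bar> powr (q - 1) * (\<integral>x. \<bar>H J y x\<bar> powr q \<partial>M) \<partial>iid J)
      + (\<integral>y. \<bar>\<tau>\<bar> * \<bar>?v y - ?mV\<bar> \<partial>iid J) + \<tau>\<^sup>2 * ?mV powr (3 / 2)"
    unfolding 1 using A C[unfolded D] E by (rule norm_diff_triangle_le3)
  then show ?thesis by simp
qed

end

section \<open>From an approximate differential equation to the Gaussian characteristic
  function\<close>

lemma cmod_iexp_diff_le_sq: "cmod (iexp a - 1 - \<i> * a) \<le> a\<^sup>2"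
proof -
  have "cmod (iexp a - 1 - \<i> * a) \<le> \<bar>a\<bar>\<^sup>2 / 2"
    using iexp_approx1[of a 1] by (simp add: numeral_2_eq_2 algebra_simps)
  also have "\<dots> \<le> a\<^sup>2" by simp
  finally show ?thesis .
qed

text \<open>The function \<open>exp (t\<^sup>2 / 2) * \<phi> t\<close> has a small derivative and is \<open>1\<close> at \<open>0\<close>.\<close>

lemma charf_ode_bound:
  fixes \<phi> \<phi>' :: "real \<Rightarrow> complex"
  assumes D: "\<And>t. (\<phi> has_vector_derivative \<phi>' t) (at t)" and 0: "\<phi> 0 = 1"
    and bound: "\<And>s. \<bar>s\<bar> \<le> \<bar>t\<bar> \<Longrightarrow> cmod (\<phi>' s + s * \<phi> s) \<le> \<beta>"
  shows "cmod (\<phi> t - complex_of_real (exp (- t\<^sup>2 / 2))) \<le> \<bar>t\<bar> * \<beta>"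
proof -
  define g where "g s = complex_of_real (exp (s\<^sup>2 / 2)) * \<phi> s" for s
  have \<beta>: "0 \<le> \<beta>" by (rule order_trans[OF norm_ge_zero bound[of 0]]) simp
  have dg: "(g has_vector_derivative complex_of_real (exp (s\<^sup>2 / 2)) * (\<phi>' s + s * \<phi> s)) (at s)" for s
  proof -
    have "((\<lambda>s. exp (s\<^sup>2 / 2)) has_real_derivative exp (s\<^sup>2 / 2) * s) (at s)"
      by (auto intro!: derivative_eq_intros)
    then have "((\<lambda>s. complex_of_real (exp (s\<^sup>2 / 2))) has_vector_derivative complex_of_real (exp (s\<^sup>2 / 2) * s)) (at s)"
      by (rule has_vector_derivative_of_real)
    then have "((\<lambda>s. complex_of_real (exp (s\<^sup>2 / 2)) * \<phi> s) has_vector_derivative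
        (complex_of_real (exp (s\<^sup>2 / 2)) * \<phi>' s + complex_of_real (exp (s\<^sup>2 / 2) * s) * \<phi> s)) (at s)"
      using D[of s] by (rule has_vector_derivative_mult)
    then show ?thesis unfolding g_def by (simp add: algebra_simps)
  qed
  have "cmod (g t - g 0) \<le> exp (t\<^sup>2 / 2) * \<beta> * norm (t - 0)"
  \<comment> \<open>The symmetric interval is convex and contains 0 and t for either sign of t. On
    it exp(s^2/2) is at most exp(t^2/2), a factor that cancels when g is turned back into
    \<phi>.\<close>
  proof (rule differentiable_bound[where S = "{-\<bar>t\<bar>..\<bar>t\<bar>}" and f' = "\<lambda>s x. x *\<^sub>R (complex_of_real (exp (s\<^sup>2 / 2)) * (\<phi>' s + s * \<phi> s))"])
    fix s assume s: "s \<in> {-\<bar>t\<bar>..\<bar>t\<bar>}"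
    show "(g has_derivative (\<lambda>x. x *\<^sub>R (complex_of_real (exp (s\<^sup>2 / 2)) * (\<phi>' s + s * \<phi> s)))) (at s within {-\<bar>t\<bar>..\<bar>t\<bar>})"
      using dg[of s] by (auto simp: has_vector_derivative_def intro: has_derivative_at_withinI)
    have st: "\<bar>s\<bar> \<le> \<bar>t\<bar>" using s by auto
    have "exp (s\<^sup>2 / 2) * cmod (\<phi>' s + s * \<phi> s) \<le> exp (t\<^sup>2 / 2) * \<beta>"
      using bound[OF st] st by (intro mult_mono) (auto simp: abs_le_square_iff)
    then have "norm (complex_of_real (exp (s\<^sup>2 / 2)) * (\<phi>' s + s * \<phi> s)) \<le> exp (t\<^sup>2 / 2) * \<beta>"
      by (simp add: norm_mult)
    then show "onorm (\<lambda>x. x *\<^sub>R (complex_of_real (exp (s\<^sup>2 / 2)) * (\<phi>' s + s * \<phi> s))) \<le> exp (t\<^sup>2 / 2) * \<beta>"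
      by (intro onorm_bound) (auto simp: mult.commute[of "exp _ * _"] intro!: mult_left_mono simp del: norm_mult simp: \<beta>)
  qed auto
  then have le: "cmod (g t - 1) \<le> exp (t\<^sup>2 / 2) * \<beta> * \<bar>t\<bar>" by (simp add: g_def 0)
  have "\<phi> t - complex_of_real (exp (- t\<^sup>2 / 2)) = complex_of_real (exp (- t\<^sup>2 / 2)) * (g t - 1)"
    by (simp add: g_def algebra_simps flip: of_real_mult exp_add)
  also have "cmod \<dots> = exp (- t\<^sup>2 / 2) * cmod (g t - 1)"
    by (simp only: norm_mult norm_of_real) simp
  also have "\<dots> \<le> exp (- t\<^sup>2 / 2) * (exp (t\<^sup>2 / 2) * \<beta> * \<bar>t\<bar>)"
    using le by (intro mult_left_mono) auto
  also have "\<dots> = \<bar>t\<bar> * \<beta>"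
    by (simp add: mult.assoc[symmetric] flip: exp_add)
  finally show ?thesis by simp
qed

context degenerate_kernel
begin

text \<open>W is bounded, so the second-order remainder of the exponential is at most K^2 s^2
  uniformly over the sample; this justifies differentiation under the integral by a direct
  estimate.\<close>

lemma charf_has_derivative:
  assumes I: "finite I"
  shows "((\<lambda>t. charf I (t * c)) has_vector_derivative
      (\<integral>y. \<i> * (c * W I y) * iexp (t * c * W I y) \<partial>iid I)) (at t)"
proof -
  define K where "K = \<bar>c\<bar> * (card I * (card I * B))"
  interpret I: prob_space "iid I" by (rule prob_space_iid)
  have mW [measurable]: "W I \<in> borel_measurable (iid I)" using I by (rule W_measurable)
  have K: "\<bar>c * W I y\<bar> \<le> K" for y
    unfolding abs_mult K_def using W_bdd[OF I] by (intro mult_left_mono) auto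
  have K0: "0 \<le> K" using K[of undefined] by linarith
  let ?D = "\<integral>y. \<i> * (c * W I y) * iexp (t * c * W I y) \<partial>iid I"
  have i1: "integrable (iid I) (\<lambda>y. iexp (s * c * W I y))" for s
    by (rule integrable_iid[where K = 1]) auto
  have i2: "integrable (iid I) (\<lambda>y. \<i> * (c * W I y) * iexp (t * c * W I y))"
    using K by (intro integrable_iid[where K = K]) (auto simp: norm_mult abs_mult)
  have est: "cmod (charf I ((t + s) * c) - charf I (t * c) - s *\<^sub>R ?D) \<le> K\<^sup>2 * s\<^sup>2" for s
  proof -
    have eq: "charf I ((t + s) * c) - charf I (t * c) - s *\<^sub>R ?D
      = (\<integral>y. iexp ((t + s) * c * W I y) - iexp (t * c * W I y)
          - s *\<^sub>R (\<i> * (c * W I y) * iexp (t * c * W I y)) \<partial>iid I)"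
      unfolding charf_def
      by (simp only: Bochner_Integration.integral_diff[OF Bochner_Integration.integrable_diff[OF i1 i1] integrable_scaleR_right[OF i2]]
        Bochner_Integration.integral_diff[OF i1 i1] integral_scaleR_right)
    have "cmod (\<integral>y. iexp ((t + s) * c * W I y) - iexp (t * c * W I y)
          - s *\<^sub>R (\<i> * (c * W I y) * iexp (t * c * W I y)) \<partial>iid I) \<le> (\<integral>y. K\<^sup>2 * s\<^sup>2 \<partial>iid I)"
    proof (rule cmod_integral_mono)
      fix y
      have "iexp ((t + s) * c * W I y) - iexp (t * c * W I y) - s *\<^sub>R (\<i> * (c * W I y) * iexp (t * c * W I y))
        = iexp (t * c * W I y) * (iexp (s * (c * W I y)) - 1 - \<i> * (s * (c * W I y)))"
        by (simp add: algebra_simps scaleR_conv_of_real exp_add)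
      also have "cmod \<dots> \<le> (s * (c * W I y))\<^sup>2"
        unfolding norm_mult using cmod_iexp_diff_le_sq[of "s * (c * W I y)"] by simp
      also have "\<dots> = s\<^sup>2 * \<bar>c * W I y\<bar>\<^sup>2" by (simp add: power_mult_distrib)
      also have "\<dots> \<le> s\<^sup>2 * K\<^sup>2" using K[of y] by (intro mult_left_mono power_mono) auto
      finally show "cmod (iexp ((t + s) * c * W I y) - iexp (t * c * W I y)
          - s *\<^sub>R (\<i> * (c * W I y) * iexp (t * c * W I y))) \<le> K\<^sup>2 * s\<^sup>2" by (simp add: mult.commute)
    qed simp
    moreover have "(\<integral>y. K\<^sup>2 * s\<^sup>2 \<partial>iid I) = K\<^sup>2 * s\<^sup>2" by (simp add: I.prob_space)
    ultimately show ?thesis unfolding eq by linarith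
  qed
  have "((\<lambda>s. norm (charf I ((t + s) * c) - charf I (t * c) - s *\<^sub>R ?D) / norm s) \<longlongrightarrow> 0) (at 0)"
  proof (rule Lim_null_comparison)
    show "\<forall>\<^sub>F s in at 0. norm (norm (charf I ((t + s) * c) - charf I (t * c) - s *\<^sub>R ?D) / norm s) \<le> K\<^sup>2 * \<bar>s\<bar>"
    proof (rule eventually_at_filter[THEN iffD2], intro always_eventually allI impI)
      fix s :: real assume s: "s \<noteq> 0"
      have "norm (norm (charf I ((t + s) * c) - charf I (t * c) - s *\<^sub>R ?D) / norm s)
        = norm (charf I ((t + s) * c) - charf I (t * c) - s *\<^sub>R ?D) / \<bar>s\<bar>"
        by (simp only: real_norm_def abs_divide abs_norm_cancel abs_idempotent)
      also have "\<dots> \<le> (K\<^sup>2 * s\<^sup>2) / \<bar>s\<bar>"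
        by (intro divide_right_mono est) simp
      also have "\<dots> = K\<^sup>2 * \<bar>s\<bar>" using s by (simp add: power2_eq_square field_simps flip: abs_mult)
      finally show "norm (norm (charf I ((t + s) * c) - charf I (t * c) - s *\<^sub>R ?D) / norm s) \<le> K\<^sup>2 * \<bar>s\<bar>" .
    qed
    show "((\<lambda>s. K\<^sup>2 * \<bar>s\<bar>) \<longlongrightarrow> 0) (at 0)" by (auto intro!: tendsto_eq_intros)
  qed
  then show ?thesis
    unfolding has_vector_derivative_def has_derivative_at by (intro conjI bounded_linear_scaleR_left)
qed

text \<open>The constant \<open>c\<close> normalises \<open>W\<close>, whose variance is \<open>m (m + 1) V / 2\<close>. The error consists of a Lyapunov
  term (\<open>\<kappa>1\<close>, \<open>\<kappa>2\<close>) and of the fluctuation of the conditional variance, whose diagonal and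
  off-diagonal parts are controlled by \<open>\<kappa>2\<close> and \<open>\<kappa>3\<close>; \<open>\<epsilon>\<close> is free and is sent to \<open>0\<close> last.\<close>

theorem charf_normal_approx:
  assumes I: "finite I" "card I = Suc m" and m: "0 < m" and V: "0 < V"
    and q: "2 \<le> q" "q \<le> 3" and \<epsilon>: "0 < \<epsilon>"
  defines "c \<equiv> sqrt (2 / (real (Suc m) * m * V))"
    and "\<kappa>1 \<equiv> m powr (2 - q) * h_moment q / V powr (q / 2)"
    and "\<kappa>2 \<equiv> m powr (1 - q / 2) * G_moment (q / 2) / V powr (q / 2)"
    and "\<kappa>3 \<equiv> G_energy / V\<^sup>2"
  shows "cmod (charf I (t * c) - complex_of_real (exp (- t\<^sup>2 / 2))) \<le> \<bar>t\<bar> *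
    (500 * \<bar>t\<bar> powr (q - 1) * (\<kappa>1 + \<kappa>2)
     + \<bar>t\<bar> * (2 * \<epsilon> + 120 * \<epsilon> powr (1 - q / 2) * (\<kappa>2 + m powr (1 - q / 2)) + \<kappa>3 / (2 * \<epsilon>))
     + 2 * t\<^sup>2 / sqrt m)"
proof (rule charf_ode_bound[where \<phi> = "\<lambda>t. charf I (t * c)"])
  interpret I: prob_space "iid I" by (rule prob_space_iid)
  show "((\<lambda>t. charf I (t * c)) has_vector_derivative
      (\<integral>y. \<i> * (c * W I y) * iexp (t * c * W I y) \<partial>iid I)) (at t)" for t
    by (rule charf_has_derivative[OF I(1)])
  show "charf I (0 * c) = 1" by (simp add: charf_def I.prob_space)
  fix s :: real assume st: "\<bar>s\<bar> \<le> \<bar>t\<bar>"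
  let ?p = "real (Suc m)" and ?mV = "real m * V"
  define \<tau> where "\<tau> = s * c"
  have mV: "0 < ?mV" using m V by simp
  have c: "0 < c" "c\<^sup>2 = 2 / (?p * ?mV)" using m V by (auto simp: c_def mult.assoc)
  have mW [measurable]: "W I \<in> borel_measurable (iid I)" using I by (intro W_measurable)
  \<comment> \<open>The bound of \<open>leave_one_out\<close> with both of its integrals estimated,
    at the threshold \<epsilon> m V: fluctuations of the conditional variance are measured relative
    to its mean.\<close>
  define R where "R = 2 * \<bar>\<tau>\<bar> powr (q - 1) * (80 * (m * h_moment q + m powr (q / 2) * G_moment (q / 2)))
      + \<bar>\<tau>\<bar> * (2 * (\<epsilon> * ?mV) + (\<epsilon> * ?mV) powr (1 - q / 2) * (40 * (m * (2 powr (q / 2) * (G_moment (q / 2) + V powr (q / 2)))))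
        + m\<^sup>2 * G_energy / (2 * (\<epsilon> * ?mV)))
      + \<tau>\<^sup>2 * ?mV powr (3 / 2)"
  have Hi: "cmod ((\<integral>y. H (I - {i}) y (y i) * iexp (\<tau> * W I y) \<partial>iid I) - \<i> * \<tau> * ?mV * charf I \<tau>) \<le> R"
    if i: "i \<in> I" for i
  proof -
    define J where "J = I - {i}"
    have J: "finite J" "i \<notin> J" "insert i J = I" "card J = m" using I i by (auto simp: J_def)
    have "cmod ((\<integral>y. H J y (y i) * iexp (\<tau> * W I y) \<partial>iid I) - \<i> * \<tau> * ?mV * charf I \<tau>)
      \<le> 2 * \<bar>\<tau>\<bar> powr (q - 1) * (\<integral>y. (\<integral>x. \<bar>H J y x\<bar> powr q \<partial>M) \<partial>iid J)
      + \<bar>\<tau>\<bar> * (\<integral>y. \<bar>(\<integral>x. (H J y x)\<^sup>2 \<partial>M) - card J * V\<bar> \<partial>iid J)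
      + \<tau>\<^sup>2 * ?mV powr (3 / 2)"
      using leave_one_out[OF J(1,2) _ q, of \<tau>] mV by (simp add: J(3,4))
    also have "\<dots> \<le> R"
      unfolding R_def using double_integral_H_powr[OF J(1) q] integral_abs_dev_le[OF J(1) q, of "\<epsilon> * ?mV"] \<epsilon> mV
      by (intro add_mono mult_left_mono) (auto simp: J(4) h_moment_def G_moment_def)
    finally show ?thesis by (simp add: J_def)
  qed
  \<comment> \<open>W is half the sum of the increments, so the derivative splits into one
    leave-one-out term per observation.\<close>
  have sum: "(\<integral>y. \<i> * (c * W I y) * iexp (s * c * W I y) \<partial>iid I)
    = \<i> * c / 2 * (\<Sum>i\<in>I. \<integral>y. H (I - {i}) y (y i) * iexp (\<tau> * W I y) \<partial>iid I)"
  proof -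
    have "integrable (iid I) (\<lambda>y. H (I - {i}) y (y i) * iexp (\<tau> * W I y))" if i: "i \<in> I" for i
    proof (rule integrable_iid[where K = "card (I - {i}) * B"])
      have "(\<lambda>y. H (I - {i}) y (y i)) \<in> borel_measurable (iid I)"
        unfolding H_def using i by measurable
      then show "(\<lambda>y. H (I - {i}) y (y i) * iexp (\<tau> * W I y)) \<in> borel_measurable (iid I)" by measurable
    qed (use H_bdd[of "I - {i}"] I in \<open>auto simp: norm_mult\<close>)
    then have "(\<Sum>i\<in>I. \<integral>y. H (I - {i}) y (y i) * iexp (\<tau> * W I y) \<partial>iid I)
      = (\<integral>y. (\<Sum>i\<in>I. H (I - {i}) y (y i) * iexp (\<tau> * W I y)) \<partial>iid I)"
      by (subst Bochner_Integration.integral_sum) auto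
    also have "\<dots> = (\<integral>y. 2 * W I y * iexp (\<tau> * W I y) \<partial>iid I)"
      by (simp add: W_eq_sum_H sum_distrib_right)
    finally show ?thesis
      by (simp add: \<tau>_def mult.assoc flip: integral_mult_right_zero)
  qed
  \<comment> \<open>The normalisation makes c^2 (m + 1) m V / 2 equal to 1, so the main terms add up
    to -s times the characteristic function.\<close>
  have "\<i> * c / 2 * (?p * (\<i> * \<tau> * ?mV)) = - complex_of_real (c\<^sup>2 * ?p * ?mV / 2 * s)"
    by (simp add: \<tau>_def power2_eq_square algebra_simps)
  also have "c\<^sup>2 * ?p * ?mV / 2 = 1"
  proof -
    have "?p * ?mV \<noteq> 0" using m V by simp
    then show ?thesis unfolding c(2) by (simp only: mult.assoc) simp
  qed
  finally have cs: "\<i> * c / 2 * (?p * (\<i> * \<tau> * ?mV)) = - complex_of_real s" by simp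
  have "(\<integral>y. \<i> * (c * W I y) * iexp (s * c * W I y) \<partial>iid I) + s * charf I (s * c)
    = \<i> * c / 2 * (\<Sum>i\<in>I. \<integral>y. H (I - {i}) y (y i) * iexp (\<tau> * W I y) \<partial>iid I)
      - \<i> * c / 2 * (?p * (\<i> * \<tau> * ?mV)) * charf I \<tau>"
    unfolding sum cs by (simp add: \<tau>_def)
  also have "\<dots> = \<i> * c / 2 * (\<Sum>i\<in>I. (\<integral>y. H (I - {i}) y (y i) * iexp (\<tau> * W I y) \<partial>iid I) - \<i> * \<tau> * ?mV * charf I \<tau>)"
    using I(2) by (simp add: sum_subtractf algebra_simps)
  also have "cmod \<dots> \<le> c / 2 * (?p * R)"
  proof -
    have "cmod (\<Sum>i\<in>I. (\<integral>y. H (I - {i}) y (y i) * iexp (\<tau> * W I y) \<partial>iid I) - \<i> * \<tau> * ?mV * charf I \<tau>) \<le> ?p * R"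
      using sum_norm_bound[OF Hi, of I] I(2) by simp
    moreover have "cmod (\<i> * c / 2) = c / 2" using c by (simp add: norm_mult norm_divide)
    ultimately show ?thesis using c by (subst norm_mult, simp only:) (intro mult_left_mono, auto)
  qed
  also have "c / 2 * (?p * R) \<le> 500 * \<bar>t\<bar> powr (q - 1) * (\<kappa>1 + \<kappa>2)
     + \<bar>t\<bar> * (2 * \<epsilon> + 120 * \<epsilon> powr (1 - q / 2) * (\<kappa>2 + m powr (1 - q / 2)) + \<kappa>3 / (2 * \<epsilon>))
     + 2 * t\<^sup>2 / sqrt m"
  proof -
    define r where "r = q / 2"
    have r: "1 \<le> r" "r \<le> 3 / 2" "q = 2 * r" using q by (auto simp: r_def)
    have m1: "1 \<le> real m" "0 < real m" "real m \<le> ?p" "0 < ?p" using m by auto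
    \<comment> \<open>Since r <= 3/2, the power is at most 2 sqrt 2, which is below 3.\<close>
    have two: "2 powr r \<le> (3 :: real)"
    proof -
      have "2 powr r \<le> (2 :: real) powr (3 / 2)" using r by (intro powr_mono) auto
      also have "\<dots> = 2 * sqrt 2" using powr_add[of "2::real" 1 "1 / 2"] by (simp add: powr_half_sqrt)
      also have "\<dots> \<le> 2 * (3 / 2)" by (intro mult_left_mono real_le_lsqrt) (auto simp: power2_eq_square)
      finally show ?thesis by simp
    qed
    have cq: "c powr q = 2 powr r * ?p powr (- r) * real m powr (- r) * V powr (- r)"
    proof -
      have "c powr q = (c powr 2) powr r" unfolding r(3) by (simp only: powr_powr)
      also have "c powr 2 = 2 / (?p * ?mV)" using c by simp
      also have "\<dots> powr r = 2 powr r * ?p powr (- r) * real m powr (- r) * V powr (- r)"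
        by (simp only: powr_divide powr_mult) (simp only: powr_minus divide_inverse inverse_mult_distrib mult.assoc)
      finally show ?thesis .
    qed
    \<comment> \<open>The sample size m + 1 may be replaced by m because the exponent 1 - r is
      nonpositive.\<close>
    have pr: "?p powr (1 - r) \<le> m powr (1 - r)" using r m1 by (intro powr_mono2') auto
    have a1: "?p * m * c powr q \<le> 3 * (m powr (2 - q) * V powr (- r))"
    proof -
      have "?p * m * c powr q = 2 powr r * (?p powr (1 - r) * m powr (1 - r)) * V powr (- r)"
        unfolding cq using m1 by (simp add: powr_diff powr_minus divide_inverse)
      also have "\<dots> \<le> 3 * (m powr (1 - r) * m powr (1 - r)) * V powr (- r)"
        using pr two by (intro mult_right_mono mult_mono) auto
      also have "m powr (1 - r) * m powr (1 - r) = m powr (2 - q)" by (simp add: r flip: powr_add)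
      finally show ?thesis by (simp only: mult.assoc)
    qed
    have a2: "?p * m powr r * c powr q \<le> 3 * (m powr (1 - r) * V powr (- r))"
    proof -
      have "?p * m powr r * c powr q = 2 powr r * ?p powr (1 - r) * V powr (- r)"
        unfolding cq using m1 by (simp add: powr_diff powr_minus divide_inverse)
      also have "\<dots> \<le> 3 * m powr (1 - r) * V powr (- r)"
        using pr two by (intro mult_right_mono mult_mono) auto
      finally show ?thesis by (simp only: mult.assoc)
    qed
    have \<kappa>1: "\<kappa>1 = m powr (2 - q) * V powr (- r) * h_moment q"
      unfolding \<kappa>1_def r_def powr_minus divide_inverse by (simp only: ac_simps)
    have \<kappa>2: "\<kappa>2 = m powr (1 - r) * V powr (- r) * G_moment r"
      unfolding \<kappa>2_def r_def powr_minus divide_inverse by (simp only: ac_simps)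
    have \<kappa>0: "0 \<le> \<kappa>1" "0 \<le> \<kappa>2" "0 \<le> \<kappa>3"
      using h_moment_nonneg G_moment_nonneg G_energy_nonneg by (auto simp: \<kappa>1 \<kappa>2 \<kappa>3_def)
    have \<tau>: "\<bar>\<tau>\<bar> = \<bar>s\<bar> * c" using c by (simp add: \<tau>_def abs_mult)
    have frac: "2 / (P * u) * P / 2 = 1 / u" if "P \<noteq> 0" "u \<noteq> 0" for P u :: real
      using that by simp
    have cp: "c\<^sup>2 * ?p / 2 = 1 / ?mV"
      unfolding c(2) by (rule frac) (use m1 V in simp_all)
    have cc: "c * c powr (q - 1) = c powr q" using c by (simp add: powr_diff)
    have "c / 2 * (?p * (2 * \<bar>\<tau>\<bar> powr (q - 1) * (80 * (m * h_moment q + m powr r * G_moment r))))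
      = 80 * \<bar>s\<bar> powr (q - 1) * ((?p * m * c powr q) * h_moment q + (?p * m powr r * c powr q) * G_moment r)"
      unfolding \<tau> powr_mult cc[symmetric] by (simp add: algebra_simps)
    also have "\<dots> \<le> 80 * \<bar>s\<bar> powr (q - 1) * (3 * (m powr (2 - q) * V powr (- r)) * h_moment q
        + 3 * (m powr (1 - r) * V powr (- r)) * G_moment r)"
      using a1 a2 h_moment_nonneg G_moment_nonneg by (intro mult_left_mono add_mono mult_right_mono) auto
    also have "\<dots> = 240 * \<bar>s\<bar> powr (q - 1) * (\<kappa>1 + \<kappa>2)"
      by (simp add: \<kappa>1 \<kappa>2 algebra_simps)
    also have "\<dots> \<le> 500 * \<bar>t\<bar> powr (q - 1) * (\<kappa>1 + \<kappa>2)"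
      using st q \<kappa>0 by (intro mult_mono powr_mono2) auto
    finally have T1: "c / 2 * (?p * (2 * \<bar>\<tau>\<bar> powr (q - 1) * (80 * (m * h_moment q + m powr r * G_moment r))))
      \<le> 500 * \<bar>t\<bar> powr (q - 1) * (\<kappa>1 + \<kappa>2)" .
    let ?X = "2 * (\<epsilon> * ?mV) + (\<epsilon> * ?mV) powr (1 - r) * (40 * (m * (2 powr r * (G_moment r + V powr r))))
        + m\<^sup>2 * G_energy / (2 * (\<epsilon> * ?mV))"
    have X1: "(\<epsilon> * ?mV) powr (1 - r) * (40 * (m * (2 powr r * (G_moment r + V powr r)))) / ?mV
      \<le> 120 * \<epsilon> powr (1 - r) * (\<kappa>2 + m powr (1 - r))"
    proof -
      have "(\<epsilon> * ?mV) powr (1 - r) * (40 * (m * (2 powr r * (G_moment r + V powr r)))) / ?mV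
        = 40 * 2 powr r * (\<epsilon> powr (1 - r) * (m powr (1 - r) * (V powr (1 - r) / V) * (G_moment r + V powr r)))"
        using m1 by (simp add: powr_mult)
      also have "V powr (1 - r) / V = V powr (- r)" using V by (simp add: powr_diff powr_minus divide_inverse)
      also have "m powr (1 - r) * V powr (- r) * (G_moment r + V powr r) = \<kappa>2 + m powr (1 - r)"
        using V by (simp add: \<kappa>2 distrib_left powr_minus)
      also have "40 * 2 powr r * (\<epsilon> powr (1 - r) * (\<kappa>2 + m powr (1 - r))) \<le> 40 * 3 * (\<epsilon> powr (1 - r) * (\<kappa>2 + m powr (1 - r)))"
        using two \<kappa>0 by (intro mult_right_mono) auto
      finally show ?thesis by simp
    qed
    have "c / 2 * (?p * (\<bar>\<tau>\<bar> * ?X)) = \<bar>s\<bar> * (c\<^sup>2 * ?p / 2) * ?X"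
      unfolding \<tau> power2_eq_square by (simp only: ac_simps times_divide_eq_left times_divide_eq_right)
    also have "c\<^sup>2 * ?p / 2 = 1 / ?mV" by (rule cp)
    also have "\<bar>s\<bar> * (1 / ?mV) * ?X = \<bar>s\<bar> * (2 * \<epsilon>
        + (\<epsilon> * ?mV) powr (1 - r) * (40 * (m * (2 powr r * (G_moment r + V powr r)))) / ?mV + \<kappa>3 / (2 * \<epsilon>))"
    proof -
      have "2 * (\<epsilon> * ?mV) / ?mV = 2 * \<epsilon>" using m1 V by simp
      moreover have "m\<^sup>2 * G_energy / (2 * (\<epsilon> * ?mV)) / ?mV = \<kappa>3 / (2 * \<epsilon>)"
        using m1 V \<epsilon> by (simp add: \<kappa>3_def power2_eq_square)
      ultimately show ?thesis
        by (simp only: mult.assoc[of "\<bar>s\<bar>"] divide_inverse_commute[of 1] mult_1_right)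
           (simp only: distrib_left inverse_eq_divide times_divide_eq_left mult_1_left add_divide_distrib)
    qed
    also have "\<dots> \<le> \<bar>t\<bar> * (2 * \<epsilon> + 120 * \<epsilon> powr (1 - r) * (\<kappa>2 + m powr (1 - r)) + \<kappa>3 / (2 * \<epsilon>))"
      using st X1 \<epsilon> mV \<kappa>0 G_moment_nonneg V by (intro mult_mono add_mono add_nonneg_nonneg) auto
    finally have T2: "c / 2 * (?p * (\<bar>\<tau>\<bar> * ?X))
      \<le> \<bar>t\<bar> * (2 * \<epsilon> + 120 * \<epsilon> powr (1 - r) * (\<kappa>2 + m powr (1 - r)) + \<kappa>3 / (2 * \<epsilon>))" .
    have "c / 2 * (?p * (\<tau>\<^sup>2 * ?mV powr (3 / 2))) = s\<^sup>2 * (c * (c\<^sup>2 * ?p / 2) * ?mV powr (3 / 2))"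
      by (simp add: \<tau>_def power_mult_distrib algebra_simps)
    also have "c\<^sup>2 * ?p / 2 = 1 / ?mV" by (rule cp)
    \<comment> \<open>All powers of V cancel: the replacement of \<open>charf J\<close> costs only
      the order 1 / sqrt m, for every kernel.\<close>
    also have "c * (1 / ?mV) * ?mV powr (3 / 2) = sqrt (2 / ?p)"
    proof -
      have "?mV powr (3 / 2) = ?mV * sqrt ?mV"
        using powr_add[of ?mV 1 "1 / 2"] mV by (simp only: powr_half_sqrt less_imp_le powr_one) simp
      then have "c * (1 / ?mV) * ?mV powr (3 / 2) = c * sqrt ?mV" using mV by simp
      also have "\<dots> = sqrt (2 / (?p * m * V) * ?mV)" unfolding c_def by (simp only: real_sqrt_mult)
      also have "2 / (?p * m * V) * ?mV = 2 / ?p"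
      proof -
        have "2 / (P * u) * u = 2 / P" if "u \<noteq> 0" for P u :: real
          using that by simp
        from this[of ?mV ?p] show ?thesis using m1 V by (simp only: mult.assoc) simp
      qed
      finally show ?thesis .
    qed
    also have "s\<^sup>2 * sqrt (2 / ?p) \<le> t\<^sup>2 * (2 / sqrt m)"
    proof (intro mult_mono)
      show "s\<^sup>2 \<le> t\<^sup>2" using st by (simp add: abs_le_square_iff)
      have "sqrt (2 / ?p) \<le> sqrt (4 / m)" using m1 by (intro real_sqrt_le_mono frac_le) auto
      then show "sqrt (2 / ?p) \<le> 2 / sqrt m" by (simp add: real_sqrt_divide)
    qed auto
    finally have T3: "c / 2 * (?p * (\<tau>\<^sup>2 * ?mV powr (3 / 2))) \<le> 2 * t\<^sup>2 / sqrt m" by simp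
    have "c / 2 * (?p * R) = c / 2 * (?p * (2 * \<bar>\<tau>\<bar> powr (q - 1) * (80 * (m * h_moment q + m powr r * G_moment r))))
      + c / 2 * (?p * (\<bar>\<tau>\<bar> * ?X)) + c / 2 * (?p * (\<tau>\<^sup>2 * ?mV powr (3 / 2)))"
      unfolding R_def r_def[symmetric] by (simp only: distrib_left)
    also have "\<dots> \<le> 500 * \<bar>t\<bar> powr (q - 1) * (\<kappa>1 + \<kappa>2)
      + \<bar>t\<bar> * (2 * \<epsilon> + 120 * \<epsilon> powr (1 - r) * (\<kappa>2 + m powr (1 - r)) + \<kappa>3 / (2 * \<epsilon>))
      + 2 * t\<^sup>2 / sqrt m"
      using T1 T2 T3 by (intro add_mono)
    finally show ?thesis by (simp only: r_def)
  qed
  finally show "cmod ((\<integral>y. \<i> * (c * W I y) * iexp (s * c * W I y) \<partial>iid I) + s * charf I (s * c)) \<le> \<dots>" .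
qed

end

subsection \<open>Squared inner products of random unit vectors\<close>

text \<open>Termwise comparison of power series, by (2 k)! >= 2^k k!.\<close>

lemma cosh_le_exp_half_sq: "exp z + exp (- z) \<le> 2 * exp (z\<^sup>2 / 2)" for z :: real
proof -
  have le: "(\<lambda>n. z ^ (2 * n) / fact (2 * n)) n \<le> (z\<^sup>2 / 2) ^ n / fact n" for n
  proof -
    have "(2::real) ^ n * fact n \<le> fact (2 * n)"
    proof (induction n)
      case (Suc n)
      have "(2::real) ^ Suc n * fact (Suc n) = (2 * real n + 2) * (2 ^ n * fact n)" by (simp add: algebra_simps)
      also have "\<dots> \<le> (2 * real n + 2) * ((2 * real n + 1) * fact (2 * n))"
      proof (intro mult_left_mono)
        have "(1::real) * fact (2 * n) \<le> (2 * real n + 1) * fact (2 * n)"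
          by (intro mult_right_mono) auto
        then show "(2::real) ^ n * fact n \<le> (2 * real n + 1) * fact (2 * n)" using Suc by linarith
      qed simp
      also have "\<dots> = fact (2 * Suc n)" by (simp add: algebra_simps)
      finally show ?case .
    qed simp
    then have "z ^ (2 * n) / fact (2 * n) \<le> z ^ (2 * n) / (2 ^ n * fact n)"
      by (intro divide_left_mono) auto
    then show ?thesis by (simp add: power_mult power_divide)
  qed
  have "(\<lambda>n. z ^ (2 * n) / fact (2 * n)) sums cosh z"
  proof -
    have "(\<lambda>n. (\<lambda>n. if even n then z ^ n /\<^sub>R fact n else 0) (2 * n)) sums cosh z"
      using cosh_converges[of z]
      by (subst sums_mono_reindex[of "\<lambda>n. 2 * n"]) (auto simp: strict_mono_def elim!: evenE)
    then show ?thesis by (simp add: divide_inverse mult.commute)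
  qed
  moreover have "(\<lambda>n. (z\<^sup>2 / 2) ^ n / fact n) sums exp (z\<^sup>2 / 2)"
    using exp_converges[of "z\<^sup>2 / 2"] by (simp only: real_scaleR_def divide_inverse mult.commute)
  ultimately have "cosh z \<le> exp (z\<^sup>2 / 2)"
    by (intro sums_le[OF le])
  then show ?thesis by (simp add: cosh_def)
qed

text \<open>46656 is 6^6, from (6 + |z|)^6 = 6^6 (1 + |z|/6)^6 <= 6^6 exp |z|. Exponents up to 6
  cover 2 q for q <= 3.\<close>

lemma powr_le_exp:
  fixes z q :: real
  assumes "0 \<le> q" "q \<le> 6"
  shows "\<bar>z\<bar> powr q \<le> 46656 * (exp z + exp (- z))"
proof -
  have "\<bar>z\<bar> powr q \<le> (6 + \<bar>z\<bar>) powr q" using assms by (intro powr_mono2) auto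
  also have "\<dots> \<le> (6 + \<bar>z\<bar>) powr 6" using assms by (intro powr_mono) auto
  also have "\<dots> = (6 * (1 + \<bar>z\<bar> / 6)) ^ 6"
    by (simp add: powr_numeral)
  also have "\<dots> = 6 ^ 6 * (1 + \<bar>z\<bar> / 6) ^ 6"
    by (rule power_mult_distrib)
  also have "(1 + \<bar>z\<bar> / 6) ^ 6 \<le> exp \<bar>z\<bar>"
    using exp_ge_one_plus_x_over_n_power_n[of "6" "\<bar>z\<bar>"] by simp
  also have "exp \<bar>z\<bar> \<le> exp z + exp (- z)" by (auto simp: abs_if)
  finally show ?thesis by simp
qed

section \<open>Contractions of moment tensors\<close>

definition kron :: "nat \<Rightarrow> nat \<Rightarrow> real" where
  "kron a b = (if a = b then 1 else 0)"

lemma sum_kron: "a < n \<Longrightarrow> (\<Sum>b<n. f b * kron a b) = f a"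
proof -
  assume "a < n"
  have "(\<Sum>b<n. f b * kron a b) = (\<Sum>b<n. if b = a then f b else 0)"
    by (intro sum.cong) (auto simp: kron_def)
  then show ?thesis using \<open>a < n\<close> by simp
qed

lemma sum_kron_product:
  "(\<Sum>j<n. \<Sum>l<n. x j * x l * kron j l) = (\<Sum>j<n. (x j)\<^sup>2)" for x :: "nat \<Rightarrow> real"
  by (intro sum.cong refl) (simp add: sum_kron power2_eq_square)

text \<open>The bracket is the form of a fourth-moment tensor invariant under sign changes and
  permutations of coordinates: three pairings and a diagonal correction. The summation order j, j',
  l, l' is the one in which \<open>sum_product\<close> expands a product of two double sums.\<close>

lemma sum_kron_four:
  fixes x y :: "nat \<Rightarrow> real"
  shows "(\<Sum>j<n. \<Sum>j'<n. \<Sum>l<n. \<Sum>l'<n. x j * x l * (y j' * y l') *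
      (g * (kron j l * kron j' l' + kron j j' * kron l l' + kron j l' * kron l j') + d * (kron j l * kron j j' * kron j l')))
    = g * ((\<Sum>j<n. (x j)\<^sup>2) * (\<Sum>j<n. (y j)\<^sup>2) + 2 * (\<Sum>j<n. x j * y j)\<^sup>2) + d * (\<Sum>j<n. (x j)\<^sup>2 * (y j)\<^sup>2)"
proof -
  have 1: "(\<Sum>j<n. \<Sum>j'<n. \<Sum>l<n. \<Sum>l'<n. x j * x l * (y j' * y l') * (kron j l * kron j' l'))
      = (\<Sum>j<n. (x j)\<^sup>2) * (\<Sum>j<n. (y j)\<^sup>2)"
  proof -
    have "(\<Sum>l<n. \<Sum>l'<n. x j * x l * (y j' * y l') * (kron j l * kron j' l')) = (x j)\<^sup>2 * (y j')\<^sup>2"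
      if "j < n" "j' < n" for j j'
    proof -
      have "(\<Sum>l<n. \<Sum>l'<n. x j * x l * (y j' * y l') * (kron j l * kron j' l'))
        = (\<Sum>l<n. (\<Sum>l'<n. (x j * x l * (y j' * y l') * kron j l) * kron j' l'))" by (simp add: mult.assoc)
      also have "\<dots> = (\<Sum>l<n. (x j * x l * (y j' * y j')) * kron j l)"
        using that by (subst sum_kron) auto
      finally show ?thesis using that by (subst (asm) sum_kron) (auto simp: power2_eq_square)
    qed
    then show ?thesis by (simp add: sum_product)
  qed
  have 2: "(\<Sum>j<n. \<Sum>j'<n. \<Sum>l<n. \<Sum>l'<n. x j * x l * (y j' * y l') * (kron j j' * kron l l')) = (\<Sum>j<n. x j * y j)\<^sup>2"
  proof -
    have "(\<Sum>l<n. \<Sum>l'<n. x j * x l * (y j' * y l') * (kron j j' * kron l l'))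
        = x j * y j' * (\<Sum>l<n. x l * y l) * kron j j'" for j j'
    proof -
      have "(\<Sum>l<n. \<Sum>l'<n. x j * x l * (y j' * y l') * (kron j j' * kron l l'))
        = (\<Sum>l<n. (\<Sum>l'<n. (x j * x l * (y j' * y l') * kron j j') * kron l l'))" by (simp add: mult.assoc)
      also have "\<dots> = (\<Sum>l<n. (x j * x l * (y j' * y l) * kron j j'))"
        by (intro sum.cong refl) (subst sum_kron, auto)
      finally show ?thesis by (simp add: sum_distrib_left sum_distrib_right ac_simps)
    qed
    then have "(\<Sum>j<n. \<Sum>j'<n. \<Sum>l<n. \<Sum>l'<n. x j * x l * (y j' * y l') * (kron j j' * kron l l'))
      = (\<Sum>j<n. \<Sum>j'<n. x j * y j' * (\<Sum>l<n. x l * y l) * kron j j')" by simp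
    also have "\<dots> = (\<Sum>j<n. x j * y j * (\<Sum>l<n. x l * y l))"
      by (intro sum.cong refl) (subst sum_kron, auto)
    finally show ?thesis by (simp add: power2_eq_square sum_distrib_right)
  qed
  have 3: "(\<Sum>j<n. \<Sum>j'<n. \<Sum>l<n. \<Sum>l'<n. x j * x l * (y j' * y l') * (kron j l' * kron l j')) = (\<Sum>j<n. x j * y j)\<^sup>2"
  proof -
    have "(\<Sum>l<n. \<Sum>l'<n. x j * x l * (y j' * y l') * (kron j l' * kron l j')) = (x j * y j) * (x j' * y j')"
      if "j < n" "j' < n" for j j'
    proof -
      have "(\<Sum>l<n. \<Sum>l'<n. x j * x l * (y j' * y l') * (kron j l' * kron l j'))
        = (\<Sum>l<n. (\<Sum>l'<n. (x j * x l * (y j' * y l') * kron j' l) * kron j l'))"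
        by (simp add: kron_def eq_commute[of j'] ac_simps)
      also have "\<dots> = (\<Sum>l<n. (x j * x l * (y j' * y j)) * kron j' l)"
        using that by (subst sum_kron) auto
      finally show ?thesis using that by (subst (asm) sum_kron) (auto simp: ac_simps)
    qed
    then show ?thesis by (simp add: sum_product power2_eq_square)
  qed
  have 4: "(\<Sum>j<n. \<Sum>j'<n. \<Sum>l<n. \<Sum>l'<n. x j * x l * (y j' * y l') * (kron j l * kron j j' * kron j l'))
      = (\<Sum>j<n. (x j)\<^sup>2 * (y j)\<^sup>2)"
  proof (intro sum.cong refl)
    fix j assume "j \<in> {..<n}"
    then have j: "j < n" by simp
    have "(\<Sum>j'<n. \<Sum>l<n. \<Sum>l'<n. x j * x l * (y j' * y l') * (kron j l * kron j j' * kron j l'))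
      = (\<Sum>j'<n. \<Sum>l<n. (\<Sum>l'<n. (x j * x l * (y j' * y l') * kron j l * kron j j') * kron j l'))" by (simp add: mult.assoc)
    also have "\<dots> = (\<Sum>j'<n. \<Sum>l<n. (x j * x l * (y j' * y j) * kron j j') * kron j l)"
    proof (intro sum.cong refl)
      fix j' l
      have "(\<Sum>l'<n. (x j * x l * (y j' * y l') * kron j l * kron j j') * kron j l') = x j * x l * (y j' * y j) * kron j l * kron j j'"
        by (rule sum_kron[OF j])
      then show "(\<Sum>l'<n. (x j * x l * (y j' * y l') * kron j l * kron j j') * kron j l') = x j * x l * (y j' * y j) * kron j j' * kron j l"
        by (simp only: ac_simps)
    qed
    also have "\<dots> = (\<Sum>j'<n. (x j * x j * (y j' * y j)) * kron j j')"
      using j by (subst sum_kron) auto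
    also have "\<dots> = (x j)\<^sup>2 * (y j)\<^sup>2" using j by (subst sum_kron) (auto simp: power2_eq_square)
    finally show "(\<Sum>j'<n. \<Sum>l<n. \<Sum>l'<n. x j * x l * (y j' * y l') * (kron j l * kron j j' * kron j l')) = (x j)\<^sup>2 * (y j)\<^sup>2" .
  qed
  have "(\<Sum>j<n. \<Sum>j'<n. \<Sum>l<n. \<Sum>l'<n. x j * x l * (y j' * y l') *
      (g * (kron j l * kron j' l' + kron j j' * kron l l' + kron j l' * kron l j') + d * (kron j l * kron j j' * kron j l')))
    = (\<Sum>j<n. \<Sum>j'<n. \<Sum>l<n. \<Sum>l'<n. g * (x j * x l * (y j' * y l') * (kron j l * kron j' l'))
      + g * (x j * x l * (y j' * y l') * (kron j j' * kron l l'))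
      + g * (x j * x l * (y j' * y l') * (kron j l' * kron l j'))
      + d * (x j * x l * (y j' * y l') * (kron j l * kron j j' * kron j l')))"
    by (intro sum.cong refl) (simp add: algebra_simps)
  also have "\<dots> = g * ((\<Sum>j<n. (x j)\<^sup>2) * (\<Sum>j<n. (y j)\<^sup>2)) + g * (\<Sum>j<n. x j * y j)\<^sup>2 + g * (\<Sum>j<n. x j * y j)\<^sup>2
      + d * (\<Sum>j<n. (x j)\<^sup>2 * (y j)\<^sup>2)"
    by (simp only: sum.distrib sum_distrib_left[symmetric] 1 2 3 4)
  finally show ?thesis by (simp add: algebra_simps)
qed

lemma integral_sum_mult:
  fixes f :: "'i \<Rightarrow> 'a \<Rightarrow> real"
  assumes "\<And>i. i \<in> I \<Longrightarrow> integrable M (f i)"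
  shows "(\<integral>x. (\<Sum>i\<in>I. c i * f i x) \<partial>M) = (\<Sum>i\<in>I. c i * (\<integral>x. f i x \<partial>M))"
  using assms by (subst Bochner_Integration.integral_sum) auto

lemma integral_double_sum:
  fixes f :: "nat \<Rightarrow> nat \<Rightarrow> 'a \<Rightarrow> real"
  assumes "\<And>j l. j < n \<Longrightarrow> l < n \<Longrightarrow> integrable M (f j l)"
  shows "(\<integral>x. (\<Sum>j<n. \<Sum>l<n. c j l * f j l x) \<partial>M) = (\<Sum>j<n. \<Sum>l<n. c j l * (\<integral>x. f j l x \<partial>M))"
  unfolding sum.cartesian_product split_beta
  using assms by (intro integral_sum_mult[of _ M "\<lambda>p. f (fst p) (snd p)" "\<lambda>p. c (fst p) (snd p)"]) auto

lemma integral_quadruple_sum: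
  fixes f :: "nat \<Rightarrow> nat \<Rightarrow> nat \<Rightarrow> nat \<Rightarrow> 'a \<Rightarrow> real"
  assumes "\<And>j j' l l'. j < n \<Longrightarrow> j' < n \<Longrightarrow> l < n \<Longrightarrow> l' < n \<Longrightarrow> integrable M (f j j' l l')"
  shows "(\<integral>x. (\<Sum>j<n. \<Sum>j'<n. \<Sum>l<n. \<Sum>l'<n. c j j' l l' * f j j' l l' x) \<partial>M)
    = (\<Sum>j<n. \<Sum>j'<n. \<Sum>l<n. \<Sum>l'<n. c j j' l l' * (\<integral>x. f j j' l l' x \<partial>M))"
  unfolding sum.cartesian_product split_beta
  using assms by (intro integral_sum_mult) auto

text \<open>Abstracts a normalised row. The map \<open>flip\<close> acts on the sample space,
  preserves the measure and changes the sign of one coordinate, but only almost everywhere: the unit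
  vector assigned to the zero row is not reflected. The unit norm is demanded everywhere, because
  the kernel has to be bounded everywhere.\<close>

locale exchangeable_sphere = prob_space M for M :: "'a measure" +
  fixes u :: "'a \<Rightarrow> nat \<Rightarrow> real" and n :: nat and b4 g :: real and flip :: "nat \<Rightarrow> 'a \<Rightarrow> 'a"
  assumes n: "2 \<le> n"
    and u_meas [measurable]: "\<And>j. (\<lambda>x. u x j) \<in> borel_measurable M"
    and u_unit: "\<And>x. (\<Sum>j<n. (u x j)\<^sup>2) = 1"
    and moment4: "\<And>j. j < n \<Longrightarrow> (\<integral>x. (u x j) ^ 4 \<partial>M) = b4"
    and moment22: "\<And>j l. j < n \<Longrightarrow> l < n \<Longrightarrow> j \<noteq> l \<Longrightarrow> (\<integral>x. (u x j)\<^sup>2 * (u x l)\<^sup>2 \<partial>M) = g"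
    and flip_meas [measurable]: "\<And>j. j < n \<Longrightarrow> flip j \<in> measurable M M"
    and flip_distr: "\<And>j. j < n \<Longrightarrow> distr M M (flip j) = M"
    and flip_u: "\<And>j. j < n \<Longrightarrow> AE x in M. \<forall>k<n. u (flip j x) k = (if k = j then - u x k else u x k)"
begin

text \<open>Half the mean of (u_1^2 - u_2^2)^2, and later an eigenvalue of the operator with kernel
  h.\<close>

definition b :: real where "b = b4 - g"

lemma u_sq_le: "j < n \<Longrightarrow> (u x j)\<^sup>2 \<le> 1"
proof -
  assume "j < n"
  then have "(u x j)\<^sup>2 \<le> (\<Sum>j<n. (u x j)\<^sup>2)" by (intro member_le_sum) auto
  then show ?thesis by (simp add: u_unit)
qed

lemma abs_u_le: "j < n \<Longrightarrow> \<bar>u x j\<bar> \<le> 1"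
  using u_sq_le[of j x] by (simp add: abs_square_le_1)

lemma integral_flip:
  fixes f :: "'a \<Rightarrow> real"
  assumes "j < n" "f \<in> borel_measurable M"
  shows "(\<integral>x. f (flip j x) \<partial>M) = (\<integral>x. f x \<partial>M)"
  using integral_distr[of "flip j" M M f] assms by (simp add: flip_distr)

lemma abs_mult_le_1: "\<bar>x\<bar> \<le> 1 \<Longrightarrow> \<bar>y\<bar> \<le> 1 \<Longrightarrow> \<bar>x * y\<bar> \<le> 1" for x y :: real
  unfolding abs_mult by (rule mult_le_one) auto

lemma integrable_u4:
  "j < n \<Longrightarrow> j' < n \<Longrightarrow> l < n \<Longrightarrow> l' < n \<Longrightarrow> integrable M (\<lambda>x. u x j * u x l * (u x j' * u x l'))"
  by (intro integrable_bounded[of _ 1]) (auto intro!: abs_mult_le_1 abs_u_le simp del: abs_mult)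

text \<open>Flipping a coordinate that occurs an odd number of times changes the sign of the
  integrand but not the value of the integral.\<close>

lemma integral_u4_odd:
  assumes "k < n" "j < n" "j' < n" "l < n" "l' < n"
    and odd: "(if j = k then -1 else 1) * (if l = k then -1 else 1) * ((if j' = k then -1 else 1) * (if l' = k then -1 else 1)) = (-1 :: real)"
  shows "(\<integral>x. u x j * u x l * (u x j' * u x l') \<partial>M) = 0"
proof -
  let ?f = "\<lambda>x. u x j * u x l * (u x j' * u x l')"
  have "(\<integral>x. ?f x \<partial>M) = (\<integral>x. ?f (flip k x) \<partial>M)"
    using assms by (subst integral_flip) auto
  also have "\<dots> = (\<integral>x. - ?f x \<partial>M)"
  proof (rule integral_cong_AE)
    show "AE x in M. ?f (flip k x) = - ?f x"
      using flip_u[OF assms(1)]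
    proof eventually_elim
      case (elim x)
      define s where "s i = (if i = k then -1 else 1 :: real)" for i
      have e: "u (flip k x) i = s i * u x i" if "i < n" for i
        using elim that by (auto simp: s_def)
      have "?f (flip k x) = (s j * s l * (s j' * s l')) * ?f x"
        using assms by (simp only: e ac_simps)
      also have "s j * s l * (s j' * s l') = -1" using odd by (simp only: s_def)
      finally show ?case by simp
    qed
  qed (use assms in measurable)
  finally show ?thesis by simp
qed

lemma integral_u2_off:
  assumes "j < n" "l < n" "j \<noteq> l"
  shows "(\<integral>x. u x j * u x l \<partial>M) = 0"
proof -
  have "(\<integral>x. u x j * u x l \<partial>M) = (\<integral>x. u (flip j x) j * u (flip j x) l \<partial>M)"
    using assms by (subst integral_flip) auto
  also have "\<dots> = (\<integral>x. - (u x j * u x l) \<partial>M)"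
  proof (rule integral_cong_AE)
    show "AE x in M. u (flip j x) j * u (flip j x) l = - (u x j * u x l)"
      using flip_u[OF assms(1)] by eventually_elim (use assms in auto)
  qed (use assms in measurable)
  finally show ?thesis by simp
qed

lemma integrable_u22: "j < n \<Longrightarrow> l < n \<Longrightarrow> integrable M (\<lambda>x. (u x j)\<^sup>2 * (u x l)\<^sup>2)"
  using integrable_u4[of j l j l] by (simp add: power2_eq_square)

lemma integral_u22: "j < n \<Longrightarrow> l < n \<Longrightarrow> (\<integral>x. (u x j)\<^sup>2 * (u x l)\<^sup>2 \<partial>M) = g + b * kron j l"
  using moment4[of j] moment22[of j l] by (auto simp: kron_def b_def power4_eq_xxxx power2_eq_square mult.assoc)

lemma integrable_u2: "j < n \<Longrightarrow> integrable M (\<lambda>x. (u x j)\<^sup>2)"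
  using u_sq_le by (intro integrable_bounded[of _ 1]) auto

lemma integral_u2_eq: "j < n \<Longrightarrow> (\<integral>x. (u x j)\<^sup>2 \<partial>M) = b + n * g"
proof -
  assume j: "j < n"
  have "(\<integral>x. (u x j)\<^sup>2 \<partial>M) = (\<integral>x. (\<Sum>l<n. (u x j)\<^sup>2 * (u x l)\<^sup>2) \<partial>M)"
    by (simp add: u_unit flip: sum_distrib_left)
  also have "\<dots> = (\<Sum>l<n. g + b * kron j l)"
    using j integrable_u22 by (subst Bochner_Integration.integral_sum) (auto simp: integral_u22)
  also have "\<dots> = b + n * g" using sum_kron[OF j, of "\<lambda>_. b"] by (simp add: sum.distrib)
  finally show ?thesis .
qed

text \<open>Multiplying u_j^2 by the squared norm gives E u_j^2 = b + n g for every j, and these n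
  equal numbers sum to 1. For given n a single free parameter is left among b and g.\<close>

lemma b_plus: "b + n * g = 1 / n"
proof -
  have "1 = (\<integral>x. (\<Sum>j<n. (u x j)\<^sup>2) \<partial>M)" by (simp add: u_unit prob_space)
  also have "\<dots> = (\<Sum>j<n. b + n * g)"
    using integrable_u2 by (subst Bochner_Integration.integral_sum) (auto simp: integral_u2_eq)
  also have "\<dots> = n * (b + n * g)" by simp
  finally show ?thesis using n by (simp add: field_simps)
qed

lemma integral_u2: "j < n \<Longrightarrow> (\<integral>x. (u x j)\<^sup>2 \<partial>M) = 1 / n"
  using integral_u2_eq b_plus by simp

text \<open>Only patterns in which every coordinate occurs an even number of times survive. On the
  full diagonal the three pairings already contribute 3 g, so the correction is b4 - 3 g = b - 2
  g.\<close>

lemma integral_u4: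
  assumes "j < n" "j' < n" "l < n" "l' < n"
  shows "(\<integral>x. u x j * u x l * (u x j' * u x l') \<partial>M)
    = g * (kron j l * kron j' l' + kron j j' * kron l l' + kron j l' * kron l j') + (b - 2 * g) * (kron j l * kron j j' * kron j l')"
proof -
  note sq = integral_u22[unfolded power2_eq_square]
  consider (all) "j = l" "j' = l'" | (two) "j = j'" "l = l'" "j \<noteq> l" | (three) "j = l'" "l = j'" "j \<noteq> l"
    | (odd) k where "k < n" "(if j = k then -1 else 1) * (if l = k then -1 else 1) * ((if j' = k then -1 else 1) * (if l' = k then -1 else 1)) = (-1 :: real)"
      "\<not> (j = l \<and> j' = l')" "\<not> (j = j' \<and> l = l')" "\<not> (j = l' \<and> l = j')"
  proof (cases "(j = l \<and> j' = l') \<or> (j = j' \<and> l = l') \<or> (j = l' \<and> l = j')")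
    case False
    have "\<exists>k<n. (if j = k then -1 else 1) * (if l = k then -1 else 1) * ((if j' = k then -1 else 1) * (if l' = k then -1 else 1)) = (-1 :: real)"
    proof (cases "j = l")
      case True
      then have "j' \<noteq> l'" using False by auto
      then show ?thesis using True assms by (intro exI[of _ j']) auto
    next
      case jl: False
      show ?thesis
      proof (cases "j = j'")
        case True then show ?thesis using False jl assms by (intro exI[of _ l]) auto
      next
        case False': False
        show ?thesis
        proof (cases "j = l'")
          case True then show ?thesis using False False' jl assms by (intro exI[of _ l]) auto
        next
          case False then show ?thesis using False' jl assms by (intro exI[of _ j]) auto
        qed
      qed
    qed
    then show ?thesis using False that(4) by auto
  qed (use that in blast)
  then show ?thesis
  proof cases
    case all
    then show ?thesis using sq[of j j'] assms by (auto simp: kron_def algebra_simps)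
  next
    case two
    then show ?thesis using sq[of j l] assms by (auto simp: kron_def ac_simps)
  next
    case three
    then show ?thesis using sq[of j l] assms by (auto simp: kron_def ac_simps)
  next
    case odd
    then show ?thesis using integral_u4_odd[of k j j' l l'] assms by (auto simp: kron_def)
  qed
qed

section \<open>The kernel h and its diagonal part D\<close>

definition ip :: "'a \<Rightarrow> 'a \<Rightarrow> real" where
  "ip x y = (\<Sum>j<n. u x j * u y j)"

definition Q :: "'a \<Rightarrow> 'a \<Rightarrow> real" where
  "Q x y = (\<Sum>j<n. (u x j)\<^sup>2 * (u y j)\<^sup>2)"

definition D :: "'a \<Rightarrow> 'a \<Rightarrow> real" where
  "D x y = Q x y - 1 / n"

definition h :: "'a \<Rightarrow> 'a \<Rightarrow> real" where
  "h x y = (ip x y)\<^sup>2 - 1 / n"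

lemma u_compose [measurable (raw)]:
  "f \<in> measurable N M \<Longrightarrow> (\<lambda>w. u (f w) j) \<in> borel_measurable N"
  using measurable_compose[OF _ u_meas] .

lemma ip_compose [measurable (raw)]:
  "f \<in> measurable N M \<Longrightarrow> k \<in> measurable N M \<Longrightarrow> (\<lambda>w. ip (f w) (k w)) \<in> borel_measurable N"
  unfolding ip_def by (intro borel_measurable_sum borel_measurable_times u_compose)

lemma Q_compose [measurable (raw)]:
  "f \<in> measurable N M \<Longrightarrow> k \<in> measurable N M \<Longrightarrow> (\<lambda>w. Q (f w) (k w)) \<in> borel_measurable N"
  unfolding Q_def by (intro borel_measurable_sum borel_measurable_times borel_measurable_power u_compose)

lemma D_compose [measurable (raw)]:
  "f \<in> measurable N M \<Longrightarrow> k \<in> measurable N M \<Longrightarrow> (\<lambda>w. D (f w) (k w)) \<in> borel_measurable N"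
  unfolding D_def by (intro borel_measurable_diff Q_compose borel_measurable_const)

lemma n_pos: "0 < real n" "1 / real n \<le> 1 / 2" "0 < 1 / real n"
  using n by (auto simp: field_simps)

lemma ip_self: "ip x x = 1"
  using u_unit[of x] by (simp add: ip_def power2_eq_square)

lemma ip_sq_le: "(ip x y)\<^sup>2 \<le> 1"
proof -
  have "(ip x y)\<^sup>2 \<le> (\<Sum>j<n. (u x j)\<^sup>2) * (\<Sum>j<n. (u y j)\<^sup>2)"
    unfolding ip_def by (rule Cauchy_Schwarz_ineq_sum)
  then show ?thesis by (simp add: u_unit)
qed

lemma Q_nonneg: "0 \<le> Q x y"
  unfolding Q_def by (intro sum_nonneg) auto

lemma Q_le: "Q x y \<le> 1"
proof -
  have "Q x y \<le> (\<Sum>j<n. (u x j)\<^sup>2 * 1)"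
    unfolding Q_def using u_sq_le by (intro sum_mono mult_left_mono) auto
  then show ?thesis by (simp add: u_unit)
qed

lemma abs_D_le: "\<bar>D x y\<bar> \<le> 1"
  unfolding D_def using Q_nonneg[of x y] Q_le[of x y] n_pos by linarith

lemma abs_h_le: "\<bar>h x y\<bar> \<le> 1"
  unfolding h_def using ip_sq_le[of x y] zero_le_power2[of "ip x y"] n_pos by linarith

lemma ip_sq_expand: "(ip x z)\<^sup>2 = (\<Sum>j<n. \<Sum>l<n. u x j * u x l * (u z j * u z l))"
  by (simp add: ip_def power2_eq_square sum_product ac_simps)

lemma integrable_ip_sq: "x \<in> space M \<Longrightarrow> integrable M (\<lambda>z. (ip x z)\<^sup>2)"
  using ip_sq_le by (intro integrable_bounded[of _ 1]) auto

lemma integral_ip_sq: "x \<in> space M \<Longrightarrow> (\<integral>z. (ip x z)\<^sup>2 \<partial>M) = 1 / n"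
proof -
  have int: "integrable M (\<lambda>z. u z j * u z l)" if "j < n" "l < n" for j l
    using that by (intro integrable_bounded[of _ 1]) (auto intro!: abs_mult_le_1 abs_u_le simp del: abs_mult)
  have val: "(\<integral>z. u z j * u z l \<partial>M) = 1 / n * kron j l" if "j < n" "l < n" for j l
    using that integral_u2[of j] integral_u2_off[of j l] by (auto simp: kron_def power2_eq_square)
  have "(\<integral>z. (ip x z)\<^sup>2 \<partial>M) = (\<Sum>j<n. \<Sum>l<n. u x j * u x l * (\<integral>z. u z j * u z l \<partial>M))"
    unfolding ip_sq_expand using int by (rule integral_double_sum)
  also have "\<dots> = (\<Sum>j<n. \<Sum>l<n. 1 / n * (u x j * u x l * kron j l))"
    by (intro sum.cong refl) (simp add: val)
  also have "\<dots> = 1 / n * (\<Sum>j<n. \<Sum>l<n. u x j * u x l * kron j l)"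
    by (simp only: sum_distrib_left)
  also have "\<dots> = 1 / n" by (simp add: sum_kron_product u_unit)
  finally show ?thesis .
qed

lemma integral_ip_sq_ip_sq:
  "(\<integral>z. (ip x z)\<^sup>2 * (ip y z)\<^sup>2 \<partial>M) = g * (1 + 2 * (ip x y)\<^sup>2) + (b - 2 * g) * Q x y"
proof -
  have "(\<integral>z. (ip x z)\<^sup>2 * (ip y z)\<^sup>2 \<partial>M)
    = (\<integral>z. (\<Sum>j<n. \<Sum>j'<n. \<Sum>l<n. \<Sum>l'<n. u x j * u x l * (u y j' * u y l') * (u z j * u z l * (u z j' * u z l'))) \<partial>M)"
    unfolding ip_sq_expand sum_product by (intro Bochner_Integration.integral_cong sum.cong refl) (simp add: ac_simps)
  also have "\<dots> = (\<Sum>j<n. \<Sum>j'<n. \<Sum>l<n. \<Sum>l'<n. u x j * u x l * (u y j' * u y l') * (\<integral>z. u z j * u z l * (u z j' * u z l') \<partial>M))"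
    using integrable_u4 by (rule integral_quadruple_sum)
  also have "\<dots> = (\<Sum>j<n. \<Sum>j'<n. \<Sum>l<n. \<Sum>l'<n. u x j * u x l * (u y j' * u y l') *
      (g * (kron j l * kron j' l' + kron j j' * kron l l' + kron j l' * kron l j') + (b - 2 * g) * (kron j l * kron j j' * kron j l')))"
    by (intro sum.cong refl) (simp only: integral_u4 lessThan_iff)
  also have "\<dots> = g * (1 + 2 * (ip x y)\<^sup>2) + (b - 2 * g) * Q x y"
    unfolding sum_kron_four by (simp add: u_unit ip_def Q_def)
  finally show ?thesis .
qed

end

sublocale exchangeable_sphere \<subseteq> K: degenerate_kernel M h 1
proof
  show "(\<lambda>(x, y). h x y) \<in> borel_measurable (M \<Otimes>\<^sub>M M)" unfolding h_def by measurable
  show "\<bar>h x y\<bar> \<le> 1" for x y by (rule abs_h_le)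
  show "h x y = h y x" for x y by (simp add: h_def ip_def mult.commute)
  show "(\<integral>y. h x y \<partial>M) = 0" if "x \<in> space M" for x
    unfolding h_def using integrable_ip_sq[OF that] integral_ip_sq[OF that] by (simp add: prob_space)
qed

context exchangeable_sphere
begin

text \<open>\<open>h\<close> is the sum of \<open>D\<close> and of an off-diagonal kernel; these are orthogonal, and the operator with
  kernel \<open>h\<close> has the eigenvalues \<open>b\<close> and \<open>2 * g\<close> on them.\<close>

lemma G_eq:
  assumes x: "x \<in> space M" and y: "y \<in> space M"
  shows "K.G x y = 2 * g * h x y + (b - 2 * g) * D x y"
proof -
  have int: "integrable M (\<lambda>z. (ip x z)\<^sup>2 * (ip y z)\<^sup>2)"
    using x y ip_sq_le by (intro integrable_bounded[of _ 1]) (auto intro!: mult_le_one)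
  have "K.G x y = (\<integral>z. (ip x z)\<^sup>2 * (ip y z)\<^sup>2 - 1 / n * (ip x z)\<^sup>2 - 1 / n * (ip y z)\<^sup>2 + 1 / n * (1 / n) \<partial>M)"
    unfolding K.G_def h_def by (intro Bochner_Integration.integral_cong refl) (simp add: algebra_simps)
  also have "\<dots> = g * (1 + 2 * (ip x y)\<^sup>2) + (b - 2 * g) * Q x y - 1 / n * (1 / n) - 1 / n * (1 / n) + 1 / n * (1 / n)"
    using int integrable_ip_sq x y
    by (simp only: Bochner_Integration.integral_add Bochner_Integration.integral_diff integral_mult_right_zero Bochner_Integration.integrable_add Bochner_Integration.integrable_diff integrable_mult_right integrable_const
      integral_ip_sq_ip_sq integral_ip_sq lebesgue_integral_const prob_space) simp
  also have "\<dots> = 2 * g * h x y + (b - 2 * g) * D x y + (g + b * (1 / n) - 1 / n * (1 / n))"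
    unfolding h_def D_def by (simp add: algebra_simps)
  \<comment> \<open>Since 1/n = b + n g, the constants cancel.\<close>
  also have "g + b * (1 / n) - 1 / n * (1 / n) = 0"
    unfolding b_plus[symmetric] using b_plus n_pos by (simp add: field_simps)
  finally show ?thesis by simp
qed

text \<open>The operator with kernel D multiplies D by b. All second moments of D thereby reduce to
  its trace.\<close>

lemma integral_D_D: "x \<in> space M \<Longrightarrow> y \<in> space M \<Longrightarrow> (\<integral>z. D x z * D y z \<partial>M) = b * D x y"
proof -
  assume x: "x \<in> space M" and y: "y \<in> space M"
  have intQ: "integrable M (Q w)" if "w \<in> space M" for w
    using that Q_le Q_nonneg by (intro integrable_bounded[of _ 1]) auto
  have Qint: "(\<integral>z. Q w z \<partial>M) = 1 / n" for w
    unfolding Q_def using integrable_u2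
    by (subst Bochner_Integration.integral_sum) (auto simp: integral_u2 u_unit simp flip: sum_divide_distrib)
  have int: "integrable M (\<lambda>z. Q x z * Q y z)"
    using x y Q_le Q_nonneg by (intro integrable_bounded[of _ 1]) (auto intro!: mult_le_one)
  have QQ: "(\<integral>z. Q x z * Q y z \<partial>M) = g + b * Q x y"
  proof -
    have "(\<integral>z. Q x z * Q y z \<partial>M) = (\<integral>z. (\<Sum>j<n. \<Sum>l<n. (u x j)\<^sup>2 * (u y l)\<^sup>2 * ((u z j)\<^sup>2 * (u z l)\<^sup>2)) \<partial>M)"
      unfolding Q_def sum_product by (intro Bochner_Integration.integral_cong sum.cong refl) (simp add: ac_simps)
    also have "\<dots> = (\<Sum>j<n. \<Sum>l<n. (u x j)\<^sup>2 * (u y l)\<^sup>2 * (\<integral>z. (u z j)\<^sup>2 * (u z l)\<^sup>2 \<partial>M))"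
      using integrable_u22 by (rule integral_double_sum)
    also have "\<dots> = (\<Sum>j<n. \<Sum>l<n. g * ((u x j)\<^sup>2 * (u y l)\<^sup>2) + b * ((u x j)\<^sup>2 * (u y l)\<^sup>2 * kron j l))"
      by (intro sum.cong refl) (simp add: integral_u22 algebra_simps)
    also have "\<dots> = g * ((\<Sum>j<n. (u x j)\<^sup>2) * (\<Sum>l<n. (u y l)\<^sup>2)) + b * (\<Sum>j<n. \<Sum>l<n. (u x j)\<^sup>2 * (u y l)\<^sup>2 * kron j l)"
      unfolding sum_product by (simp only: sum.distrib sum_distrib_left)
    also have "(\<Sum>j<n. \<Sum>l<n. (u x j)\<^sup>2 * (u y l)\<^sup>2 * kron j l) = Q x y"
      unfolding Q_def by (intro sum.cong refl) (subst sum_kron, auto)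
    finally show ?thesis by (simp add: u_unit)
  qed
  have "(\<integral>z. D x z * D y z \<partial>M) = (\<integral>z. Q x z * Q y z - 1 / n * Q x z - 1 / n * Q y z + 1 / n * (1 / n) \<partial>M)"
    unfolding D_def by (intro Bochner_Integration.integral_cong refl) (simp add: algebra_simps)
  also have "\<dots> = g + b * Q x y - 1 / n * (1 / n) - 1 / n * (1 / n) + 1 / n * (1 / n)"
    using int intQ[OF x] intQ[OF y]
    by (simp only: Bochner_Integration.integral_add Bochner_Integration.integral_diff integral_mult_right_zero Bochner_Integration.integrable_add Bochner_Integration.integrable_diff integrable_mult_right integrable_const
      QQ Qint lebesgue_integral_const prob_space) simp
  also have "\<dots> = b * D x y + (g + b * (1 / n) - 1 / n * (1 / n))"
    unfolding D_def by (simp add: algebra_simps)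
  also have "g + b * (1 / n) - 1 / n * (1 / n) = 0"
    unfolding b_plus[symmetric] using b_plus n_pos by (simp add: field_simps)
  finally show ?thesis by simp
qed

end

section \<open>Traces and moments of the kernels D and G\<close>

context exchangeable_sphere
begin

lemma g_nonneg: "0 \<le> g"
proof -
  have "0 \<le> (\<integral>x. (u x 0)\<^sup>2 * (u x 1)\<^sup>2 \<partial>M)" by (intro Bochner_Integration.integral_nonneg) auto
  then show ?thesis using moment22[of 0 1] n by auto
qed

lemma b_nonneg: "0 \<le> b"
proof -
  have j: "0 < n" "1 < n" using n by auto
  have i4: "integrable M (\<lambda>x. (u x j) ^ 4)" if "j < n" for j
    using integrable_u22[OF that that] by (simp add: power2_eq_square power4_eq_xxxx mult.assoc)
  have "g = (\<integral>x. (u x 0)\<^sup>2 * (u x 1)\<^sup>2 \<partial>M)" using moment22[of 0 1] j by simp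
  also have "\<dots> \<le> (\<integral>x. ((u x 0) ^ 4 + (u x 1) ^ 4) / 2 \<partial>M)"
  proof (rule integral_mono)
    fix x
    have "0 \<le> ((u x 0)\<^sup>2 - (u x 1)\<^sup>2)\<^sup>2" by simp
    then show "(u x 0)\<^sup>2 * (u x 1)\<^sup>2 \<le> ((u x 0) ^ 4 + (u x 1) ^ 4) / 2"
      by (simp add: power2_eq_square power4_eq_xxxx algebra_simps)
  qed (use integrable_u22 i4 j in auto)
  also have "\<dots> = b4" using i4 j by (simp add: moment4)
  finally show ?thesis by (simp add: b_def)
qed

lemma b_le_b4: "b \<le> b4"
  using g_nonneg by (simp add: b_def)

lemma n_g_le: "n * g \<le> 1 / n" "b \<le> 1 / n"
proof -
  have "0 \<le> n * g" using g_nonneg by simp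
  then show "n * g \<le> 1 / n" "b \<le> 1 / n" using b_plus b_nonneg by linarith+
qed

text \<open>Cauchy-Schwarz against the constant vector: the fourth powers of the coordinates of a
  unit vector sum to at least 1/n.\<close>

lemma D_diag: "0 \<le> D x x" "D x x \<le> 1 - 1 / n"
proof -
  have "(\<Sum>j<n. (u x j)\<^sup>2)\<^sup>2 \<le> (\<Sum>j<n. 1\<^sup>2) * (\<Sum>j<n. ((u x j)\<^sup>2)\<^sup>2)"
    using Cauchy_Schwarz_ineq_sum[of "\<lambda>_. 1" "\<lambda>j. (u x j)\<^sup>2" "{..<n}"] by simp
  then have "1 \<le> n * (\<Sum>j<n. ((u x j)\<^sup>2)\<^sup>2)" by (simp only: u_unit) simp
  then have "1 \<le> n * Q x x" by (simp add: Q_def power2_eq_square)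
  then show "0 \<le> D x x" using n_pos by (simp add: D_def field_simps)
  show "D x x \<le> 1 - 1 / n" using Q_le[of x x] by (simp add: D_def)
qed

lemma integrable_D_diag: "integrable M (\<lambda>x. D x x)"
  using abs_D_le by (intro integrable_bounded[of _ 1]) auto

lemma integral_D_diag: "(\<integral>x. D x x \<partial>M) = (real n - 1) * b"
proof -
  have "(\<integral>x. Q x x \<partial>M) = (\<Sum>j<n. \<integral>x. (u x j)\<^sup>2 * (u x j)\<^sup>2 \<partial>M)"
    unfolding Q_def by (intro Bochner_Integration.integral_sum integrable_u22) simp_all
  also have "\<dots> = (\<Sum>j<n. g + b * kron j j)"
    by (intro sum.cong refl integral_u22) simp_all
  finally have "(\<integral>x. Q x x \<partial>M) = n * g + n * b" by (simp add: kron_def distrib_left)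
  moreover have "integrable M (\<lambda>x. Q x x)" using Q_le Q_nonneg by (intro integrable_bounded[of _ 1]) auto
  ultimately have "(\<integral>x. D x x \<partial>M) = n * g + n * b - 1 / n" unfolding D_def by (simp add: prob_space)
  then show ?thesis unfolding b_plus[symmetric] by (simp add: algebra_simps)
qed

lemma integral_D_sq: "x \<in> space M \<Longrightarrow> (\<integral>z. (D x z)\<^sup>2 \<partial>M) = b * D x x"
  using integral_D_D[of x x] by (simp add: power2_eq_square)

lemma double_integral_D_sq: "(\<integral>x. (\<integral>z. (D x z)\<^sup>2 \<partial>M) \<partial>M) = (real n - 1) * b\<^sup>2"
proof -
  have "(\<integral>x. (\<integral>z. (D x z)\<^sup>2 \<partial>M) \<partial>M) = (\<integral>x. b * D x x \<partial>M)"
    by (intro Bochner_Integration.integral_cong refl) (simp add: integral_D_sq)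
  then show ?thesis by (simp add: integral_D_diag power2_eq_square)
qed

lemma G_diag: "x \<in> space M \<Longrightarrow> K.G x x = b * D x x + 2 * g * (1 - 1 / n - D x x)"
  by (simp add: G_eq h_def ip_self algebra_simps)

text \<open>The sum of the squared eigenvalues: b with multiplicity n - 1, and 2 g with multiplicity
  n (n - 1) / 2.\<close>

lemma V_eq: "K.V = (real n - 1) * (b\<^sup>2 + 2 * real n * g\<^sup>2)"
proof -
  have "K.V = (\<integral>x. (b - 2 * g) * D x x + 2 * g * (1 - 1 / n) \<partial>M)"
    unfolding K.V_def by (intro Bochner_Integration.integral_cong refl) (simp add: G_diag algebra_simps)
  also have "\<dots> = (b - 2 * g) * ((real n - 1) * b) + 2 * g * (1 - 1 / n)"
    using integrable_D_diag integral_D_diag by (simp add: prob_space)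
  also have "1 - 1 / real n = (real n - 1) * (1 / n)" using n_pos by (simp add: field_simps)
  finally show ?thesis unfolding b_plus[symmetric] by (simp add: algebra_simps power2_eq_square)
qed

lemma V_pos: "0 < K.V"
proof -
  have "b\<^sup>2 + 2 * real n * g\<^sup>2 > 0"
  \<comment> \<open>By b + n g = 1/n, the two parameters cannot vanish together.\<close>
  proof (cases "g = 0")
    case True
    then have "b = 1 / n" using b_plus by simp
    then show ?thesis using True n_pos by simp
  next
    case False
    then have "2 * real n * g\<^sup>2 > 0" using n by simp
    then show ?thesis by (meson add_nonneg_pos zero_le_power2)
  qed
  then show ?thesis unfolding V_eq using n by (intro mult_pos_pos) auto
qed

lemma V_ge: "(real n - 1) * b\<^sup>2 \<le> K.V" "2 * (real n - 1) * real n * g\<^sup>2 \<le> K.V"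
proof -
  have "0 \<le> (real n - 1) * (2 * real n * g\<^sup>2)" "0 \<le> (real n - 1) * b\<^sup>2" using n by auto
  then show "(real n - 1) * b\<^sup>2 \<le> K.V" "2 * (real n - 1) * real n * g\<^sup>2 \<le> K.V"
    unfolding V_eq distrib_left by (simp_all only: ac_simps)
qed

text \<open>D(x, x) lies in [0, 1], so its r-th power is at most D(x, x), whose mean is known; no
  moment of the coordinates beyond the fourth enters.\<close>

lemma G_moment_le:
  assumes r: "1 \<le> r"
  shows "K.G_moment r \<le> 2 powr r * ((real n - 1) * b * b powr r + (2 * g) powr r)"
proof -
  have le: "K.G x x powr r \<le> 2 powr r * (b powr r * D x x + (2 * g) powr r)" if x: "x \<in> space M" for x
  proof -
    have D1: "D x x \<le> 1" using D_diag(2)[of x] n_pos by linarith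
    have "2 * g * (1 - 1 / n - D x x) \<le> 2 * g * 1"
      using D_diag(1)[of x] n_pos(3) g_nonneg by (intro mult_left_mono) linarith+
    then have "K.G x x \<le> b * D x x + 2 * g" using G_diag[OF x] by linarith
    then have "K.G x x powr r \<le> (b * D x x + 2 * g) powr r"
      using K.G_nonneg r by (intro powr_mono2) auto
    also have "\<dots> \<le> 2 powr r * ((b * D x x) powr r + (2 * g) powr r)"
      using b_nonneg g_nonneg D_diag(1) r by (intro powr_add_le_scaled) auto
    also have "(b * D x x) powr r \<le> b powr r * D x x"
    proof -
      have "D x x powr r \<le> D x x powr 1" using D_diag(1)[of x] D1 r by (intro powr_mono') auto
      then show ?thesis using D_diag(1)[of x] by (simp add: powr_mult mult_left_mono)
    qed
    finally show ?thesis by simp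
  qed
  have "K.G_moment r \<le> (\<integral>x. 2 powr r * (b powr r * D x x + (2 * g) powr r) \<partial>M)"
    unfolding K.G_moment_def
  proof (rule integral_mono)
    have [measurable]: "(\<lambda>x. K.G x x) \<in> borel_measurable M"
      by (rule degenerate_kernel.h_compose[OF K.degenerate_kernel_G]) auto
    show "integrable M (\<lambda>x. K.G x x powr r)"
      using r K.G_bdd K.G_nonneg by (intro integrable_bounded[of _ "1 powr r"])
        (auto intro!: powr_mono2[of r _ 1, simplified] order_trans[OF abs_ge_self order_trans[OF K.G_bdd]])
  qed (use le integrable_D_diag in auto)
  also have "\<dots> = 2 powr r * (b powr r * ((real n - 1) * b) + (2 * g) powr r)"
    using integrable_D_diag by (simp add: integral_D_diag prob_space)
  finally show ?thesis by (simp add: ac_simps)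
qed

text \<open>G mixes h and D, whose mean squares are V and (n - 1) b^2; the cross term is removed by
  (s + t)^2 <= 2 s^2 + 2 t^2.\<close>

lemma G_energy_le: "K.G_energy \<le> 8 * g\<^sup>2 * K.V + 2 * (b - 2 * g)\<^sup>2 * ((real n - 1) * b\<^sup>2)"
proof -
  have intD: "integrable M (\<lambda>y. (D x y)\<^sup>2)" if "x \<in> space M" for x
    using that abs_D_le[of x] by (intro integrable_bounded[of _ 1]) (auto simp: abs_square_le_1)
  have inth: "integrable M (\<lambda>y. (h x y)\<^sup>2)" if "x \<in> space M" for x
    using that abs_h_le[of x] by (intro integrable_bounded[of _ 1]) (auto simp: abs_square_le_1)
  have le: "(\<integral>y. (K.G x y)\<^sup>2 \<partial>M) \<le> 8 * g\<^sup>2 * K.G x x + 2 * (b - 2 * g)\<^sup>2 * (\<integral>y. (D x y)\<^sup>2 \<partial>M)" if x: "x \<in> space M" for x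
  proof -
    have "(\<integral>y. (K.G x y)\<^sup>2 \<partial>M) \<le> (\<integral>y. 8 * g\<^sup>2 * (h x y)\<^sup>2 + 2 * (b - 2 * g)\<^sup>2 * (D x y)\<^sup>2 \<partial>M)"
    proof (rule integral_mono_AE[OF _ _ AE_I2])
      show "integrable M (\<lambda>y. (K.G x y)\<^sup>2)"
        using x K.G_bdd[of x] degenerate_kernel.h_measurable_right[OF K.degenerate_kernel_G x]
        by (intro integrable_bounded[of _ 1]) (auto simp: abs_square_le_1)
      show "integrable M (\<lambda>y. 8 * g\<^sup>2 * (h x y)\<^sup>2 + 2 * (b - 2 * g)\<^sup>2 * (D x y)\<^sup>2)"
        using intD inth x by auto
      fix y assume y: "y \<in> space M"
      have "(s + t)\<^sup>2 \<le> 2 * s\<^sup>2 + 2 * t\<^sup>2" for s t :: real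
        using sum_squares_bound[of s t] by (simp add: power2_eq_square algebra_simps)
      from this[of "2 * g * h x y" "(b - 2 * g) * D x y"]
      show "(K.G x y)\<^sup>2 \<le> 8 * g\<^sup>2 * (h x y)\<^sup>2 + 2 * (b - 2 * g)\<^sup>2 * (D x y)\<^sup>2"
        unfolding G_eq[OF x y] by (simp only: power_mult_distrib) simp
    qed
    also have "\<dots> = 8 * g\<^sup>2 * K.G x x + 2 * (b - 2 * g)\<^sup>2 * (\<integral>y. (D x y)\<^sup>2 \<partial>M)"
      using intD[OF x] inth[OF x] by (simp add: K.G_def power2_eq_square)
    finally show ?thesis .
  qed
  have intG: "integrable M (\<lambda>x. K.G x x)"
    using K.G_bdd degenerate_kernel.h_compose[OF K.degenerate_kernel_G, of "\<lambda>x. x" M "\<lambda>x. x"]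
    by (intro integrable_bounded[of _ 1]) auto
  have intDD: "integrable M (\<lambda>x. \<integral>y. (D x y)\<^sup>2 \<partial>M)"
    using abs_D_le by (intro integrable_bounded[of _ 1]) (auto intro!: integral_nonneg_le_bound simp: abs_square_le_1)
  have GMeas: "(\<lambda>x. \<integral>y. (K.G x y)\<^sup>2 \<partial>M) \<in> borel_measurable M"
  proof -
    have "(\<lambda>(x, y). (K.G x y)\<^sup>2) \<in> borel_measurable (M \<Otimes>\<^sub>M M)"
      using K.G_meas by (simp add: split_beta')
    then show ?thesis by measurable
  qed
  have "K.G_energy \<le> (\<integral>x. 8 * g\<^sup>2 * K.G x x + 2 * (b - 2 * g)\<^sup>2 * (\<integral>y. (D x y)\<^sup>2 \<partial>M) \<partial>M)"
    unfolding K.G_energy_def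
  proof (rule integral_mono_AE[OF _ _ AE_I2])
    show "integrable M (\<lambda>x. \<integral>y. (K.G x y)\<^sup>2 \<partial>M)"
      using K.G_bdd GMeas degenerate_kernel.h_measurable_right[OF K.degenerate_kernel_G]
      by (intro integrable_bounded[of _ 1]) (auto intro!: integral_nonneg_le_bound simp: abs_square_le_1)
  qed (use le intG intDD in auto)
  also have "\<dots> = 8 * g\<^sup>2 * K.V + 2 * (b - 2 * g)\<^sup>2 * ((real n - 1) * b\<^sup>2)"
    using intG intDD by (simp add: double_integral_D_sq K.V_def)
  finally show ?thesis .
qed

end

section \<open>A Khintchine inequality from sign flips\<close>

context exchangeable_sphere
begin

text \<open>Division by zero makes the weights vanish if \<open>Q x y = 0\<close>.\<close>

definition w :: "'a \<Rightarrow> 'a \<Rightarrow> nat \<Rightarrow> real" where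
  "w y x j = u x j * u y j / sqrt (Q x y)"

text \<open>Interpolates between the exponential of the weighted sum, at m = n, and a bounded
  factor, at m = 0. The signs are not separate random variables: the flips act on the sample space,
  so linear terms are exchanged for squares one coordinate at a time. The factor with Q is invariant
  under flips.\<close>

definition E :: "real \<Rightarrow> 'a \<Rightarrow> real \<Rightarrow> nat \<Rightarrow> 'a \<Rightarrow> real" where
  "E q y s m x = Q x y powr q * exp ((\<Sum>j<m. s * w y x j) + (\<Sum>j\<in>{m..<n}. (w y x j)\<^sup>2) / 2)"

lemma w_sq_sum: "(\<Sum>j<n. (w y x j)\<^sup>2) \<le> 1"
proof -
  have "(\<Sum>j<n. (w y x j)\<^sup>2) = (\<Sum>j<n. (u x j)\<^sup>2 * (u y j)\<^sup>2 / Q x y)"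
    using Q_nonneg[of x y] by (simp add: w_def power_divide power_mult_distrib)
  also have "\<dots> = Q x y / Q x y" unfolding Q_def by (rule sum_divide_distrib[symmetric])
  finally show ?thesis by simp
qed

lemma w_sq_le: "j < n \<Longrightarrow> (w y x j)\<^sup>2 \<le> 1"
  using member_le_sum[of j "{..<n}" "\<lambda>j. (w y x j)\<^sup>2"] w_sq_sum[of y x] by fastforce

lemma abs_w_le: "j < n \<Longrightarrow> \<bar>w y x j\<bar> \<le> 1"
  using w_sq_le[of j y x] by (simp add: abs_square_le_1)

lemma w_compose [measurable (raw)]:
  "f \<in> measurable N M \<Longrightarrow> y \<in> space M \<Longrightarrow> (\<lambda>z. w y (f z) j) \<in> borel_measurable N"
proof -
  assume f [measurable]: "f \<in> measurable N M" and y: "y \<in> space M"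
  have [measurable]: "(\<lambda>z. Q (f z) y) \<in> borel_measurable N"
    using y by (intro Q_compose f measurable_const)
  show "(\<lambda>z. w y (f z) j) \<in> borel_measurable N" unfolding w_def by measurable
qed

lemma E_measurable: "y \<in> space M \<Longrightarrow> E q y s m \<in> borel_measurable M"
proof -
  assume y: "y \<in> space M"
  have [measurable]: "(\<lambda>x. Q x y) \<in> borel_measurable M" "(\<lambda>x. w y x j) \<in> borel_measurable M" for j
    using y by (auto intro!: Q_compose w_compose)
  show ?thesis unfolding E_def by measurable
qed

lemma E_bounds:
  assumes "m \<le> n" "\<bar>s\<bar> \<le> 1" "0 \<le> q"
  shows "0 \<le> E q y s m x" "E q y s m x \<le> exp (real n + 1)"
proof -
  show "0 \<le> E q y s m x" by (simp add: E_def)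
  have "Q x y powr q \<le> 1 powr q" using Q_le Q_nonneg assms by (intro powr_mono2) auto
  moreover have "(\<Sum>j<m. s * w y x j) \<le> n"
  proof -
    have "(\<Sum>j<m. s * w y x j) \<le> (\<Sum>j<m. 1)"
    proof (rule sum_mono)
      fix j assume "j \<in> {..<m}"
      then have "\<bar>s * w y x j\<bar> \<le> 1" using assms abs_w_le[of j y x] by (intro abs_mult_le_1) auto
      then show "s * w y x j \<le> 1" by linarith
    qed
    then show ?thesis using assms by simp
  qed
  moreover have "(\<Sum>j\<in>{m..<n}. (w y x j)\<^sup>2) / 2 \<le> 1"
  proof -
    have "(\<Sum>j\<in>{m..<n}. (w y x j)\<^sup>2) \<le> (\<Sum>j<n. (w y x j)\<^sup>2)" by (intro sum_mono2) auto
    then show ?thesis using w_sq_sum[of y x] by linarith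
  qed
  ultimately have "E q y s m x \<le> 1 * exp (real n + 1)"
    unfolding E_def by (intro mult_mono) auto
  then show "E q y s m x \<le> exp (real n + 1)" by simp
qed

lemma integrable_E:
  assumes "m \<le> n" "\<bar>s\<bar> \<le> 1" "0 \<le> q" "y \<in> space M"
  shows "integrable M (E q y s m)"
  using assms E_bounds[OF assms(1-3)] E_measurable[OF assms(4)]
  by (intro integrable_bounded[of _ "exp (real n + 1)"]) auto

text \<open>Averaging over the sign flip of coordinate \<open>m\<close> turns \<open>exp z\<close> into \<open>cosh z \<le> exp (z\<^sup>2 / 2)\<close>, with
  \<open>z\<close> the \<open>m\<close>-th weight; all other factors are invariant.\<close>

lemma integral_E_step:
  assumes m: "m < n" and s: "\<bar>s\<bar> = 1" and q: "0 \<le> q" and y: "y \<in> space M"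
  shows "(\<integral>x. E q y s (Suc m) x \<partial>M) \<le> (\<integral>x. E q y s m x \<partial>M)"
proof -
  have s2: "s\<^sup>2 = 1" using s by (metis power2_abs power_one)
  have i1: "integrable M (E q y s (Suc m))" "integrable M (E q y s m)"
    using m s q y by (auto intro!: integrable_E)
  have i2: "integrable M (\<lambda>x. E q y s (Suc m) (flip m x))"
    using m s q y E_bounds[of "Suc m" s q y] E_measurable[OF y, of q s "Suc m"]
    by (intro integrable_bounded[of _ "exp (real n + 1)"]) auto
  have "2 * (\<integral>x. E q y s (Suc m) x \<partial>M) = (\<integral>x. E q y s (Suc m) x \<partial>M) + (\<integral>x. E q y s (Suc m) (flip m x) \<partial>M)"
    using integral_flip[OF m E_measurable[OF y]] by simp
  also have "\<dots> = (\<integral>x. E q y s (Suc m) x + E q y s (Suc m) (flip m x) \<partial>M)"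
    using i1 i2 by simp
  also have "\<dots> \<le> (\<integral>x. 2 * E q y s m x \<partial>M)"
  proof (rule integral_mono_AE)
    show "AE x in M. E q y s (Suc m) x + E q y s (Suc m) (flip m x) \<le> 2 * E q y s m x"
      using flip_u[OF m]
    proof eventually_elim
      case (elim x)
      have Qf: "Q (flip m x) y = Q x y"
        unfolding Q_def using elim by (intro sum.cong) auto
      have wf: "w y (flip m x) j = (if j = m then - w y x j else w y x j)" if "j < n" for j
        using elim that by (auto simp: w_def Qf)
      define A where "A = (\<Sum>j<m. s * w y x j) + (\<Sum>j\<in>{Suc m..<n}. (w y x j)\<^sup>2) / 2"
      define z where "z = s * w y x m"
      have 1: "E q y s (Suc m) x = Q x y powr q * (exp A * exp z)"
        unfolding E_def A_def z_def exp_add[symmetric] by (simp add: algebra_simps)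
      have a: "(\<Sum>j<m. s * w y (flip m x) j) = (\<Sum>j<m. s * w y x j)"
        using m by (intro sum.cong refl) (auto simp: wf)
      have b: "(\<Sum>j\<in>{Suc m..<n}. (w y (flip m x) j)\<^sup>2) = (\<Sum>j\<in>{Suc m..<n}. (w y x j)\<^sup>2)"
        using m by (intro sum.cong refl) (auto simp: wf)
      have 2: "E q y s (Suc m) (flip m x) = Q x y powr q * (exp A * exp (- z))"
        unfolding E_def A_def z_def exp_add[symmetric] Qf b by (simp add: a wf m algebra_simps)
      have z2: "z\<^sup>2 = (w y x m)\<^sup>2" by (simp add: z_def power_mult_distrib s2)
      have c: "(\<Sum>j\<in>{m..<n}. (w y x j)\<^sup>2) = (w y x m)\<^sup>2 + (\<Sum>j\<in>{Suc m..<n}. (w y x j)\<^sup>2)"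
        using m by (simp add: sum.atLeast_Suc_lessThan)
      have 3: "E q y s m x = Q x y powr q * (exp A * exp (z\<^sup>2 / 2))"
        unfolding E_def A_def z2 exp_add[symmetric] c by (simp add: add_divide_distrib algebra_simps)
      have "E q y s (Suc m) x + E q y s (Suc m) (flip m x) = Q x y powr q * exp A * (exp z + exp (- z))"
        unfolding 1 2 by (simp add: algebra_simps)
      also have "\<dots> \<le> Q x y powr q * exp A * (2 * exp (z\<^sup>2 / 2))"
        by (intro mult_left_mono cosh_le_exp_half_sq) auto
      finally show ?case unfolding 3 by (simp add: algebra_simps)
    qed
  qed (use i1 i2 in auto)
  finally show ?thesis using i1 by simp
qed

text \<open>At m = 0 the exponent is half the sum of the squared weights, hence at most 1/2; the
  factor 3 comes from the bound exp 1 <= 3.\<close>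

lemma integral_E_le:
  assumes s: "\<bar>s\<bar> = 1" and q: "0 \<le> q" and y: "y \<in> space M"
  shows "(\<integral>x. E q y s n x \<partial>M) \<le> 3 * (\<integral>x. Q x y powr q \<partial>M)"
proof -
  have "m \<le> n \<Longrightarrow> (\<integral>x. E q y s m x \<partial>M) \<le> (\<integral>x. E q y s 0 x \<partial>M)" for m
  proof (induction m)
    case (Suc m)
    then have "(\<integral>x. E q y s (Suc m) x \<partial>M) \<le> (\<integral>x. E q y s m x \<partial>M)"
      using s q y by (intro integral_E_step) auto
    then show ?case using Suc by linarith
  qed simp
  then have "(\<integral>x. E q y s n x \<partial>M) \<le> (\<integral>x. E q y s 0 x \<partial>M)" by simp
  also have "\<dots> \<le> (\<integral>x. 3 * Q x y powr q \<partial>M)"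
  proof (rule integral_mono)
    show "integrable M (E q y s 0)" using s q y by (intro integrable_E) auto
    have "Q x y powr q \<le> 1 powr q" for x using Q_le Q_nonneg q by (intro powr_mono2) auto
    then show "integrable M (\<lambda>x. 3 * Q x y powr q)"
      using y by (intro integrable_mult_right integrable_bounded[of _ 1]) auto
    fix x
    have "(\<Sum>j\<in>{0..<n}. (w y x j)\<^sup>2) / 2 \<le> 1"
      using w_sq_sum[of y x] by (simp add: atLeast0LessThan)
    then have "exp ((\<Sum>j\<in>{0..<n}. (w y x j)\<^sup>2) / 2) \<le> exp 1" by simp
    also have "exp 1 \<le> (3 :: real)" by (rule exp_le)
    finally have "Q x y powr q * exp ((\<Sum>j\<in>{0..<n}. (w y x j)\<^sup>2) / 2) \<le> Q x y powr q * 3"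
      by (intro mult_left_mono) auto
    then show "E q y s 0 x \<le> 3 * Q x y powr q"
      unfolding E_def by simp
  qed
  finally show ?thesis by simp
qed

text \<open>Given the absolute values of the coordinates, the inner product is a sum with random
  signs and variance Q. Exponential moments of the normalised sum bound its moment of order 2 q. The
  constant is 46656 times 3 for each of the two signs of s.\<close>

lemma khintchine:
  assumes q: "2 \<le> q" "q \<le> 3" and y: "y \<in> space M"
  shows "(\<integral>x. \<bar>ip x y\<bar> powr (2 * q) \<partial>M) \<le> 279936 * (\<integral>x. Q x y powr q \<partial>M)"
proof -
  have "(\<integral>x. \<bar>ip x y\<bar> powr (2 * q) \<partial>M) \<le> (\<integral>x. 46656 * (E q y 1 n x + E q y (-1) n x) \<partial>M)"
  proof (rule integral_mono)
    have "\<bar>ip x y\<bar> powr (2 * q) \<le> 1 powr (2 * q)" for x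
      using ip_sq_le[of x y] q by (intro powr_mono2) (auto simp: abs_square_le_1)
    then show "integrable M (\<lambda>x. \<bar>ip x y\<bar> powr (2 * q))"
      using y by (intro integrable_bounded[of _ 1]) auto
    show "integrable M (\<lambda>x. 46656 * (E q y 1 n x + E q y (-1) n x))"
      using integrable_E[of n 1 q y] integrable_E[of n "-1" q y] y q by simp
    fix x
    show "\<bar>ip x y\<bar> powr (2 * q) \<le> 46656 * (E q y 1 n x + E q y (-1) n x)"
    proof (cases "Q x y = 0")
      \<comment> \<open>Here every product of coordinates is 0, so the inner product vanishes and
        the meaningless normalisation is avoided.\<close>
      case True
      then have "\<forall>j\<in>{..<n}. (u x j)\<^sup>2 * (u y j)\<^sup>2 = 0"
        unfolding Q_def by (subst (asm) sum_nonneg_eq_0_iff) auto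
      then have "ip x y = 0" unfolding ip_def by (intro sum.neutral) auto
      then show ?thesis using E_bounds(1)[of n 1 q y x] E_bounds(1)[of n "-1" q y x] q by simp
    next
      case False
      define z where "z = (\<Sum>j<n. w y x j)"
      have Q: "0 < Q x y" using False Q_nonneg[of x y] by simp
      have "ip x y = sqrt (Q x y) * z"
        unfolding z_def w_def ip_def using Q by (simp add: sum_distrib_left)
      then have "\<bar>ip x y\<bar> powr (2 * q) = sqrt (Q x y) powr (2 * q) * \<bar>z\<bar> powr (2 * q)"
        using Q by (simp add: abs_mult powr_mult)
      also have "sqrt (Q x y) powr (2 * q) = Q x y powr q"
        using Q by (simp add: powr_powr flip: powr_half_sqrt)
      also have "Q x y powr q * \<bar>z\<bar> powr (2 * q) \<le> Q x y powr q * (46656 * (exp z + exp (- z)))"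
        using q by (intro mult_left_mono powr_le_exp) auto
      also have "\<dots> = 46656 * (E q y 1 n x + E q y (-1) n x)"
        by (simp add: E_def z_def sum_negf algebra_simps)
      finally show ?thesis .
    qed
  qed
  also have "\<dots> = 46656 * ((\<integral>x. E q y 1 n x \<partial>M) + (\<integral>x. E q y (-1) n x \<partial>M))"
    using integrable_E[of n 1 q y] integrable_E[of n "-1" q y] y q by simp
  also have "\<dots> \<le> 46656 * (3 * (\<integral>x. Q x y powr q \<partial>M) + 3 * (\<integral>x. Q x y powr q \<partial>M))"
    using q y by (intro mult_left_mono add_mono integral_E_le) auto
  finally show ?thesis by simp
qed

text \<open>Khintchine trades the squared inner product for Q, and D = Q - 1/n satisfies |D|^q <=
  D^2 because |D| <= 1 and q >= 2. The constant rounds up 64 * 279936 + 8; each factor 8 bounds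
  2^q.\<close>

lemma h_moment_le:
  assumes q: "2 \<le> q" "q \<le> 3"
  shows "K.h_moment q \<le> 20000000 * ((real n - 1) * b\<^sup>2 + real n powr (- q))"
proof -
  let ?c = "real n powr (- q)"
  have c: "(1 / real n) powr q = ?c" by (simp only: powr_divide powr_one_eq_one powr_minus_divide)
  have two: "2 powr q \<le> (8 :: real)" using powr_mono[of q 3 "2 :: real"] q by simp
  have intD: "integrable M (\<lambda>z. (D x z)\<^sup>2)" if "x \<in> space M" for x
    using that abs_D_le[of x] by (intro integrable_bounded[of _ 1]) (auto simp: abs_square_le_1)
  have le: "(\<integral>z. \<bar>h x z\<bar> powr q \<partial>M) \<le> 8 * (279936 * (8 * ((\<integral>z. (D x z)\<^sup>2 \<partial>M) + ?c)) + ?c)"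
    if x: "x \<in> space M" for x
  proof -
    have ib: "\<bar>ip z x\<bar> powr (2 * q) \<le> 1 powr (2 * q)" for z
      using ip_sq_le[of z x] q by (intro powr_mono2) (auto simp: abs_square_le_1)
    have int: "integrable M (\<lambda>z. \<bar>ip z x\<bar> powr (2 * q))"
      using x ib by (intro integrable_bounded[of _ 1]) auto
    have "(\<integral>z. \<bar>h x z\<bar> powr q \<partial>M) \<le> (\<integral>z. 8 * (\<bar>ip z x\<bar> powr (2 * q) + ?c) \<partial>M)"
    proof (rule integral_mono)
      have "\<bar>h x z\<bar> powr q \<le> 1 powr q" for z using abs_h_le q by (intro powr_mono2) auto
      then show "integrable M (\<lambda>z. \<bar>h x z\<bar> powr q)"
        using x by (intro integrable_bounded[of _ 1]) auto
      show "integrable M (\<lambda>z. 8 * (\<bar>ip z x\<bar> powr (2 * q) + ?c))" using int by simp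
      fix z
      have ip: "ip x z = ip z x" by (simp add: ip_def mult.commute)
      have "\<bar>h x z\<bar> \<le> (ip z x)\<^sup>2 + 1 / n"
        unfolding h_def ip using n_pos(3) zero_le_power2[of "ip z x"] by linarith
      then have "\<bar>h x z\<bar> powr q \<le> ((ip z x)\<^sup>2 + 1 / n) powr q" using q by (intro powr_mono2) auto
      also have "\<dots> \<le> 2 powr q * (((ip z x)\<^sup>2) powr q + (1 / n) powr q)"
        using q n_pos by (intro powr_add_le_scaled) auto
      also have "((ip z x)\<^sup>2) powr q = (\<bar>ip z x\<bar> powr 2) powr q" by simp
      also have "\<dots> = \<bar>ip z x\<bar> powr (2 * q)" by (simp only: powr_powr)
      also have "2 powr q * (\<bar>ip z x\<bar> powr (2 * q) + (1 / n) powr q) \<le> 8 * (\<bar>ip z x\<bar> powr (2 * q) + (1 / n) powr q)"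
        using two by (intro mult_right_mono) auto
      finally show "\<bar>h x z\<bar> powr q \<le> 8 * (\<bar>ip z x\<bar> powr (2 * q) + ?c)" by (simp only: c)
    qed
    also have "\<dots> = 8 * ((\<integral>z. \<bar>ip z x\<bar> powr (2 * q) \<partial>M) + ?c)"
      using int by (simp add: prob_space)
    also have "(\<integral>z. \<bar>ip z x\<bar> powr (2 * q) \<partial>M) \<le> 279936 * (\<integral>z. Q z x powr q \<partial>M)"
      using q x by (rule khintchine)
    also have "(\<integral>z. Q z x powr q \<partial>M) \<le> (\<integral>z. 8 * ((D x z)\<^sup>2 + ?c) \<partial>M)"
    proof (rule integral_mono)
      have "Q z x powr q \<le> 1 powr q" for z using Q_le Q_nonneg q by (intro powr_mono2) auto
      then show "integrable M (\<lambda>z. Q z x powr q)"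
        using x by (intro integrable_bounded[of _ 1]) auto
      show "integrable M (\<lambda>z. 8 * ((D x z)\<^sup>2 + ?c))" using intD[OF x] by simp
      fix z
      have "Q z x = Q x z" by (simp add: Q_def mult.commute)
      then have "Q z x \<le> \<bar>D x z\<bar> + 1 / n" by (simp add: D_def)
      then have "Q z x powr q \<le> (\<bar>D x z\<bar> + 1 / n) powr q" using Q_nonneg q by (intro powr_mono2) auto
      also have "\<dots> \<le> 2 powr q * (\<bar>D x z\<bar> powr q + (1 / n) powr q)"
        using q n_pos by (intro powr_add_le_scaled) auto
      also have "\<dots> \<le> 8 * ((D x z)\<^sup>2 + (1 / n) powr q)"
      proof (intro mult_mono two add_mono order_refl)
        have "\<bar>D x z\<bar> powr q \<le> \<bar>D x z\<bar> powr 2" using abs_D_le q by (intro powr_mono') auto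
        then show "\<bar>D x z\<bar> powr q \<le> (D x z)\<^sup>2" by simp
      qed auto
      finally show "Q z x powr q \<le> 8 * ((D x z)\<^sup>2 + ?c)" by (simp only: c)
    qed
    also have "(\<integral>z. 8 * ((D x z)\<^sup>2 + ?c) \<partial>M) = 8 * ((\<integral>z. (D x z)\<^sup>2 \<partial>M) + ?c)"
      using intD[OF x] by (simp add: prob_space)
    finally show ?thesis by simp
  qed
  have intDD: "integrable M (\<lambda>x. \<integral>z. (D x z)\<^sup>2 \<partial>M)"
    using abs_D_le by (intro integrable_bounded[of _ 1]) (auto intro!: integral_nonneg_le_bound simp: abs_square_le_1)
  have "K.h_moment q \<le> (\<integral>x. 8 * (279936 * (8 * ((\<integral>z. (D x z)\<^sup>2 \<partial>M) + ?c)) + ?c) \<partial>M)"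
    unfolding K.h_moment_def
  proof (rule integral_mono_AE[OF _ _ AE_I2])
    have "\<bar>h x z\<bar> powr q \<le> 1" for x z
      using powr_mono2[of q "\<bar>h x z\<bar>" 1] abs_h_le q by simp
    then show "integrable M (\<lambda>x. \<integral>z. \<bar>h x z\<bar> powr q \<partial>M)"
      by (intro integrable_bounded[of _ 1]) (auto intro!: integral_nonneg_le_bound)
  qed (use le intDD in auto)
  also have "\<dots> = 8 * (279936 * (8 * ((real n - 1) * b\<^sup>2 + ?c)) + ?c)"
    using intDD by (simp add: double_integral_D_sq prob_space)
  also have "\<dots> \<le> 20000000 * ((real n - 1) * b\<^sup>2 + ?c)"
  proof -
    have "8 * (279936 * (8 * (X + Y)) + Y) \<le> 20000000 * (X + Y)" if "0 \<le> X" "0 \<le> Y" for X Y :: real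
      using that by (simp add: distrib_left)
    then show ?thesis using n by simp
  qed
  finally show ?thesis .
qed

end

subsection \<open>Asymptotic normality for random unit vectors\<close>

context exchangeable_sphere
begin

text \<open>The squared scaling of the trace statistic is \<open>2 * p\<^sup>2 * W0\<close>, whereas its exact variance is
  \<open>2 * p * (p - 1) * V\<close>.\<close>

definition W0 :: real where
  "W0 = n * b4\<^sup>2 + 2 / (real n)\<^sup>2"

text \<open>Eliminating b through b + n g = 1/n leaves a function of n and of n^2 g, which lies in
  [0, 1].\<close>

lemma W0_minus_V: "W0 - K.V = (3 * (1 - (n * (n * g))\<^sup>2) + 3 * (n * (n * g))\<^sup>2 / n) / (real n)\<^sup>2"
proof -
  define N where "N = real n"
  have N: "N \<noteq> 0" using n_pos by (simp add: N_def)
  have b: "b = 1 / N - N * g" using b_plus by (simp add: N_def)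
  have b4: "b4 = b + g" by (simp add: b_def)
  have "N ^ 2 * (N * (1 / N - N * g + g)\<^sup>2 + 2 / N\<^sup>2 - (N - 1) * ((1 / N - N * g)\<^sup>2 + 2 * N * g\<^sup>2))
    = 3 * (1 - (N * (N * g))\<^sup>2) + 3 * (N * (N * g))\<^sup>2 / N"
    using N by (simp add: field_simps power2_eq_square)
  then have "N ^ 2 * (N * b4\<^sup>2 + 2 / N\<^sup>2 - (N - 1) * (b\<^sup>2 + 2 * N * g\<^sup>2)) = 3 * (1 - (N * (N * g))\<^sup>2) + 3 * (N * (N * g))\<^sup>2 / N"
    by (simp only: b[symmetric] b4[symmetric])
  then show ?thesis unfolding W0_def V_eq N_def[symmetric] using N by (simp add: field_simps)
qed

lemma y_bounds: "0 \<le> n * (n * g)" "n * (n * g) \<le> 1"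
  using n_g_le(1) g_nonneg n_pos by (auto simp: field_simps)

lemma W0_ge: "n * b4\<^sup>2 \<le> W0" "2 / (real n)\<^sup>2 \<le> W0" "0 < W0"
proof -
  have "0 < 2 / (real n)\<^sup>2" using n_pos by simp
  moreover have "0 \<le> n * b4\<^sup>2" by simp
  ultimately show "n * b4\<^sup>2 \<le> W0" "2 / (real n)\<^sup>2 \<le> W0" "0 < W0" unfolding W0_def by linarith+
qed

lemma V_le_W0: "K.V \<le> W0"
proof -
  have "(n * (n * g))\<^sup>2 \<le> 1" using y_bounds by (simp add: abs_square_le_1)
  then have "0 \<le> W0 - K.V" unfolding W0_minus_V by (intro divide_nonneg_nonneg add_nonneg_nonneg) auto
  then show ?thesis by simp
qed

text \<open>Put y = n^2 g. Apart from a term of order n^(-3), the gap is of order (1 - y) / n^2,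
  while n^2 W0 >= (1 - y)^2 n + 2. For y near 1 the gap is small, otherwise W0 is large; the balance
  is a relative error of order 1 / sqrt n, uniform over all laws.\<close>

lemma V_ge_W0: "(1 - 5 / sqrt n) * W0 \<le> K.V"
proof -
  define N where "N = real n"
  define y where "y = N * (N * g)"
  have N: "2 \<le> N" using n by (simp add: N_def)
  have y: "0 \<le> y" "y \<le> 1" using y_bounds by (auto simp: y_def N_def)
  have y2: "y\<^sup>2 \<le> 1" using y by (simp add: abs_square_le_1)
  have b4: "N * b4 = (1 - y) + y / N"
  proof -
    have "b4 = 1 / N - N * g + g" using b_plus by (simp add: N_def b_def)
    then show ?thesis using N by (simp add: y_def field_simps)
  qed
  have "N\<^sup>2 * W0 = (N * b4)\<^sup>2 * N + 2"
    unfolding W0_def N_def[symmetric] using N by (simp add: field_simps power2_eq_square)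
  moreover have "(1 - y)\<^sup>2 * N \<le> (N * b4)\<^sup>2 * N"
    unfolding b4 using y N by (intro mult_right_mono power_mono) auto
  ultimately have NW: "(1 - y)\<^sup>2 * N + 2 \<le> N\<^sup>2 * W0" by linarith
  define s where "s = sqrt N"
  have s: "0 < s" "s * s = N" using N by (auto simp: s_def)
  \<comment> \<open>The square is expanded to balance the two regimes of y.\<close>
  have "0 \<le> ((1 - y) * s - 1)\<^sup>2" by simp
  then have "2 * ((1 - y) * s) \<le> (1 - y)\<^sup>2 * N + 1"
    unfolding s(2)[symmetric] by (simp add: power2_eq_square algebra_simps)
  then have 1: "2 * ((1 - y) * s) \<le> N\<^sup>2 * W0" using NW by linarith
  have 2: "2 \<le> N\<^sup>2 * W0" 
  proof -
    have "0 \<le> (1 - y)\<^sup>2 * N" using N by (intro mult_nonneg_nonneg) auto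
    then show ?thesis using NW by linarith
  qed
  have sN: "s \<le> N"
  proof -
    have "1 \<le> s" using N by (simp add: s_def)
    then have "s * 1 \<le> s * s" using s by (intro mult_left_mono) auto
    then show ?thesis using s by simp
  qed
  have "s * (3 * (1 - y\<^sup>2) + 3 * y\<^sup>2 / N) \<le> 5 * (N\<^sup>2 * W0)"
  proof -
    have "1 - y\<^sup>2 = (1 - y) * (1 + y)" by (simp add: power2_eq_square algebra_simps)
    also have "\<dots> \<le> (1 - y) * 2" using y by (intro mult_left_mono) auto
    finally have "s * (3 * (1 - y\<^sup>2)) \<le> s * (3 * ((1 - y) * 2))" using s by (intro mult_left_mono) auto
    also have "\<dots> = 3 * (2 * ((1 - y) * s))" by simp
    finally have a: "s * (3 * (1 - y\<^sup>2)) \<le> 3 * (N\<^sup>2 * W0)" using 1 by linarith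
    have "s * (3 * y\<^sup>2 / N) = 3 * y\<^sup>2 * (s / N)" by simp
    also have "\<dots> \<le> 3 * 1 * 1" using y2 sN s N by (intro mult_mono) auto
    finally have "s * (3 * y\<^sup>2 / N) \<le> 2 * (N\<^sup>2 * W0)" using 2 by linarith
    then show ?thesis using a unfolding distrib_left by linarith
  qed
  then have "N\<^sup>2 * (s * (W0 - K.V)) \<le> N\<^sup>2 * (5 * W0)"
    using N unfolding W0_minus_V N_def[symmetric] y_def[symmetric] by (simp add: ac_simps)
  then have "s * (W0 - K.V) \<le> 5 * W0" using N by simp
  then have "W0 - K.V \<le> 5 / s * W0" using s by (simp add: field_simps)
  then show ?thesis unfolding s_def N_def by (simp add: algebra_simps)
qed

text \<open>From n = 100 on, 5 / sqrt n is at most 1/2.\<close>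

lemma V_ge_half:
  assumes "100 \<le> n"
  shows "n * b4\<^sup>2 / 2 \<le> K.V" "1 / (real n)\<^sup>2 \<le> K.V"
proof -
  have "sqrt 100 \<le> sqrt n" using assms by (intro real_sqrt_le_mono) auto
  then have "5 / sqrt n \<le> 1 / 2" using assms real_sqrt_unique[of 10 100] by (simp add: field_simps)
  then have "1 / 2 * W0 \<le> (1 - 5 / sqrt n) * W0" using W0_ge(3) by (intro mult_right_mono) auto
  then have "1 / 2 * W0 \<le> K.V" using V_ge_W0 by linarith
  then show "n * b4\<^sup>2 / 2 \<le> K.V" "1 / (real n)\<^sup>2 \<le> K.V" using W0_ge by auto
qed

lemma V_powr_ge:
  assumes n100: "100 \<le> n" and q: "0 \<le> q"
  shows "real n powr (- q) \<le> K.V powr (q / 2)"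
proof -
  have "1 / (real n)\<^sup>2 = real n powr (- 2)" using n_pos by (simp add: powr_minus_divide)
  then have "(1 / (real n)\<^sup>2) powr (q / 2) = real n powr (- q)" by (simp only: powr_powr) simp
  moreover have "(1 / (real n)\<^sup>2) powr (q / 2) \<le> K.V powr (q / 2)"
    using V_ge_half(2)[OF n100] q by (intro powr_mono2) auto
  ultimately show ?thesis by simp
qed

lemma h_moment_ratio:
  assumes q: "2 < q" "q \<le> 3" and n100: "100 \<le> n"
  shows "K.h_moment q / K.V powr (q / 2) \<le> 20000000 * ((real n - 1) * b\<^sup>2 / K.V powr (q / 2) + 1)"
proof -
  have "real n powr (- q) / K.V powr (q / 2) \<le> 1" using V_powr_ge[OF n100] q V_pos by simp
  moreover have "K.h_moment q / K.V powr (q / 2) \<le> 20000000 * ((real n - 1) * b\<^sup>2 + real n powr (- q)) / K.V powr (q / 2)"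
    using h_moment_le[of q] q by (intro divide_right_mono) auto
  ultimately show ?thesis by (simp add: add_divide_distrib)
qed

lemma G_moment_ratio:
  assumes r: "1 < r" "r \<le> 3 / 2" and n100: "100 \<le> n"
  shows "K.G_moment r / K.V powr r \<le> 4 * ((real n - 1) * b * b powr r / K.V powr r + 4)"
proof -
  have two: "2 powr r \<le> (4 :: real)" using powr_mono[of r 2 "2 :: real"] r by simp
  have "n * (n * g) \<le> 1" using y_bounds by simp
  then have "g \<le> 1 / (real n)\<^sup>2" using n_pos by (simp add: field_simps power2_eq_square)
  then have "g \<le> K.V" using V_ge_half(2)[OF n100] by linarith
  then have "(2 * g) powr r \<le> (2 * K.V) powr r" using g_nonneg r by (intro powr_mono2) auto
  also have "\<dots> = 2 powr r * K.V powr r" using V_pos by (simp add: powr_mult)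
  also have "\<dots> \<le> 4 * K.V powr r" using two by (intro mult_right_mono) auto
  finally have 1: "(2 * g) powr r / K.V powr r \<le> 4" using V_pos by (simp add: divide_le_eq)
  have "K.G_moment r / K.V powr r \<le> 2 powr r * ((real n - 1) * b * b powr r + (2 * g) powr r) / K.V powr r"
    using G_moment_le[of r] r by (intro divide_right_mono) auto
  also have "\<dots> = 2 powr r * ((real n - 1) * b * b powr r / K.V powr r + (2 * g) powr r / K.V powr r)"
    by (simp only: times_divide_eq_right[symmetric] add_divide_distrib)
  also have "\<dots> \<le> 4 * ((real n - 1) * b * b powr r / K.V powr r + 4)"
    using two 1 b_nonneg n by (intro mult_mono add_mono) auto
  finally show ?thesis .
qed

text \<open>V dominates both (n - 1) b^2 and 2 n (n - 1) g^2, whereas the energy is of order at most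
  (b^2 + g^2) V. It is therefore smaller than V^2 by a factor of order n, whatever the law of the
  entries.\<close>

lemma G_energy_ratio: "K.G_energy / K.V\<^sup>2 \<le> 16 / (real n - 1)"
proof -
  have n1: "1 \<le> real n - 1" using n by simp
  have "(b - 2 * g)\<^sup>2 \<le> 2 * b\<^sup>2 + 8 * g\<^sup>2"
    using sum_squares_bound[of b "- 2 * g"] by (simp add: power2_eq_square algebra_simps)
  then have "2 * (b - 2 * g)\<^sup>2 * ((real n - 1) * b\<^sup>2) \<le> 2 * (2 * b\<^sup>2 + 8 * g\<^sup>2) * K.V"
    using V_ge(1) n1 by (intro mult_mono) auto
  then have "K.G_energy \<le> (24 * g\<^sup>2 + 4 * b\<^sup>2) * K.V"
    using G_energy_le by (simp add: algebra_simps)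
  moreover have "(real n - 1) * (24 * g\<^sup>2 + 4 * b\<^sup>2) \<le> 16 * K.V"
  proof -
    have "(real n - 1) * 1 * g\<^sup>2 \<le> (real n - 1) * real n * g\<^sup>2" using n1 n by (intro mult_right_mono mult_left_mono) auto
    then have "(real n - 1) * g\<^sup>2 \<le> K.V / 2" using V_ge(2) by (simp add: algebra_simps)
    moreover have "(real n - 1) * (24 * g\<^sup>2 + 4 * b\<^sup>2) = 24 * ((real n - 1) * g\<^sup>2) + 4 * ((real n - 1) * b\<^sup>2)"
      by (simp add: algebra_simps)
    ultimately show ?thesis using V_ge(1) by linarith
  qed
  then have "24 * g\<^sup>2 + 4 * b\<^sup>2 \<le> 16 * K.V / (real n - 1)" using n1 by (simp add: field_simps)
  then have "(24 * g\<^sup>2 + 4 * b\<^sup>2) * K.V \<le> 16 * K.V / (real n - 1) * K.V"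
    using V_pos by (intro mult_right_mono) auto
  ultimately have "K.G_energy \<le> 16 / (real n - 1) * K.V\<^sup>2" by (simp add: power2_eq_square)
  then show ?thesis using V_pos by (simp add: divide_le_eq)
qed

text \<open>The lower bound n b4^2 / 2 for V yields a^2 / 2 <= m^2 V and a / 2 <= m V / b. The
  exponent 1 - q/2 is negative, so both ratios are small once a is large.\<close>

lemma ratios_dense:
  assumes q: "2 < q" "q \<le> 3" and n100: "100 \<le> n" and m: "0 < m" and a: "0 < b4" "a = m * sqrt n * b4"
  shows "m powr (2 - q) * ((real n - 1) * b\<^sup>2 / K.V powr (q / 2)) \<le> (a\<^sup>2 / 2) powr (1 - q / 2)"
    and "m powr (1 - q / 2) * ((real n - 1) * b * b powr (q / 2) / K.V powr (q / 2)) \<le> (a / 2) powr (1 - q / 2)"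
proof -
  have ap: "0 < a" using a m n_pos by simp
  have mm: "m powr (2 - q) = (m\<^sup>2) powr (1 - q / 2)"
  proof -
    have "(m\<^sup>2) powr (1 - q / 2) = (m powr 2) powr (1 - q / 2)" using m by simp
    then show ?thesis by (simp only: powr_powr) (simp add: algebra_simps)
  qed
  have "m powr (2 - q) * ((real n - 1) * b\<^sup>2 / K.V powr (q / 2)) \<le> (m\<^sup>2) powr (1 - q / 2) * (K.V / K.V powr (q / 2))"
    unfolding mm using V_ge(1) by (intro mult_left_mono divide_right_mono) auto
  also have "K.V / K.V powr (q / 2) = K.V powr (1 - q / 2)" using V_pos by (simp add: powr_diff)
  also have "(m\<^sup>2) powr (1 - q / 2) * K.V powr (1 - q / 2) = (m\<^sup>2 * K.V) powr (1 - q / 2)"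
    using V_pos by (simp add: powr_mult)
  also have "\<dots> \<le> (a\<^sup>2 / 2) powr (1 - q / 2)"
  proof (rule powr_mono2')
    have "a\<^sup>2 / 2 = m\<^sup>2 * (n * b4\<^sup>2 / 2)" using n_pos by (simp add: a(2) power_mult_distrib)
    also have "\<dots> \<le> m\<^sup>2 * K.V" using V_ge_half(1)[OF n100] by (intro mult_left_mono) auto
    finally show "a\<^sup>2 / 2 \<le> m\<^sup>2 * K.V" .
  qed (use ap q in auto)
  finally show "m powr (2 - q) * ((real n - 1) * b\<^sup>2 / K.V powr (q / 2)) \<le> (a\<^sup>2 / 2) powr (1 - q / 2)" .
  show "m powr (1 - q / 2) * ((real n - 1) * b * b powr (q / 2) / K.V powr (q / 2)) \<le> (a / 2) powr (1 - q / 2)"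
  proof (cases "b = 0")
    case False
    then have b: "0 < b" using b_nonneg by simp
    have "(real n - 1) * b * b powr (q / 2) = (real n - 1) * b\<^sup>2 * b powr (q / 2 - 1)"
      using b by (simp add: powr_diff power2_eq_square)
    also have "\<dots> \<le> K.V * b powr (q / 2 - 1)" using V_ge(1) by (intro mult_right_mono) auto
    finally have "(real n - 1) * b * b powr (q / 2) / K.V powr (q / 2) \<le> K.V * b powr (q / 2 - 1) / K.V powr (q / 2)"
      by (intro divide_right_mono) auto
    also have "\<dots> = (K.V / b) powr (1 - q / 2)"
    proof -
      have "K.V powr (1 - q / 2) = K.V / K.V powr (q / 2)" using V_pos by (simp add: powr_diff)
      moreover have "b powr (q / 2 - 1) = 1 / b powr (1 - q / 2)"
        using powr_minus_divide[of b "1 - q / 2"] by simp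
      ultimately show ?thesis unfolding powr_divide by simp
    qed
    finally have "m powr (1 - q / 2) * ((real n - 1) * b * b powr (q / 2) / K.V powr (q / 2)) \<le> m powr (1 - q / 2) * (K.V / b) powr (1 - q / 2)"
      by (intro mult_left_mono) auto
    also have "\<dots> = (m * (K.V / b)) powr (1 - q / 2)" by (rule powr_mult[symmetric])
    also have "\<dots> \<le> (a / 2) powr (1 - q / 2)"
    proof (rule powr_mono2')
      have "sqrt n * 1 \<le> sqrt n * sqrt n" using n by (intro mult_left_mono) auto
      then have sn: "sqrt n \<le> n" by simp
      have "b4 * b4 * n / 2 \<le> K.V" using V_ge_half(1)[OF n100] by (simp add: power2_eq_square ac_simps)
      have "b * (b4 * n / 2) \<le> K.V"
      proof -
        have "b * (b4 * n / 2) \<le> b4 * (b4 * n / 2)"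
          using a n_pos by (intro mult_right_mono b_le_b4) auto
        also have "\<dots> = b4 * b4 * n / 2" by simp
        finally show ?thesis using \<open>b4 * b4 * n / 2 \<le> K.V\<close> by linarith
      qed
      then have "n * b4 / 2 \<le> K.V / b" using b by (simp add: field_simps)
      moreover have "sqrt n * b4 / 2 \<le> n * b4 / 2" using sn a by (intro divide_right_mono mult_right_mono) auto
      ultimately have "m * (sqrt n * b4 / 2) \<le> m * (K.V / b)" using m by (intro mult_left_mono) auto
      then show "a / 2 \<le> m * (K.V / b)" by (simp add: a(2))
    qed (use ap q in auto)
    finally show ?thesis .
  qed auto
qed

text \<open>Here V >= n^(-2) replaces the lower bound in terms of b4, so that an upper bound on b4
  is what is required.\<close>

lemma ratios_sparse:
  assumes q: "2 < q" "q \<le> 3" and n100: "100 \<le> n" and C: "n powr (1 + q) * b4\<^sup>2 \<le> C"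
  shows "(real n - 1) * b\<^sup>2 / K.V powr (q / 2) \<le> C"
    and "(real n - 1) * b * b powr (q / 2) / K.V powr (q / 2) \<le> C"
proof -
  have Vq: "real n powr (- q) \<le> K.V powr (q / 2)" using V_powr_ge[OF n100] q by simp
  have "(real n - 1) * b\<^sup>2 \<le> n * b4\<^sup>2"
    using b_nonneg b_le_b4 n by (intro mult_mono power_mono) auto
  then have "(real n - 1) * b\<^sup>2 / K.V powr (q / 2) \<le> n * b4\<^sup>2 / real n powr (- q)"
    using Vq n_pos by (intro frac_le) auto
  also have "\<dots> = n powr (1 + q) * b4\<^sup>2" using n_pos by (simp add: powr_add powr_minus field_simps)
  finally show 1: "(real n - 1) * b\<^sup>2 / K.V powr (q / 2) \<le> C" using C by linarith
  have "b * b powr (q / 2) \<le> b\<^sup>2"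
  proof -
    have "b \<le> 1" using n_g_le(2) n_pos(2) by linarith
    then have "b powr (q / 2) \<le> b powr 1"
      using b_nonneg q by (intro powr_mono') auto
    then show ?thesis using b_nonneg mult_left_mono[of "b powr (q / 2)" b b] by (simp add: power2_eq_square)
  qed
  then have "(real n - 1) * (b * b powr (q / 2)) \<le> (real n - 1) * b\<^sup>2" using n by (intro mult_left_mono) auto
  then have "(real n - 1) * (b * b powr (q / 2)) / K.V powr (q / 2) \<le> (real n - 1) * b\<^sup>2 / K.V powr (q / 2)"
    by (intro divide_right_mono) auto
  then show "(real n - 1) * b * b powr (q / 2) / K.V powr (q / 2) \<le> C" using 1 by (simp add: mult.assoc)
qed

end

section \<open>Passage to the limit\<close>

lemma tendsto_zero_approx:
  fixes f :: "nat \<Rightarrow> real" and K :: real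
  assumes K: "0 \<le> K"
    and A: "\<And>\<epsilon>. 0 < \<epsilon> \<Longrightarrow> \<exists>A. A \<longlonglongrightarrow> 0 \<and> (\<forall>\<^sub>F n in sequentially. \<bar>f n\<bar> \<le> K * \<epsilon> + A n)"
  shows "f \<longlonglongrightarrow> 0"
proof (rule tendstoI)
  fix e :: real assume e: "0 < e"
  define \<epsilon> where "\<epsilon> = e / (2 * (K + 1))"
  have \<epsilon>: "0 < \<epsilon>" using e K by (simp add: \<epsilon>_def)
  have Ke: "K * \<epsilon> \<le> e / 2" using e K by (simp add: \<epsilon>_def field_simps)
  from A[OF \<epsilon>] obtain A where "A \<longlonglongrightarrow> 0" and le: "\<forall>\<^sub>F n in sequentially. \<bar>f n\<bar> \<le> K * \<epsilon> + A n" by blast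
  then have "\<forall>\<^sub>F n in sequentially. A n < e / 2" using e by (intro order_tendstoD(2)[of A 0]) auto
  with le show "\<forall>\<^sub>F n in sequentially. dist (f n) 0 < e"
    by eventually_elim (use Ke in simp)
qed

text \<open>The error bound increases with the size of the argument, so one value T serves all
  arguments in a bounded range.\<close>

lemma rate_mono:
  fixes x T K E r q :: real
  assumes x: "0 \<le> x" "x \<le> T" and K: "0 \<le> K" and E: "0 \<le> E" and r: "0 \<le> r" and q: "1 \<le> q"
  shows "x * (500 * x powr (q - 1) * K + x * E + 2 * x\<^sup>2 / r)
    \<le> T * (500 * T powr (q - 1) * K + T * E + 2 * T\<^sup>2 / r)"
proof -
  have "x powr (q - 1) \<le> T powr (q - 1)" using x q by (intro powr_mono2) auto
  then have "500 * x powr (q - 1) * K \<le> 500 * T powr (q - 1) * K" using K by (intro mult_right_mono) auto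
  moreover have "x * E \<le> T * E" using x E by (intro mult_right_mono)
  moreover have "2 * x\<^sup>2 / r \<le> 2 * T\<^sup>2 / r" using x r by (intro divide_right_mono mult_left_mono power_mono) auto
  moreover have "0 \<le> 500 * x powr (q - 1) * K + x * E + 2 * x\<^sup>2 / r"
    using x K E r by (intro add_nonneg_nonneg mult_nonneg_nonneg divide_nonneg_nonneg) auto
  ultimately show ?thesis using x by (intro mult_mono) linarith+
qed

context
  fixes M :: "nat \<Rightarrow> 'a measure" and u :: "nat \<Rightarrow> 'a \<Rightarrow> nat \<Rightarrow> real" and b4 g :: "nat \<Rightarrow> real"
    and flip :: "nat \<Rightarrow> nat \<Rightarrow> 'a \<Rightarrow> 'a" and p :: "nat \<Rightarrow> nat" and q :: real
  assumes sph: "\<And>n. 2 \<le> n \<Longrightarrow> exchangeable_sphere (M n) (u n) n (b4 n) (g n) (flip n)"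
    and p: "filterlim p at_top sequentially"
    and q: "2 < q" "q \<le> 3"
begin

abbreviation "skern n \<equiv> exchangeable_sphere.h (u n) n"
abbreviation "Vn n \<equiv> degenerate_kernel.V (M n) (skern n)"
abbreviation "pred_p n \<equiv> real (p n - 1)"
abbreviation "kap1 n \<equiv> pred_p n powr (2 - q) * degenerate_kernel.h_moment (M n) (skern n) q / Vn n powr (q / 2)"
abbreviation "kap2 n \<equiv> pred_p n powr (1 - q / 2) * degenerate_kernel.G_moment (M n) (skern n) (q / 2) / Vn n powr (q / 2)"
abbreviation "kap3 n \<equiv> degenerate_kernel.G_energy (M n) (skern n) / (Vn n)\<^sup>2"

lemma pred_p_at_top: "filterlim pred_p at_top sequentially"
proof -
  have "filterlim (\<lambda>n. p n - 1) at_top sequentially"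
    using filterlim_compose[OF filterlim_minus_const_nat_at_top p] .
  then show ?thesis by (rule filterlim_compose[OF filterlim_real_sequentially])
qed

lemma kap3_tendsto: "kap3 \<longlonglongrightarrow> 0"
proof (rule Lim_null_comparison)
  show "\<forall>\<^sub>F n in sequentially. norm (kap3 n) \<le> 16 / (real n - 1)"
    using eventually_ge_at_top[of 2]
  proof eventually_elim
    case (elim n)
    interpret S: exchangeable_sphere "M n" "u n" n "b4 n" "g n" "flip n" using elim by (rule sph)
    show ?case using S.G_energy_ratio S.K.G_energy_nonneg by simp
  qed
  show "(\<lambda>n. 16 / (real n - 1)) \<longlonglongrightarrow> 0" by real_asymp
qed

lemma kap_tendsto_dense:
  assumes dense: "filterlim (\<lambda>n. real (p n) * sqrt n * b4 n) at_top sequentially"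
  shows "kap1 \<longlonglongrightarrow> 0" "kap2 \<longlonglongrightarrow> 0"
proof -
  \<comment> \<open>The error bounds count the other observations, so the divergence of p sqrt n b4
    is transferred to p - 1 in place of p; this costs a factor 2 once p >= 2.\<close>
  define a where "a n = pred_p n * sqrt n * b4 n" for n
  have b4_pos: "\<forall>\<^sub>F n in sequentially. 0 < b4 n"
    using filterlim_at_top_dense[THEN iffD1, rule_format, OF dense, of 0]
    by eventually_elim (auto simp: zero_less_mult_iff mult_less_0_iff dest: less_imp_le not_less[THEN iffD2])
  have p2: "\<forall>\<^sub>F n in sequentially. 2 \<le> p n"
    using p by (auto simp: filterlim_at_top)
  have a_top: "filterlim a at_top sequentially"
  proof (rule filterlim_at_top_mono)
    show "filterlim (\<lambda>n. 1 / 2 * (real (p n) * sqrt n * b4 n)) at_top sequentially"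
      using dense by (intro filterlim_tendsto_pos_mult_at_top[OF tendsto_const]) auto
    show "\<forall>\<^sub>F n in sequentially. 1 / 2 * (real (p n) * sqrt n * b4 n) \<le> a n"
      using b4_pos p2
    proof eventually_elim
      case (elim n)
      have "1 / 2 * real (p n) * (sqrt n * b4 n) \<le> pred_p n * (sqrt n * b4 n)"
        using elim by (intro mult_right_mono) auto
      then show ?case by (simp add: a_def ac_simps)
    qed
  qed
  have good: "\<forall>\<^sub>F n in sequentially. 100 \<le> n \<and> 0 < pred_p n \<and> 0 < b4 n"
    using eventually_ge_at_top[of 100] b4_pos p2 by eventually_elim auto
  have a2_top: "filterlim (\<lambda>n. (a n)\<^sup>2 / 2) at_top sequentially"
  proof -
    have "filterlim (\<lambda>n. a n * a n) at_top sequentially" using a_top by (rule filterlim_at_top_mult_at_top[OF a_top])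
    then have "filterlim (\<lambda>n. 1 / 2 * (a n * a n)) at_top sequentially"
      by (intro filterlim_tendsto_pos_mult_at_top[OF tendsto_const]) auto
    then show ?thesis by (simp add: power2_eq_square)
  qed
  have ah_top: "filterlim (\<lambda>n. a n / 2) at_top sequentially"
    using filterlim_tendsto_pos_mult_at_top[OF tendsto_const _ a_top, of "1 / 2"] by simp
  show "kap1 \<longlonglongrightarrow> 0"
  proof (rule Lim_null_comparison)
    show "\<forall>\<^sub>F n in sequentially. norm (kap1 n) \<le> 20000000 * (((a n)\<^sup>2 / 2) powr (1 - q / 2) + pred_p n powr (2 - q))"
      using good
    proof eventually_elim
      case (elim n)
      interpret S: exchangeable_sphere "M n" "u n" n "b4 n" "g n" "flip n" using elim by (intro sph) auto
      have "kap1 n = pred_p n powr (2 - q) * (S.K.h_moment q / S.K.V powr (q / 2))" by simp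
      also have "\<dots> \<le> pred_p n powr (2 - q) * (20000000 * ((real n - 1) * S.b\<^sup>2 / S.K.V powr (q / 2) + 1))"
        using elim by (intro mult_left_mono S.h_moment_ratio q) auto
      also have "\<dots> = 20000000 * (pred_p n powr (2 - q) * ((real n - 1) * S.b\<^sup>2 / S.K.V powr (q / 2)) + pred_p n powr (2 - q))"
        by (simp only: distrib_left ac_simps mult_1_right)
      also have "\<dots> \<le> 20000000 * (((a n)\<^sup>2 / 2) powr (1 - q / 2) + pred_p n powr (2 - q))"
        using elim by (intro mult_left_mono add_right_mono S.ratios_dense(1) q) (auto simp: a_def)
      finally show ?case using S.K.h_moment_nonneg by simp
    qed
    show "(\<lambda>n. 20000000 * (((a n)\<^sup>2 / 2) powr (1 - q / 2) + pred_p n powr (2 - q))) \<longlonglongrightarrow> 0"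
      using q by (intro tendsto_mult_right_zero tendsto_add_zero tendsto_neg_powr a2_top pred_p_at_top) auto
  qed
  show "kap2 \<longlonglongrightarrow> 0"
  proof (rule Lim_null_comparison)
    show "\<forall>\<^sub>F n in sequentially. norm (kap2 n) \<le> 4 * ((a n / 2) powr (1 - q / 2) + 4 * pred_p n powr (1 - q / 2))"
      using good
    proof eventually_elim
      case (elim n)
      interpret S: exchangeable_sphere "M n" "u n" n "b4 n" "g n" "flip n" using elim by (intro sph) auto
      have "kap2 n = pred_p n powr (1 - q / 2) * (S.K.G_moment (q / 2) / S.K.V powr (q / 2))" by simp
      also have "\<dots> \<le> pred_p n powr (1 - q / 2) * (4 * ((real n - 1) * S.b * S.b powr (q / 2) / S.K.V powr (q / 2) + 4))"
        using elim q by (intro mult_left_mono S.G_moment_ratio) auto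
      also have "\<dots> = 4 * (pred_p n powr (1 - q / 2) * ((real n - 1) * S.b * S.b powr (q / 2) / S.K.V powr (q / 2)) + 4 * pred_p n powr (1 - q / 2))"
        by (simp only: distrib_left ac_simps)
      also have "\<dots> \<le> 4 * ((a n / 2) powr (1 - q / 2) + 4 * pred_p n powr (1 - q / 2))"
        using elim by (intro mult_left_mono add_right_mono S.ratios_dense(2) q) (auto simp: a_def)
      finally show ?case using S.K.G_moment_nonneg by simp
    qed
    show "(\<lambda>n. 4 * ((a n / 2) powr (1 - q / 2) + 4 * pred_p n powr (1 - q / 2))) \<longlonglongrightarrow> 0"
      using q by (intro tendsto_mult_right_zero tendsto_add_zero tendsto_neg_powr ah_top pred_p_at_top) auto
  qed
qed

lemma kap_tendsto_sparse:
  assumes C: "\<forall>\<^sub>F n in sequentially. n powr (1 + q) * (b4 n)\<^sup>2 \<le> C"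
  shows "kap1 \<longlonglongrightarrow> 0" "kap2 \<longlonglongrightarrow> 0"
proof -
  show "kap1 \<longlonglongrightarrow> 0"
  proof (rule Lim_null_comparison)
    show "\<forall>\<^sub>F n in sequentially. norm (kap1 n) \<le> pred_p n powr (2 - q) * (20000000 * (C + 1))"
      using C eventually_ge_at_top[of 100]
    proof eventually_elim
      case (elim n)
      interpret S: exchangeable_sphere "M n" "u n" n "b4 n" "g n" "flip n" using elim by (intro sph) auto
      have "kap1 n = pred_p n powr (2 - q) * (S.K.h_moment q / S.K.V powr (q / 2))" by simp
      also have "\<dots> \<le> pred_p n powr (2 - q) * (20000000 * ((real n - 1) * S.b\<^sup>2 / S.K.V powr (q / 2) + 1))"
        using elim by (intro mult_left_mono S.h_moment_ratio q) auto
      also have "\<dots> \<le> pred_p n powr (2 - q) * (20000000 * (C + 1))"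
        using elim by (intro mult_left_mono add_right_mono S.ratios_sparse(1) q) auto
      finally show ?case using S.K.h_moment_nonneg by simp
    qed
    show "(\<lambda>n. pred_p n powr (2 - q) * (20000000 * (C + 1))) \<longlonglongrightarrow> 0"
      using q by (intro tendsto_mult_left_zero tendsto_neg_powr pred_p_at_top) auto
  qed
  show "kap2 \<longlonglongrightarrow> 0"
  proof (rule Lim_null_comparison)
    show "\<forall>\<^sub>F n in sequentially. norm (kap2 n) \<le> pred_p n powr (1 - q / 2) * (4 * (C + 4))"
      using C eventually_ge_at_top[of 100]
    proof eventually_elim
      case (elim n)
      interpret S: exchangeable_sphere "M n" "u n" n "b4 n" "g n" "flip n" using elim by (intro sph) auto
      have "kap2 n = pred_p n powr (1 - q / 2) * (S.K.G_moment (q / 2) / S.K.V powr (q / 2))" by simp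
      also have "\<dots> \<le> pred_p n powr (1 - q / 2) * (4 * ((real n - 1) * S.b * S.b powr (q / 2) / S.K.V powr (q / 2) + 4))"
        using elim q by (intro mult_left_mono S.G_moment_ratio) auto
      also have "\<dots> \<le> pred_p n powr (1 - q / 2) * (4 * (C + 4))"
        using elim by (intro mult_left_mono add_right_mono S.ratios_sparse(2) q) auto
      finally show ?case using S.K.G_moment_nonneg by simp
    qed
    show "(\<lambda>n. pred_p n powr (1 - q / 2) * (4 * (C + 4))) \<longlonglongrightarrow> 0"
      using q by (intro tendsto_mult_left_zero tendsto_neg_powr pred_p_at_top) auto
  qed
qed

text \<open>\<sigma> is not the exact standard deviation. The argument 2 t / \<sigma> is therefore
  written as s c with c the exact normaliser, and s tends to t because V / W0 and (p - 1) / p tend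
  to 1. The error bound is needed at the moving point s, hence uniformly up to |t| + 1.\<close>

theorem charf_sphere_tendsto:
  assumes cond: "filterlim (\<lambda>n. real (p n) * sqrt n * b4 n) at_top sequentially
      \<or> (\<exists>C. \<forall>\<^sub>F n in sequentially. n powr (1 + q) * (b4 n)\<^sup>2 \<le> C)"
  defines "\<sigma> \<equiv> \<lambda>n. sqrt (2 * (real (p n))\<^sup>2 * real n * ((b4 n)\<^sup>2 + 2 / real n ^ 3))"
  shows "(\<lambda>n. degenerate_kernel.charf (M n) (skern n) {..<p n} (2 * t / \<sigma> n)) \<longlonglongrightarrow> complex_of_real (exp (- t\<^sup>2 / 2))"
proof -
  have k12: "kap1 \<longlonglongrightarrow> 0" "kap2 \<longlonglongrightarrow> 0"
    using cond kap_tendsto_dense kap_tendsto_sparse by blast+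
  have p2: "\<forall>\<^sub>F n in sequentially. 2 \<le> p n"
    using p by (auto simp: filterlim_at_top)
  define c where "c n = sqrt (2 / (real (p n) * pred_p n * Vn n))" for n
  define s where "s n = t * sqrt (pred_p n / p n * (Vn n / exchangeable_sphere.W0 n (b4 n)))" for n
  have good: "\<forall>\<^sub>F n in sequentially. 2 \<le> n \<and> 2 \<le> p n"
    using eventually_ge_at_top[of 2] p2 by eventually_elim simp
  have sc: "\<forall>\<^sub>F n in sequentially. 2 * t / \<sigma> n = s n * c n"
    using good
  proof eventually_elim
    case (elim n)
    interpret S: exchangeable_sphere "M n" "u n" n "b4 n" "g n" "flip n" using elim by (intro sph) auto
    let ?P = "real (p n)"
    have pos: "0 < ?P" "0 < pred_p n" "0 < S.W0" "0 < S.K.V" using elim S.W0_ge(3) S.V_pos by auto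
    have W: "2 * ?P\<^sup>2 * real n * ((b4 n)\<^sup>2 + 2 / real n ^ 3) = 2 * ?P\<^sup>2 * S.W0"
      unfolding S.W0_def using S.n_pos by (simp add: field_simps power2_eq_square power3_eq_cube)
    have "sqrt (pred_p n / ?P * (S.K.V / S.W0)) * sqrt (2 / (?P * pred_p n * S.K.V)) = sqrt (4 / (2 * ?P\<^sup>2 * S.W0))"
      unfolding real_sqrt_mult[symmetric] using pos by (intro arg_cong[where f = sqrt]) (simp add: field_simps power2_eq_square)
    also have "\<dots> = 2 / sqrt (2 * ?P\<^sup>2 * S.W0)" by (simp only: real_sqrt_divide real_sqrt_four)
    finally show ?case unfolding s_def c_def \<sigma>_def W by (simp add: mult.assoc)
  qed
  have st: "s \<longlonglongrightarrow> t"
  proof -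
    have "(\<lambda>n. Vn n / exchangeable_sphere.W0 n (b4 n)) \<longlonglongrightarrow> 1"
    proof (rule tendsto_sandwich)
      show "\<forall>\<^sub>F n in sequentially. 1 - 5 / sqrt n \<le> Vn n / exchangeable_sphere.W0 n (b4 n)"
        using eventually_ge_at_top[of 2]
      proof eventually_elim
        case (elim n)
        interpret S: exchangeable_sphere "M n" "u n" n "b4 n" "g n" "flip n" using elim by (rule sph)
        show ?case using S.V_ge_W0 S.W0_ge(3) by (simp add: le_divide_eq)
      qed
      show "\<forall>\<^sub>F n in sequentially. Vn n / exchangeable_sphere.W0 n (b4 n) \<le> 1"
        using eventually_ge_at_top[of 2]
      proof eventually_elim
        case (elim n)
        interpret S: exchangeable_sphere "M n" "u n" n "b4 n" "g n" "flip n" using elim by (rule sph)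
        show ?case using S.V_le_W0 S.W0_ge(3) by (simp add: divide_le_eq)
      qed
      show "(\<lambda>n. 1 - 5 / sqrt (real n)) \<longlonglongrightarrow> 1" by real_asymp
    qed simp
    moreover have "(\<lambda>n. pred_p n / p n) \<longlonglongrightarrow> 1"
    proof -
      have "(\<lambda>k. real (k - 1) / real k) \<longlonglongrightarrow> 1"
      proof (rule Lim_transform_eventually)
        show "(\<lambda>k. (real k - 1) / real k) \<longlonglongrightarrow> 1" by real_asymp
        show "\<forall>\<^sub>F k in sequentially. (real k - 1) / real k = real (k - 1) / real k"
          using eventually_ge_at_top[of 1] by eventually_elim (simp add: of_nat_diff)
      qed
      then show ?thesis by (rule filterlim_compose[OF _ p])
    qed
    ultimately have "s \<longlonglongrightarrow> t * sqrt (1 * 1)" unfolding s_def by (intro tendsto_intros)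
    then show ?thesis by simp
  qed
  have "(\<lambda>n. cmod (degenerate_kernel.charf (M n) (skern n) {..<p n} (s n * c n) - exp (- (s n)\<^sup>2 / 2))) \<longlonglongrightarrow> 0"
  \<comment> \<open>The factor is T * T * 2 with T = |t| + 1: the coefficient of \<epsilon> in the
    error bound, the one part that does not vanish as n grows for fixed \<epsilon>.\<close>
  proof (rule tendsto_zero_approx[where K = "2 * (\<bar>t\<bar> + 1)\<^sup>2"])
    fix \<epsilon> :: real assume \<epsilon>: "0 < \<epsilon>"
    let ?T = "\<bar>t\<bar> + 1"
    define A where "A n = ?T * (500 * ?T powr (q - 1) * (kap1 n + kap2 n)
     + ?T * (120 * \<epsilon> powr (1 - q / 2) * (kap2 n + pred_p n powr (1 - q / 2)) + kap3 n / (2 * \<epsilon>))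
     + 2 * ?T\<^sup>2 / sqrt (pred_p n))" for n
    have A0: "A \<longlonglongrightarrow> 0"
    proof -
      have "(\<lambda>n. 2 * ?T\<^sup>2 / sqrt (pred_p n)) \<longlonglongrightarrow> 0"
        using filterlim_compose[OF sqrt_at_top pred_p_at_top]
        by (intro real_tendsto_divide_at_top[OF tendsto_const])
      moreover have "(\<lambda>n. pred_p n powr (1 - q / 2)) \<longlonglongrightarrow> 0" using q by (intro tendsto_neg_powr pred_p_at_top) auto
      ultimately show ?thesis unfolding A_def using k12 kap3_tendsto \<epsilon>
        by (intro tendsto_mult_right_zero tendsto_add_zero tendsto_divide_zero)
    qed
    have "\<forall>\<^sub>F n in sequentially. \<bar>s n\<bar> < ?T"
      using tendsto_rabs[OF st] by (rule order_tendstoD(2)) simp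
    then have "\<forall>\<^sub>F n in sequentially. \<bar>cmod (degenerate_kernel.charf (M n) (skern n) {..<p n} (s n * c n) - exp (- (s n)\<^sup>2 / 2))\<bar>
      \<le> 2 * ?T\<^sup>2 * \<epsilon> + A n"
      using good
    proof eventually_elim
      case (elim n)
      interpret S: exchangeable_sphere "M n" "u n" n "b4 n" "g n" "flip n" using elim by (intro sph) auto
      have card: "card {..<p n} = Suc (p n - 1)" "0 < p n - 1" "real (Suc (p n - 1)) = real (p n)" using elim by auto
      have k0: "0 \<le> kap1 n" "0 \<le> kap2 n" "0 \<le> kap3 n"
        using S.K.h_moment_nonneg S.K.G_moment_nonneg S.K.G_energy_nonneg by auto
      have "cmod (S.K.charf {..<p n} (s n * c n) - complex_of_real (exp (- (s n)\<^sup>2 / 2))) \<le> \<bar>s n\<bar> *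
        (500 * \<bar>s n\<bar> powr (q - 1) * (kap1 n + kap2 n)
       + \<bar>s n\<bar> * (2 * \<epsilon> + 120 * \<epsilon> powr (1 - q / 2) * (kap2 n + pred_p n powr (1 - q / 2)) + kap3 n / (2 * \<epsilon>))
       + 2 * (s n)\<^sup>2 / sqrt (pred_p n))"
        using S.K.charf_normal_approx[OF finite_lessThan card(1,2) S.V_pos _ q(2) \<epsilon>, of "s n"] q
        unfolding c_def card(3) by simp
      also have "\<dots> \<le> ?T * (500 * ?T powr (q - 1) * (kap1 n + kap2 n)
       + ?T * (2 * \<epsilon> + 120 * \<epsilon> powr (1 - q / 2) * (kap2 n + pred_p n powr (1 - q / 2)) + kap3 n / (2 * \<epsilon>))
       + 2 * ?T\<^sup>2 / sqrt (pred_p n))"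
      proof -
        let ?E = "2 * \<epsilon> + 120 * \<epsilon> powr (1 - q / 2) * (kap2 n + pred_p n powr (1 - q / 2)) + kap3 n / (2 * \<epsilon>)"
        have E: "0 \<le> ?E"
          using \<epsilon> by (intro add_nonneg_nonneg mult_nonneg_nonneg divide_nonneg_nonneg k0
              S.K.G_energy_nonneg S.K.G_moment_nonneg) simp_all
        have r: "0 \<le> sqrt (pred_p n)" and q1: "1 \<le> q" using q by auto
        show ?thesis
          using rate_mono[OF abs_ge_zero less_imp_le[OF elim(1)] add_nonneg_nonneg[OF k0(1,2)] E r q1]
          unfolding power2_abs .
      qed
      also have "\<dots> = 2 * ?T\<^sup>2 * \<epsilon> + A n"
        unfolding A_def by (simp add: algebra_simps power2_eq_square)
      finally show ?case by simp
    qed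
    with A0 show "\<exists>A. A \<longlonglongrightarrow> 0 \<and> (\<forall>\<^sub>F n in sequentially. \<bar>cmod (degenerate_kernel.charf (M n) (skern n) {..<p n} (s n * c n) - exp (- (s n)\<^sup>2 / 2))\<bar>
      \<le> 2 * ?T\<^sup>2 * \<epsilon> + A n)" by blast
  qed simp
  then have "(\<lambda>n. degenerate_kernel.charf (M n) (skern n) {..<p n} (s n * c n) - exp (- (s n)\<^sup>2 / 2)) \<longlonglongrightarrow> 0"
    by (rule tendsto_norm_zero_cancel)
  moreover have "(\<lambda>n. complex_of_real (exp (- (s n)\<^sup>2 / 2))) \<longlonglongrightarrow> complex_of_real (exp (- t\<^sup>2 / 2))"
    using st by (intro tendsto_intros) auto
  ultimately have "(\<lambda>n. degenerate_kernel.charf (M n) (skern n) {..<p n} (s n * c n)) \<longlonglongrightarrow> complex_of_real (exp (- t\<^sup>2 / 2))"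
    using tendsto_add by fastforce
  then show ?thesis
    by (rule Lim_transform_eventually) (use sc in eventually_elim, simp)
qed

end

subsection \<open>Normalised rows of symmetric variables\<close>

text \<open>The zero row is sent to a unit vector, so that the norm is one everywhere and not only almost everywhere.\<close>

definition normed :: "nat \<Rightarrow> (nat \<Rightarrow> real) \<Rightarrow> nat \<Rightarrow> real" where
  "normed n x j = (if (\<Sum>k<n. (x k)\<^sup>2) = 0 then (if j = 0 then 1 else 0)
     else if j < n then x j / sqrt (\<Sum>k<n. (x k)\<^sup>2) else 0)"

text \<open>Changing a single coordinate keeps the points of a product space in it for j < n, since
  the values outside the index set stay \<open>undefined\<close>.\<close>

definition flip :: "nat \<Rightarrow> (nat \<Rightarrow> real) \<Rightarrow> nat \<Rightarrow> real" where
  "flip j x = x(j := - x j)"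

locale symmetric_law = prob_space \<mu> for \<mu> :: "real measure" +
  assumes sets_eq [measurable_cong]: "sets \<mu> = sets borel"
    and sym: "distr \<mu> \<mu> uminus = \<mu>"
    and nonzero: "AE x in \<mu>. x \<noteq> 0"
begin

abbreviation row :: "nat \<Rightarrow> (nat \<Rightarrow> real) measure" where
  "row n \<equiv> PiM {..<n} (\<lambda>_. \<mu>)"

definition fourth_moment :: "nat \<Rightarrow> real" where
  "fourth_moment n = (\<integral>x. (normed n x 0) ^ 4 \<partial>row n)"

definition mixed_moment :: "nat \<Rightarrow> real" where
  "mixed_moment n = (\<integral>x. (normed n x 0)\<^sup>2 * (normed n x 1)\<^sup>2 \<partial>row n)"

lemma normed_measurable [measurable]: "(\<lambda>x. normed n x j) \<in> borel_measurable (row n)"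
proof -
  have [measurable]: "(\<lambda>x. x k) \<in> borel_measurable (row n)" if "k < n" for k
  proof -
    have "(\<lambda>x. x k) \<in> measurable (row n) \<mu>" using that by (intro measurable_component_singleton) auto
    then show ?thesis by (simp cong: measurable_cong_sets add: measurable_cong_sets[OF refl sets_eq])
  qed
  have S [measurable]: "(\<lambda>x. \<Sum>k<n. (x k)\<^sup>2) \<in> borel_measurable (row n)"
    by (intro borel_measurable_sum borel_measurable_power) auto
  show ?thesis
  proof (cases "j < n")
    case True
    then have [measurable]: "(\<lambda>x. x j) \<in> borel_measurable (row n)" by measurable
    have "(\<lambda>x. normed n x j) = (\<lambda>x. if (\<Sum>k<n. (x k)\<^sup>2) = 0 then (if j = 0 then 1 else 0) else x j / sqrt (\<Sum>k<n. (x k)\<^sup>2))"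
      using True by (auto simp: normed_def fun_eq_iff)
    then show ?thesis by simp
  next
    case False
    have "(\<lambda>x. normed n x j) = (\<lambda>x. if (\<Sum>k<n. (x k)\<^sup>2) = 0 then (if j = 0 then 1 else 0) else 0)"
      using False by (auto simp: normed_def fun_eq_iff)
    then show ?thesis by simp
  qed
qed

lemma normed_unit: "0 < n \<Longrightarrow> (\<Sum>j<n. (normed n x j)\<^sup>2) = 1"
proof (cases "(\<Sum>k<n. (x k)\<^sup>2) = 0")
  case True
  assume "0 < n"
  then have "(\<Sum>j<n. (normed n x j)\<^sup>2) = (\<Sum>j<n. if j = 0 then 1 else 0)"
    using True by (intro sum.cong) (auto simp: normed_def)
  then show ?thesis using \<open>0 < n\<close> by simp
next
  case False
  have nn: "0 \<le> (\<Sum>k<n. (x k)\<^sup>2)" by (intro sum_nonneg) auto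
  have "(\<Sum>j<n. (normed n x j)\<^sup>2) = (\<Sum>j<n. (x j)\<^sup>2 / (\<Sum>k<n. (x k)\<^sup>2))"
    using False nn by (intro sum.cong refl) (simp add: normed_def power_divide)
  also have "\<dots> = 1" using False by (simp flip: sum_divide_distrib)
  finally show ?thesis .
qed

lemma prob_space_row: "prob_space (row n)"
  by (rule prob_space_iid)

lemma AE_row_nonzero: "0 < n \<Longrightarrow> AE x in row n. (\<Sum>k<n. (x k)\<^sup>2) \<noteq> 0"
proof -
  assume n: "0 < n"
  interpret P: product_prob_space "\<lambda>_. \<mu>" "{..<n}" by unfold_locales
  have "AE x in row n. x 0 \<noteq> 0" using P.AE_component[of 0] n nonzero by simp
  then show ?thesis
  proof eventually_elim
    case (elim x)
    have "0 < (x 0)\<^sup>2" using elim by simp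
    also have "(x 0)\<^sup>2 \<le> (\<Sum>k<n. (x k)\<^sup>2)" using n by (intro member_le_sum) auto
    finally show ?case by simp
  qed
qed

lemma flip_measurable [measurable]: "j < n \<Longrightarrow> flip j \<in> measurable (row n) (row n)"
proof -
  assume j: "j < n"
  have eq: "flip j x = (\<lambda>k\<in>{..<n}. if k = j then - x k else x k)" if "x \<in> space (row n)" for x
    using that j by (auto simp: flip_def space_PiM fun_eq_iff PiE_def extensional_def)
  have "(\<lambda>x. \<lambda>k\<in>{..<n}. if k = j then - x k else x k) \<in> measurable (row n) (row n)"
    by measurable
  then show ?thesis by (subst measurable_cong[OF eq])
qed

text \<open>A product measure is determined by boxes, and the preimage of a box is a box with one
  side reflected.\<close>

lemma flip_distr: "j < n \<Longrightarrow> distr (row n) (row n) (flip j) = row n"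
proof -
  assume j: "j < n"
  interpret P: product_prob_space "\<lambda>_. \<mu>" "{..<n}" by unfold_locales
  show ?thesis
  proof (rule P.PiM_eqI)
    fix A assume A: "\<And>i. i \<in> {..<n} \<Longrightarrow> A i \<in> sets \<mu>"
    have sp: "space \<mu> = UNIV" using sets_eq by (metis sets_eq_imp_space_eq space_borel)
    define A' where "A' = A(j := uminus -` A j)"
    have Aj: "uminus -` A j \<in> sets \<mu>"
    proof -
      have "uminus \<in> measurable \<mu> \<mu>" by measurable
      from measurable_sets[OF this A[of j]] show ?thesis using j by (simp add: sp)
    qed
    have A': "A' i \<in> sets \<mu>" if "i \<in> {..<n}" for i using A[OF that] Aj by (simp add: A'_def)
    have pre: "flip j -` PiE {..<n} A \<inter> space (row n) = PiE {..<n} A'"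
    proof (intro Set.set_eqI iffI)
      fix x assume x: "x \<in> flip j -` PiE {..<n} A \<inter> space (row n)"
      then have f: "(\<lambda>k. (flip j x) k) \<in> PiE {..<n} A" by simp
      show "x \<in> PiE {..<n} A'"
      proof (rule PiE_I)
        fix i assume i: "i \<in> {..<n}"
        have "flip j x i \<in> A i" using f i by (rule PiE_mem)
        then show "x i \<in> A' i" by (auto simp: A'_def flip_def)
      next
        fix i assume "i \<notin> {..<n}"
        then show "x i = undefined" using x by (auto simp: space_PiM PiE_def extensional_def)
      qed
    next
      fix x assume x: "x \<in> PiE {..<n} A'"
      have "flip j x \<in> PiE {..<n} A"
      proof (rule PiE_I)
        fix i assume i: "i \<in> {..<n}"
        have "x i \<in> A' i" using x i by (rule PiE_mem)
        then show "flip j x i \<in> A i" by (auto simp: A'_def flip_def split: if_splits)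
      next
        fix i assume "i \<notin> {..<n}"
        then show "flip j x i = undefined" using x j by (auto simp: flip_def PiE_def extensional_def)
      qed
      moreover have "x \<in> space (row n)" using x by (auto simp: space_PiM sp PiE_def)
      ultimately show "x \<in> flip j -` PiE {..<n} A \<inter> space (row n)" by simp
    qed
    have em: "emeasure \<mu> (A' i) = emeasure \<mu> (A i)" if i: "i \<in> {..<n}" for i
    proof (cases "i = j")
      case True
      have "emeasure \<mu> (A j) = emeasure (distr \<mu> \<mu> uminus) (A j)" by (simp add: sym)
      also have "\<dots> = emeasure \<mu> (uminus -` A j \<inter> space \<mu>)"
        using A[of j] j by (intro emeasure_distr) auto
      finally show ?thesis using True by (simp add: A'_def sp)
    qed (simp add: A'_def)
    have "emeasure (distr (row n) (row n) (flip j)) (PiE {..<n} A) = emeasure (row n) (flip j -` PiE {..<n} A \<inter> space (row n))"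
      using A j by (intro emeasure_distr) (auto intro!: sets_PiM_I_finite)
    also have "\<dots> = (\<Prod>i<n. emeasure \<mu> (A' i))"
      unfolding pre using A' by (intro P.emeasure_PiM) auto
    also have "\<dots> = (\<Prod>i<n. emeasure \<mu> (A i))" using em by (intro prod.cong) auto
    finally show "emeasure (distr (row n) (row n) (flip j)) (PiE {..<n} A) = (\<Prod>i<n. emeasure \<mu> (A i))" .
  qed auto
qed

lemma sum_sq_permute:
  fixes x :: "nat \<Rightarrow> real"
  assumes "f permutes {..<n}"
  shows "(\<Sum>k<n. ((\<lambda>i\<in>{..<n}. x (f i)) k)\<^sup>2) = (\<Sum>k<n. (x k)\<^sup>2)"
proof -
  have "(\<Sum>k<n. ((\<lambda>i\<in>{..<n}. x (f i)) k)\<^sup>2) = (\<Sum>k<n. (x (f k))\<^sup>2)" by simp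
  also have "\<dots> = (\<Sum>k<n. (x k)\<^sup>2)"
    using sum.permute[OF assms, of "\<lambda>k. (x k)\<^sup>2"] by (simp add: comp_def)
  finally show ?thesis .
qed

text \<open>Reindexing preserves a product of equal factors; this is the source of
  exchangeability.\<close>

lemma integral_permute:
  fixes F :: "(nat \<Rightarrow> real) \<Rightarrow> real"
  assumes f: "f permutes {..<n}" and [measurable]: "F \<in> borel_measurable (row n)"
  shows "(\<integral>x. F (\<lambda>i\<in>{..<n}. x (f i)) \<partial>row n) = (\<integral>x. F x \<partial>row n)"
proof -
  have "distr (row n) (row n) (\<lambda>x. \<lambda>i\<in>{..<n}. x (f i)) = row n"
    using distr_PiM_reindex[of "{..<n}" "\<lambda>_. \<mu>" f "{..<n}"] f prob_space_axioms
      permutes_inj_on[OF f, of "{..<n}"] permutes_in_image[OF f] by auto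
  moreover have "(\<lambda>x. \<lambda>i\<in>{..<n}. x (f i)) \<in> measurable (row n) (row n)"
    using permutes_in_image[OF f] by (intro measurable_restrict measurable_component_singleton) auto
  ultimately show ?thesis
    using integral_distr[of "\<lambda>x. \<lambda>i\<in>{..<n}. x (f i)" "row n" "row n" F] by simp
qed

lemma normed_permute:
  assumes f: "f permutes {..<n}" and "j < n" and "(\<Sum>k<n. (x k)\<^sup>2) \<noteq> 0"
  shows "normed n (\<lambda>i\<in>{..<n}. x (f i)) j = normed n x (f j)"
  unfolding normed_def sum_sq_permute[OF f] using assms permutes_in_image[OF f, of j] by simp

lemma fourth_moment_eq:
  assumes j: "j < n"
  shows "(\<integral>x. (normed n x j) ^ 4 \<partial>row n) = fourth_moment n"
proof -
  let ?f = "Transposition.transpose 0 j"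
  have f: "?f permutes {..<n}" using j by (intro permutes_swap_id) auto
  have "fourth_moment n = (\<integral>x. (normed n (\<lambda>i\<in>{..<n}. x (?f i)) 0) ^ 4 \<partial>row n)"
    unfolding fourth_moment_def by (subst integral_permute[OF f]) auto
  also have "\<dots> = (\<integral>x. (normed n x j) ^ 4 \<partial>row n)"
  proof (rule integral_cong_AE)
    show "AE x in row n. (normed n (\<lambda>i\<in>{..<n}. x (?f i)) 0) ^ 4 = (normed n x j) ^ 4"
      using AE_row_nonzero[of n] j normed_permute[OF f, of 0] by (auto elim!: eventually_mono)
    have [measurable]: "(\<lambda>x. \<lambda>i\<in>{..<n}. x (?f i)) \<in> measurable (row n) (row n)"
      using permutes_in_image[OF f] by (intro measurable_restrict measurable_component_singleton) auto
    show "(\<lambda>x. (normed n (\<lambda>i\<in>{..<n}. x (?f i)) 0) ^ 4) \<in> borel_measurable (row n)"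
      by (rule measurable_compose[OF \<open>(\<lambda>x. \<lambda>i\<in>{..<n}. x (?f i)) \<in> _\<close>]) measurable
  qed measurable
  finally show ?thesis ..
qed

lemma mixed_moment_eq:
  assumes j: "j < n" "l < n" "j \<noteq> l"
  shows "(\<integral>x. (normed n x j)\<^sup>2 * (normed n x l)\<^sup>2 \<partial>row n) = mixed_moment n"
proof -
  \<comment> \<open>The permutation has to send 0 to j and 1 to l. Taking l' as the image of l under
    the first transposition makes the composition correct even when j or l coincides with 0 or
    1.\<close>
  define l' where "l' = Transposition.transpose 0 j l"
  define f where "f = Transposition.transpose 0 j \<circ> Transposition.transpose 1 l'"
  have l': "l' < n" "l' \<noteq> 0" using j by (auto simp: l'_def Transposition.transpose_def)
  have n2: "1 < n" using j by linarith
  have f: "f permutes {..<n}" unfolding f_def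
    using j l' n2 by (intro permutes_compose permutes_swap_id) auto
  have "Transposition.transpose 1 l' 0 = 0" using l' by (simp add: Transposition.transpose_def)
  then have f01: "f 0 = j" "f 1 = l" by (simp_all add: f_def l'_def)
  have "mixed_moment n = (\<integral>x. (normed n (\<lambda>i\<in>{..<n}. x (f i)) 0)\<^sup>2 * (normed n (\<lambda>i\<in>{..<n}. x (f i)) 1)\<^sup>2 \<partial>row n)"
    unfolding mixed_moment_def by (subst integral_permute[OF f, of "\<lambda>x. (normed n x 0)\<^sup>2 * (normed n x 1)\<^sup>2"]) auto
  also have "\<dots> = (\<integral>x. (normed n x j)\<^sup>2 * (normed n x l)\<^sup>2 \<partial>row n)"
  proof (rule integral_cong_AE)
    show "AE x in row n. (normed n (\<lambda>i\<in>{..<n}. x (f i)) 0)\<^sup>2 * (normed n (\<lambda>i\<in>{..<n}. x (f i)) 1)\<^sup>2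
        = (normed n x j)\<^sup>2 * (normed n x l)\<^sup>2"
      using AE_row_nonzero[of n] j n2 normed_permute[OF f, of 0] normed_permute[OF f, of 1] f01
      by (auto elim!: eventually_mono)
    have m: "(\<lambda>x. \<lambda>i\<in>{..<n}. x (f i)) \<in> measurable (row n) (row n)"
      using permutes_in_image[OF f] by (intro measurable_restrict measurable_component_singleton) auto
    show "(\<lambda>x. (normed n (\<lambda>i\<in>{..<n}. x (f i)) 0)\<^sup>2 * (normed n (\<lambda>i\<in>{..<n}. x (f i)) 1)\<^sup>2) \<in> borel_measurable (row n)"
      using measurable_compose[OF m normed_measurable] by measurable
  qed measurable
  finally show ?thesis ..
qed

lemma exchangeable_sphere_row:
  assumes n: "2 \<le> n"
  shows "exchangeable_sphere (row n) (normed n) n (fourth_moment n) (mixed_moment n) flip"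
proof (intro exchangeable_sphere.intro exchangeable_sphere_axioms.intro prob_space_row n normed_measurable
    fourth_moment_eq mixed_moment_eq flip_measurable flip_distr normed_unit)
  fix j assume j: "j < n"
  show "AE x in row n. \<forall>k<n. normed n (flip j x) k = (if k = j then - normed n x k else normed n x k)"
    using AE_row_nonzero[of n]
  proof (rule eventually_mono)
    fix x :: "nat \<Rightarrow> real" assume x: "(\<Sum>k<n. (x k)\<^sup>2) \<noteq> 0"
    have s: "(\<Sum>k<n. (flip j x k)\<^sup>2) = (\<Sum>k<n. (x k)\<^sup>2)"
      by (intro sum.cong) (auto simp: flip_def)
    show "\<forall>k<n. normed n (flip j x) k = (if k = j then - normed n x k else normed n x k)"
      unfolding normed_def s using x by (auto simp: flip_def)
  qed (use n in auto)
qed (use n in auto)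

end

subsection \<open>Regular variation and the fourth moment\<close>

lemma ex_two_power_bracket: "\<exists>k. 2 ^ k \<le> x \<and> x < 2 ^ Suc k" if "1 \<le> x" for x :: real
proof -
  obtain m where m: "x < 2 ^ m" using real_arch_pow[of 2 x] by auto
  define k where "k = (LEAST m. x < 2 ^ m)"
  have k: "x < 2 ^ k" unfolding k_def using m by (rule LeastI)
  have "k \<noteq> 0" using k that by (intro notI) simp
  then obtain l where l: "k = Suc l" using not0_implies_Suc by blast
  have "\<not> x < 2 ^ l" using not_less_Least[of l "\<lambda>m. x < 2 ^ m"] l by (simp add: k_def)
  then show ?thesis using k l by (intro exI[of _ l]) auto
qed

lemma two_power_powr: "(2 ^ m) powr r = (2 :: real) powr (r * real m)"
proof -
  have "(2 :: real) ^ m = 2 powr real m" by (rule powr_realpow[symmetric]) simp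
  then show ?thesis by (simp only: powr_powr mult.commute)
qed

lemma summable_ratio_limit:
  fixes f :: "nat \<Rightarrow> real"
  assumes pos: "\<And>k. 0 < f k" and lim: "(\<lambda>k. f (Suc k) / f k) \<longlonglongrightarrow> l" and l: "l < 1"
  shows "summable f"
proof -
  define c where "c = (1 + l) / 2"
  have "\<forall>\<^sub>F k in sequentially. f (Suc k) / f k < c"
    using lim l by (intro order_tendstoD(2)[OF lim]) (simp add: c_def)
  then obtain N where N: "\<And>k. k \<ge> N \<Longrightarrow> f (Suc k) / f k < c"
    by (auto simp: eventually_sequentially)
  show ?thesis
  proof (rule summable_ratio_test[of c N f])
    show "c < 1" using l by (simp add: c_def)
    fix k assume "N \<le> k"
    then show "norm (f (Suc k)) \<le> c * norm (f k)"
      using N[of k] pos[of k] pos[of "Suc k"] by (simp add: divide_less_eq)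
  qed
qed

lemma sq_powr_half: "(x\<^sup>2) powr (r / 2) = \<bar>x\<bar> powr r" for x :: real
proof -
  have "(x\<^sup>2) powr (r / 2) = (\<bar>x\<bar> powr 2) powr (r / 2)" by simp
  then show ?thesis by (simp only: powr_powr) simp
qed

text \<open>Along powers of 2 the tail ratio at the factor 2 is a ratio of consecutive terms, so the
  ratio test takes the place of Potter's bounds; monotonicity of the tail fills the gaps between the
  powers.\<close>

locale heavy_tail = symmetric_law \<mu> for \<mu> +
  fixes \<alpha> :: real
  assumes \<alpha>: "0 < \<alpha>"
    and tail_pos: "\<And>x. 0 < x \<Longrightarrow> 0 < measure \<mu> {y. x < \<bar>y\<bar>}"
    and tail_ratio: "((\<lambda>x. measure \<mu> {y. 2 * x < \<bar>y\<bar>} / measure \<mu> {y. x < \<bar>y\<bar>}) \<longlongrightarrow> 2 powr (- \<alpha>)) at_top"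
begin

definition tail :: "real \<Rightarrow> real" where
  "tail x = measure \<mu> {y. x < \<bar>y\<bar>}"

lemma space_eq: "space \<mu> = UNIV"
  using sets_eq by (metis sets_eq_imp_space_eq space_borel)

lemma tail_sets [measurable]: "{y. x < \<bar>y\<bar>} \<in> sets \<mu>"
  unfolding sets_eq by measurable

lemma tail_antimono: "x \<le> y \<Longrightarrow> tail y \<le> tail x"
  unfolding tail_def by (intro finite_measure_mono) auto

lemma tail_dyadic_ratio: "(\<lambda>k. tail (2 ^ Suc k) / tail (2 ^ k)) \<longlonglongrightarrow> 2 powr (- \<alpha>)"
proof -
  have "filterlim (\<lambda>k. 2 ^ k :: real) at_top sequentially" by real_asymp
  from filterlim_compose[OF tail_ratio this] show ?thesis by (simp add: tail_def)
qed

lemma summable_tail: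
  assumes "r < \<alpha>"
  shows "summable (\<lambda>k. 2 powr (r * real (Suc k)) * tail (2 ^ k))"
proof (rule summable_ratio_limit)
  show "0 < 2 powr (r * real (Suc k)) * tail (2 ^ k)" for k
    using tail_pos[of "2 ^ k"] by (simp add: tail_def)
  have "(\<lambda>k. 2 powr r * (tail (2 ^ Suc k) / tail (2 ^ k))) \<longlonglongrightarrow> 2 powr r * 2 powr (- \<alpha>)"
    by (intro tendsto_mult_left tail_dyadic_ratio)
  moreover have "2 powr (r * real (Suc (Suc k))) * tail (2 ^ Suc k) / (2 powr (r * real (Suc k)) * tail (2 ^ k))
      = 2 powr r * (tail (2 ^ Suc k) / tail (2 ^ k))" for k
  proof -
    have "r * real (Suc (Suc k)) = r * real (Suc k) + r" by (simp add: algebra_simps)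
    then have "2 powr (r * real (Suc (Suc k))) = 2 powr (r * real (Suc k)) * 2 powr r" by (simp only: powr_add)
    then show ?thesis by simp
  qed
  ultimately show "(\<lambda>k. 2 powr (r * real (Suc (Suc k))) * tail (2 ^ Suc k) / (2 powr (r * real (Suc k)) * tail (2 ^ k)))
      \<longlonglongrightarrow> 2 powr r * 2 powr (- \<alpha>)" by simp
  have "2 powr r * 2 powr (- \<alpha>) = 2 powr (r - \<alpha>)" by (simp flip: powr_add)
  also have "\<dots> < 2 powr 0" using assms by (intro powr_less_mono) auto
  finally show "2 powr r * 2 powr (- \<alpha>) < 1" by simp
qed

text \<open>Dyadic levels dominate |x|^r, and the integral of the dominating sum is the series of
  \<open>summable_tail\<close>.\<close>

lemma integrable_abs_powr:
  assumes r: "0 < r" "r < \<alpha>"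
  shows "integrable \<mu> (\<lambda>x. \<bar>x\<bar> powr r)"
proof -
  define f where "f k x = 2 powr (r * real (Suc k)) * indicator {y. 2 ^ k < \<bar>y\<bar>} x" for k :: nat and x :: real
  have f0: "0 \<le> f k x" for k x by (simp add: f_def)
  have sumf: "summable (\<lambda>k. f k x)" for x
  proof -
    obtain m where m: "\<bar>x\<bar> < 2 ^ m" using real_arch_pow[of 2 "\<bar>x\<bar>"] by auto
    show ?thesis
    proof (rule summable_finite[of "{..<m}"])
      fix k assume "k \<notin> {..<m}"
      then have "(2::real) ^ m \<le> 2 ^ k" by (intro power_increasing) auto
      then have "\<bar>x\<bar> < 2 ^ k" using m by linarith
      then show "f k x = 0" by (simp add: f_def indicator_def)
    qed simp
  qed
  have intf: "integrable \<mu> (f k)" for k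
    unfolding f_def using tail_sets by (intro integrable_mult_right integrable_real_indicator) (auto simp: emeasure_eq_measure)
  have valf: "(\<integral>x. f k x \<partial>\<mu>) = 2 powr (r * real (Suc k)) * tail (2 ^ k)" for k
    unfolding f_def tail_def by (simp add: space_eq)
  have "integrable \<mu> (\<lambda>x. \<Sum>k. f k x)"
  proof (rule integrable_suminf[OF intf])
    show "AE x in \<mu>. summable (\<lambda>k. norm (f k x))" using sumf f0 by simp
    show "summable (\<lambda>k. \<integral>x. norm (f k x) \<partial>\<mu>)" using summable_tail[OF r(2)] f0 valf by simp
  qed
  then have "integrable \<mu> (\<lambda>x. 1 + (\<Sum>k. f k x))" by simp
  then show ?thesis
  proof (rule Bochner_Integration.integrable_bound)
    show "(\<lambda>x. \<bar>x\<bar> powr r) \<in> borel_measurable \<mu>" by measurable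
    show "AE x in \<mu>. norm (\<bar>x\<bar> powr r) \<le> norm (1 + (\<Sum>k. f k x))"
    proof (rule AE_I2)
      fix x :: real
      have nn: "0 \<le> (\<Sum>k. f k x)" using sumf f0 by (intro suminf_nonneg) auto
      show "norm (\<bar>x\<bar> powr r) \<le> norm (1 + (\<Sum>k. f k x))"
      proof (cases "\<bar>x\<bar> \<le> 1")
        case True
        then have "\<bar>x\<bar> powr r \<le> 1 powr r" using r by (intro powr_mono2) auto
        then show ?thesis using nn by simp
      next
        case False
        obtain k where k: "2 ^ k \<le> \<bar>x\<bar>" "\<bar>x\<bar> < 2 ^ Suc k" using ex_two_power_bracket[of "\<bar>x\<bar>"] False by auto
        have tw: "(2 ^ Suc l) powr r = 2 powr (r * real (Suc l))" for l :: nat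
          by (rule two_power_powr)
        \<comment> \<open>The indicators in f use a strict inequality, so for |x| equal to a power
          of 2 the next lower level has to be taken.\<close>
        have "\<exists>l. 2 ^ l < \<bar>x\<bar> \<and> \<bar>x\<bar> \<le> 2 ^ Suc l"
        proof (cases "2 ^ k = \<bar>x\<bar>")
          case True
          then obtain l where "k = Suc l" using False by (cases k) auto
          then have "\<bar>x\<bar> = 2 * 2 ^ l" using True by simp
          moreover have "(0 :: real) < 2 ^ l" by simp
          ultimately have "2 ^ l < \<bar>x\<bar>" "\<bar>x\<bar> \<le> 2 ^ Suc l" by (linarith, simp)
          then show ?thesis by blast
        next
          case False then show ?thesis using k by (intro exI[of _ k]) auto
        qed
        then obtain l where l: "2 ^ l < \<bar>x\<bar>" "\<bar>x\<bar> \<le> 2 ^ Suc l" by auto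
        have "\<bar>x\<bar> powr r \<le> (2 ^ Suc l) powr r" using l r by (intro powr_mono2) auto
        also have "\<dots> = f l x" using l by (simp only: tw f_def) simp
        also have "\<dots> = (\<Sum>k\<in>{l}. f k x)" by simp
        also have "\<dots> \<le> (\<Sum>k. f k x)" using sumf f0 by (intro sum_le_suminf) auto
        finally show ?thesis using nn by simp
      qed
    qed
  qed
qed

text \<open>The ratio test is applied to the reciprocals 2^(-s k) / tail(2^k): their terms are
  bounded. Passing from powers of 2 to all x costs the factor 2^(-s).\<close>

lemma tail_lower:
  assumes s: "\<alpha> < s"
  shows "\<exists>c>0. \<forall>x\<ge>1. c * x powr (- s) \<le> tail x"
proof -
  define f where "f k = 2 powr (- s * real k) / tail (2 ^ k)" for k :: nat
  have tp: "0 < tail (2 ^ k)" for k using tail_pos[of "2 ^ k"] by (simp add: tail_def)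
  have "summable f"
  proof (rule summable_ratio_limit)
    show "0 < f k" for k using tp by (simp add: f_def)
    have "(\<lambda>k. 2 powr (- s) / (tail (2 ^ Suc k) / tail (2 ^ k))) \<longlonglongrightarrow> 2 powr (- s) / 2 powr (- \<alpha>)"
      by (intro tendsto_divide tendsto_const tail_dyadic_ratio) auto
    moreover have "f (Suc k) / f k = 2 powr (- s) / (tail (2 ^ Suc k) / tail (2 ^ k))" for k
    proof -
      have "- s * real (Suc k) = - s * real k + (- s)" by (simp add: algebra_simps)
      then have "2 powr (- s * real (Suc k)) = 2 powr (- s * real k) * 2 powr (- s)" by (simp only: powr_add)
      then show ?thesis unfolding f_def by simp
    qed
    ultimately show "(\<lambda>k. f (Suc k) / f k) \<longlonglongrightarrow> 2 powr (- s) / 2 powr (- \<alpha>)" by simp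
    have "2 powr (- s) / 2 powr (- \<alpha>) = 2 powr (\<alpha> - s)" by (simp flip: powr_diff)
    also have "\<dots> < 2 powr 0" using s by (intro powr_less_mono) auto
    finally show "2 powr (- s) / 2 powr (- \<alpha>) < 1" by simp
  qed
  then have "Bseq f" by (intro convergent_imp_Bseq convergentI[of _ 0] summable_LIMSEQ_zero)
  then obtain K where K: "0 < K" "\<And>k. norm (f k) \<le> K" by (auto simp: Bseq_def)
  have lower: "2 powr (- s * real k) / K \<le> tail (2 ^ k)" for k
  proof -
    have "2 powr (- s * real k) / tail (2 ^ k) \<le> K" using K(2)[of k] tp[of k] by (simp add: f_def)
    then show ?thesis using tp[of k] K(1) by (simp add: field_simps)
  qed
  show ?thesis
  proof (intro exI[of _ "2 powr (- s) / K"] conjI allI impI)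
    show "0 < 2 powr (- s) / K" using K by simp
    fix x :: real assume x: "1 \<le> x"
    obtain k where k: "2 ^ k \<le> x" "x < 2 ^ Suc k" using ex_two_power_bracket[OF x] by auto
    have "2 powr (- s) * x powr (- s) = (2 * x) powr (- s)" by (simp add: powr_mult)
    also have "\<dots> \<le> (2 ^ Suc k) powr (- s)" using k s \<alpha> by (intro powr_mono2') auto
    also have "\<dots> = 2 powr (- s * real (Suc k))" by (rule two_power_powr)
    finally have "2 powr (- s) / K * x powr (- s) \<le> 2 powr (- s * real (Suc k)) / K"
      using K by (simp add: divide_right_mono)
    also have "\<dots> \<le> tail (2 ^ Suc k)" by (rule lower)
    also have "\<dots> \<le> tail x" using k by (intro tail_antimono) auto
    finally show "2 powr (- s) / K * x powr (- s) \<le> tail x" .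
  qed
qed

section \<open>Splitting off the first entry of a row\<close>

abbreviation rest :: "nat \<Rightarrow> (nat \<Rightarrow> real) measure" where
  "rest n \<equiv> PiM {1..<n} (\<lambda>_. \<mu>)"

lemma normed_zero_power4:
  assumes n: "0 < n"
  shows "(normed n (y(0 := x)) 0) ^ 4 \<le> 1"
    and "x\<^sup>2 + (\<Sum>k=1..<n. (y k)\<^sup>2) \<noteq> 0 \<Longrightarrow>
      (normed n (y(0 := x)) 0) ^ 4 = (x\<^sup>2 / (x\<^sup>2 + (\<Sum>k=1..<n. (y k)\<^sup>2)))\<^sup>2"
proof -
  have split: "(\<Sum>k<n. ((y(0 := x)) k)\<^sup>2) = x\<^sup>2 + (\<Sum>k=1..<n. (y k)\<^sup>2)"
    using n by (simp add: lessThan_atLeast0 sum.atLeast_Suc_lessThan)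
  show "x\<^sup>2 + (\<Sum>k=1..<n. (y k)\<^sup>2) \<noteq> 0 \<Longrightarrow>
      (normed n (y(0 := x)) 0) ^ 4 = (x\<^sup>2 / (x\<^sup>2 + (\<Sum>k=1..<n. (y k)\<^sup>2)))\<^sup>2"
  proof -
    assume nz: "x\<^sup>2 + (\<Sum>k=1..<n. (y k)\<^sup>2) \<noteq> 0"
    have nn: "0 \<le> x\<^sup>2 + (\<Sum>k=1..<n. (y k)\<^sup>2)" by (intro add_nonneg_nonneg sum_nonneg) auto
    have "(normed n (y(0 := x)) 0) ^ 4 = ((normed n (y(0 := x)) 0)\<^sup>2)\<^sup>2" by simp
    also have "(normed n (y(0 := x)) 0)\<^sup>2 = x\<^sup>2 / (x\<^sup>2 + (\<Sum>k=1..<n. (y k)\<^sup>2))"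
      unfolding normed_def split using nz nn n by (simp add: power_divide)
    finally show ?thesis .
  qed
  have "(normed n (y(0 := x)) 0)\<^sup>2 \<le> (\<Sum>j<n. (normed n (y(0 := x)) j)\<^sup>2)"
    using n by (intro member_le_sum) auto
  then have "(normed n (y(0 := x)) 0)\<^sup>2 \<le> 1" using normed_unit[OF n] by simp
  then have "((normed n (y(0 := x)) 0)\<^sup>2)\<^sup>2 \<le> 1\<^sup>2" by (intro power_mono) auto
  then show "(normed n (y(0 := x)) 0) ^ 4 \<le> 1" by simp
qed

lemma fourth_moment_split:
  assumes n: "0 < n"
  shows "fourth_moment n = (\<integral>y. (\<integral>x. (normed n (y(0 := x)) 0) ^ 4 \<partial>\<mu>) \<partial>rest n)"
proof -
  have ins: "{..<n} = insert 0 {1..<n}" using n by auto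
  have m: "(\<lambda>x. (normed n x 0) ^ 4) \<in> borel_measurable (iid (insert 0 {1..<n}))"
    unfolding ins[symmetric] by measurable
  show ?thesis
    unfolding fourth_moment_def unfolding ins
  proof (rule integral_iid_insert[where B = 1])
    fix y assume "y \<in> space (iid (insert 0 {1..<n}))"
    have "(normed n (y(0 := y 0)) 0) ^ 4 \<le> 1" by (rule normed_zero_power4(1)[OF n])
    then show "norm ((normed n y 0) ^ 4) \<le> 1" by simp
  qed (use m in auto)
qed

lemma inner_measurable:
  assumes n: "0 < n"
  shows "(\<lambda>(y, x). (normed n (y(0 := x)) 0) ^ 4) \<in> borel_measurable (rest n \<Otimes>\<^sub>M \<mu>)"
proof -
  have ins: "{..<n} = insert 0 {1..<n}" using n by auto
  have "(\<lambda>(y, x). y(0 := x)) \<in> measurable (rest n \<Otimes>\<^sub>M \<mu>) (row n)"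
    unfolding ins by (rule measurable_add_dim)
  from measurable_compose[OF this normed_measurable[of n 0]]
  have "(\<lambda>w. (normed n ((\<lambda>(y, x). y(0 := x)) w) 0) ^ 4) \<in> borel_measurable (rest n \<Otimes>\<^sub>M \<mu>)"
    by (rule borel_measurable_power)
  then show ?thesis by (simp only: split_beta')
qed

lemma inner_section_measurable:
  assumes "0 < n" and y: "y \<in> space (rest n)"
  shows "(\<lambda>x. (normed n (y(0 := x)) 0) ^ 4) \<in> borel_measurable \<mu>"
  using measurable_compose[OF measurable_Pair1'[OF y] inner_measurable[of n]] assms by simp

lemma integrable_inner:
  assumes "0 < n" "y \<in> space (rest n)"
  shows "integrable \<mu> (\<lambda>x. (normed n (y(0 := x)) 0) ^ 4)"
  using normed_zero_power4(1)[of n y] inner_section_measurable[OF assms] assms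
  by (intro integrable_bounded[of _ 1]) auto

lemma integrable_outer:
  assumes n: "0 < n"
  shows "integrable (rest n) (\<lambda>y. \<integral>x. (normed n (y(0 := x)) 0) ^ 4 \<partial>\<mu>)"
proof -
  have "(\<integral>x. (normed n (y(0 := x)) 0) ^ 4 \<partial>\<mu>) \<le> 1" if "y \<in> space (rest n)" for y
    using normed_zero_power4(1)[OF n] inner_section_measurable[OF n that]
    by (intro integral_nonneg_le_bound) auto
  moreover have "(\<lambda>y. \<integral>x. (normed n (y(0 := x)) 0) ^ 4 \<partial>\<mu>) \<in> borel_measurable (rest n)"
    using n by (intro borel_measurable_lebesgue_integral inner_measurable) auto
  ultimately show ?thesis
    by (intro prob_space.integrable_bounded[OF prob_space_iid, of _ _ 1]) auto
qed

text \<open>The event that the first entry exceeds \<open>\<tau> = (2 n E)\<^bsup>1/r\<^esup>\<close>, where \<open>E\<close> bounds the \<open>r\<close>-th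
  absolute moment, while the sum of squares of the others stays below \<open>\<tau>\<^sup>2\<close> (by Markov, probability
  at least one half), already makes the normalised first entry large.\<close>

lemma fourth_moment_lower:
  assumes r: "0 < r" "r < \<alpha>" "r \<le> 2" and s: "\<alpha> < s"
  shows "\<exists>c>0. \<forall>n\<ge>2. c * n powr (- (s / r)) \<le> fourth_moment n"
proof -
  obtain c where c: "0 < c" "\<And>x. 1 \<le> x \<Longrightarrow> c * x powr (- s) \<le> tail x" using tail_lower[OF s] by blast
  \<comment> \<open>The added 1 gives E >= 1 and hence \<tau> >= 1, the range in which the tail
    bound holds.\<close>
  define E where "E = (\<integral>x. \<bar>x\<bar> powr r \<partial>\<mu>) + 1"
  have E1: "1 \<le> E" unfolding E_def by (simp add: Bochner_Integration.integral_nonneg)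
  \<comment> \<open>The 8 combines the probability 1/2 from Markov's inequality with 1/4, the least
    value of the fourth power on the event.\<close>
  have "c / 8 * (2 * E) powr (- (s / r)) * n powr (- (s / r)) \<le> fourth_moment n" if n: "2 \<le> n" for n :: nat
  proof -
    interpret R: prob_space "rest n" by (rule prob_space_iid)
    define \<tau> where "\<tau> = (2 * (n * E)) powr (1 / r)"
    define Z where "Z y = (\<Sum>k=1..<n. (y k)\<^sup>2)" for y :: "nat \<Rightarrow> real"
    have Zm [measurable]: "Z \<in> borel_measurable (rest n)" unfolding Z_def by measurable
    have Z0: "0 \<le> Z y" for y unfolding Z_def by (intro sum_nonneg) auto
    have nE: "1 \<le> n * E" using n E1 mult_mono[of 1 "real n" 1 E] by simp
    have \<tau>1: "1 \<le> \<tau>" unfolding \<tau>_def using nE r by (intro ge_one_powr_ge_zero) auto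
    have \<tau>r: "\<tau> powr r = 2 * (n * E)" using r nE by (simp add: \<tau>_def powr_powr)
    have intsum: "integrable (rest n) (\<lambda>y. \<Sum>k=1..<n. \<bar>y k\<bar> powr r)" "(\<integral>y. (\<Sum>k=1..<n. \<bar>y k\<bar> powr r) \<partial>rest n) \<le> n * E"
    proof -
      interpret P: product_prob_space "\<lambda>_. \<mu>" "{1..<n}" by unfold_locales
      have d: "distr (rest n) \<mu> (\<lambda>y. y k) = \<mu>" if "k \<in> {1..<n}" for k
        using P.PiM_component[OF that] .
      have i: "integrable (rest n) (\<lambda>y. \<bar>y k\<bar> powr r)" "(\<integral>y. \<bar>y k\<bar> powr r \<partial>rest n) = E - 1" if k: "k \<in> {1..<n}" for k
      proof -
        have km: "(\<lambda>y. y k) \<in> measurable (rest n) \<mu>" using k by measurable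
        show "integrable (rest n) (\<lambda>y. \<bar>y k\<bar> powr r)"
          using integrable_distr_eq[OF km, of "\<lambda>x. \<bar>x\<bar> powr r"] integrable_abs_powr[OF r(1,2)] d[OF k] by simp
        show "(\<integral>y. \<bar>y k\<bar> powr r \<partial>rest n) = E - 1"
          using integral_distr[OF km, of "\<lambda>x. \<bar>x\<bar> powr r"] d[OF k] by (simp add: E_def)
      qed
      then show "integrable (rest n) (\<lambda>y. \<Sum>k=1..<n. \<bar>y k\<bar> powr r)" by auto
      have "(\<integral>y. (\<Sum>k=1..<n. \<bar>y k\<bar> powr r) \<partial>rest n) = (\<Sum>k=1..<n. E - 1)"
        using i by (subst Bochner_Integration.integral_sum) auto
      also have "\<dots> = (n - 1) * (E - 1)" by simp
      also have "\<dots> \<le> n * E" using E1 by (intro mult_mono) auto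
      finally show "(\<integral>y. (\<Sum>k=1..<n. \<bar>y k\<bar> powr r) \<partial>rest n) \<le> n * E" .
    qed
    \<comment> \<open>Subadditivity of the power r/2 <= 1. The squares need not be integrable, but
      the r-th powers are.\<close>
    have Zr: "Z y powr (r / 2) \<le> (\<Sum>k=1..<n. \<bar>y k\<bar> powr r)" for y
    proof -
      have "Z y powr (r / 2) \<le> (\<Sum>k=1..<n. ((y k)\<^sup>2) powr (r / 2))"
        unfolding Z_def using r by (intro powr_sum_le_sum_powr) auto
      then show ?thesis by (simp only: sq_powr_half)
    qed
    \<comment> \<open>Markov's inequality in pointwise form.\<close>
    have ind: "indicator {y. Z y \<le> \<tau>\<^sup>2} y \<ge> 1 - (\<Sum>k=1..<n. \<bar>y k\<bar> powr r) / (2 * (n * E))" for y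
    proof (cases "Z y \<le> \<tau>\<^sup>2")
      case True
      have "0 \<le> (\<Sum>k=1..<n. \<bar>y k\<bar> powr r) / (2 * (n * E))" using nE by (intro divide_nonneg_nonneg sum_nonneg) auto
      then show ?thesis using True by simp
    next
      case False
      have "2 * (n * E) = (\<tau> powr 2) powr (r / 2)" unfolding \<tau>r[symmetric] by (simp only: powr_powr) simp
      also have "\<tau> powr 2 = \<tau>\<^sup>2" using \<tau>1 by simp
      also have "(\<tau>\<^sup>2) powr (r / 2) \<le> Z y powr (r / 2)" using False r by (intro powr_mono2) auto
      finally have "2 * (n * E) \<le> (\<Sum>k=1..<n. \<bar>y k\<bar> powr r)" using Zr[of y] by linarith
      then have "1 \<le> (\<Sum>k=1..<n. \<bar>y k\<bar> powr r) / (2 * (n * E))" using nE by (simp only: le_divide_eq) simp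
      then show ?thesis using False by simp
    qed
    have indI: "integrable (rest n) (\<lambda>y. indicator {y. Z y \<le> \<tau>\<^sup>2} y :: real)"
    proof (rule R.integrable_bounded[of _ 1])
      have "(\<lambda>y. if Z y \<le> \<tau>\<^sup>2 then 1 else 0 :: real) \<in> borel_measurable (rest n)" by measurable
      then show "(\<lambda>y. indicator {y. Z y \<le> \<tau>\<^sup>2} y :: real) \<in> borel_measurable (rest n)"
        by (simp only: indicator_def mem_Collect_eq of_bool_def)
    qed (simp add: indicator_def)
    have half: "(1 / 2 :: real) \<le> (\<integral>y. indicator {y. Z y \<le> \<tau>\<^sup>2} y \<partial>rest n)"
    proof -
      have "(\<integral>y. (\<Sum>k=1..<n. \<bar>y k\<bar> powr r) \<partial>rest n) / (2 * (n * E)) \<le> (n * E) / (2 * (n * E))"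
        using intsum(2) nE by (intro divide_right_mono) auto
      also have "\<dots> = 1 / 2"
      proof -
        have "X / (2 * X) = 1 / 2" if "1 \<le> X" for X :: real using that by simp
        from this[OF nE] show ?thesis .
      qed
      finally have "1 / 2 \<le> 1 - (\<integral>y. (\<Sum>k=1..<n. \<bar>y k\<bar> powr r) \<partial>rest n) / (2 * (n * E))" by linarith
      also have "\<dots> = (\<integral>y. 1 - (\<Sum>k=1..<n. \<bar>y k\<bar> powr r) / (2 * (n * E)) \<partial>rest n)"
        using intsum(1) by (simp add: R.prob_space del: One_nat_def)
      also have "\<dots> \<le> (\<integral>y. indicator {y. Z y \<le> \<tau>\<^sup>2} y \<partial>rest n)"
        by (intro integral_mono Bochner_Integration.integrable_diff R.integrable_const integrable_divide intsum(1) indI ind)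
      finally show ?thesis .
    qed
    have low: "indicator {y. Z y \<le> \<tau>\<^sup>2} y * (1 / 4 * tail \<tau>) \<le> (\<integral>x. (normed n (y(0 := x)) 0) ^ 4 \<partial>\<mu>)" if y: "y \<in> space (rest n)" for y
    proof -
      have "indicator {y. Z y \<le> \<tau>\<^sup>2} y * (1 / 4 * tail \<tau>) = (\<integral>x. indicator {y. Z y \<le> \<tau>\<^sup>2} y * (1 / 4 * indicator {x. \<tau> < \<bar>x\<bar>} x) \<partial>\<mu>)"
        by (simp add: tail_def space_eq)
      also have "\<dots> \<le> (\<integral>x. (normed n (y(0 := x)) 0) ^ 4 \<partial>\<mu>)"
      proof (rule integral_mono)
        show "integrable \<mu> (\<lambda>x. indicator {y. Z y \<le> \<tau>\<^sup>2} y * (1 / 4 * indicator {x. \<tau> < \<bar>x\<bar>} x) :: real)"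
          using tail_sets by (intro integrable_mult_right integrable_real_indicator) (auto simp: emeasure_eq_measure)
        show "integrable \<mu> (\<lambda>x. (normed n (y(0 := x)) 0) ^ 4)"
          using n y by (intro integrable_inner) auto
        fix x
        show "indicator {y. Z y \<le> \<tau>\<^sup>2} y * (1 / 4 * indicator {x. \<tau> < \<bar>x\<bar>} x) \<le> (normed n (y(0 := x)) 0) ^ 4"
        proof (cases "Z y \<le> \<tau>\<^sup>2 \<and> \<tau> < \<bar>x\<bar>")
          case True
          then have "\<tau>\<^sup>2 \<le> \<bar>x\<bar>\<^sup>2" using \<tau>1 by (intro power_mono) auto
          then have Zx: "Z y \<le> x\<^sup>2" using True by simp
          have x2: "0 < x\<^sup>2" using True \<tau>1 by auto
          have pos: "0 < x\<^sup>2 + Z y" using Z0[of y] x2 by linarith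
          then have ne: "x\<^sup>2 + (\<Sum>k=1..<n. (y k)\<^sup>2) \<noteq> 0" by (simp only: Z_def[symmetric])
          have "1 / 2 \<le> x\<^sup>2 / (x\<^sup>2 + Z y)" using Zx pos by (simp add: le_divide_eq)
          then have "(1 / 2)\<^sup>2 \<le> (x\<^sup>2 / (x\<^sup>2 + Z y))\<^sup>2" by (intro power_mono) auto
          also have "\<dots> = (normed n (y(0 := x)) 0) ^ 4"
            unfolding Z_def using n by (intro normed_zero_power4(2)[symmetric] ne) simp
          finally show ?thesis using True by (simp add: power2_eq_square)
        qed auto
      qed
      finally show ?thesis .
    qed
    have "1 / 8 * tail \<tau> \<le> (\<integral>y. indicator {y. Z y \<le> \<tau>\<^sup>2} y \<partial>rest n) * (1 / 4 * tail \<tau>)"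
      using mult_right_mono[OF half, of "1 / 4 * tail \<tau>"] by (simp add: tail_def)
    also have "\<dots> = (\<integral>y. indicator {y. Z y \<le> \<tau>\<^sup>2} y * (1 / 4 * tail \<tau>) \<partial>rest n)"
      by (rule integral_mult_left_zero[symmetric])
    also have "\<dots> \<le> (\<integral>y. (\<integral>x. (normed n (y(0 := x)) 0) ^ 4 \<partial>\<mu>) \<partial>rest n)"
    proof (rule integral_mono)
      show "integrable (rest n) (\<lambda>y. indicator {y. Z y \<le> \<tau>\<^sup>2} y * (1 / 4 * tail \<tau>))"
        by (intro integrable_mult_left indI)
      show "integrable (rest n) (\<lambda>y. \<integral>x. (normed n (y(0 := x)) 0) ^ 4 \<partial>\<mu>)"
        using n by (intro integrable_outer) auto
    qed (use low in auto)
    also have "\<dots> = fourth_moment n" using n by (intro fourth_moment_split[symmetric]) auto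
    finally have "1 / 8 * tail \<tau> \<le> fourth_moment n" .
    moreover have "c * \<tau> powr (- s) \<le> tail \<tau>" using \<tau>1 by (rule c(2))
    moreover have "\<tau> powr (- s) = (2 * E) powr (- (s / r)) * n powr (- (s / r))"
    proof -
      have "\<tau> powr (- s) = (2 * E * n) powr (- (s / r))"
        unfolding \<tau>_def by (simp add: powr_powr ac_simps)
      then show ?thesis by (simp only: powr_mult)
    qed
    ultimately show ?thesis by (simp add: mult.assoc)
  qed
  moreover have "0 < c / 8 * (2 * E) powr (- (s / r))" using c E1 by simp
  ultimately show ?thesis by blast
qed

text \<open>Unless the sum of squares of the other entries is below \<open>c n\<close>, which has exponentially small
  probability, the fourth power of the normalised entry is at most \<open>(x\<^sup>2 / (c n))\<^bsup>\<rho>/2\<^esup>\<close>.\<close>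

lemma fourth_moment_upper:
  assumes \<rho>: "0 < \<rho>" "\<rho> < \<alpha>" "\<rho> \<le> 4"
  shows "\<exists>C. \<forall>\<^sub>F n in sequentially. fourth_moment n \<le> C * n powr (- (\<rho> / 2))"
proof -
  define \<theta> where "\<theta> = (\<integral>x. exp (- x\<^sup>2) \<partial>\<mu>)"
  have int_e: "integrable \<mu> (\<lambda>x. exp (- x\<^sup>2))" by (intro integrable_bounded[of _ 1]) auto
  \<comment> \<open>Otherwise exp(-x^2) = 1, that is x = 0, almost surely.\<close>
  have \<theta>1: "\<theta> < 1"
  proof (rule ccontr)
    assume "\<not> \<theta> < 1"
    moreover have "(\<integral>x. 1 - exp (- x\<^sup>2) \<partial>\<mu>) = 1 - \<theta>" using int_e by (simp add: \<theta>_def prob_space)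
    moreover have "0 \<le> (\<integral>x. 1 - exp (- x\<^sup>2) \<partial>\<mu>)" by (intro Bochner_Integration.integral_nonneg) auto
    ultimately have z: "(\<integral>x. 1 - exp (- x\<^sup>2) \<partial>\<mu>) = 0" by linarith
    have "AE x in \<mu>. 1 - exp (- x\<^sup>2) = 0"
      using integral_nonneg_eq_0_iff_AE[of \<mu> "\<lambda>x. 1 - exp (- x\<^sup>2)"] z int_e by simp
    with nonzero have "AE x in \<mu>. False" by eventually_elim simp
    then show False by simp
  qed
  have \<theta>0: "0 < \<theta>"
  proof (rule ccontr)
    assume "\<not> 0 < \<theta>"
    moreover have "0 \<le> \<theta>" unfolding \<theta>_def by (intro Bochner_Integration.integral_nonneg) auto
    ultimately have "\<theta> = 0" by linarith
    then have "AE x in \<mu>. exp (- x\<^sup>2) = 0"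
      using integral_nonneg_eq_0_iff_AE[OF int_e] by (simp add: \<theta>_def)
    then show False by simp
  qed
  \<comment> \<open>Half of Chernoff's rate: with \<theta> = exp(-2 c), the product of exp(c n) and
    \<theta>^(n - 1) still decays like exp(-c n), up to exp(2 c) for the missing factor.\<close>
  define c where "c = - ln \<theta> / 2"
  have c: "0 < c" using \<theta>0 \<theta>1 by (simp add: c_def)
  define E where "E = (\<integral>x. \<bar>x\<bar> powr \<rho> \<partial>\<mu>)"
  have E0: "0 \<le> E" unfolding E_def by (intro Bochner_Integration.integral_nonneg) auto
  have bound: "fourth_moment n \<le> E * (c * n) powr (- (\<rho> / 2)) + exp (2 * c) * exp (- (c * n))" if n: "2 \<le> n" for n :: nat
  proof -
    interpret R: prob_space "rest n" by (rule prob_space_iid)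
    interpret P: product_prob_space "\<lambda>_. \<mu>" "{1..<n}" by unfold_locales
    define Z where "Z y = (\<Sum>k=1..<n. (y k)\<^sup>2)" for y :: "nat \<Rightarrow> real"
    have Zm [measurable]: "Z \<in> borel_measurable (rest n)" unfolding Z_def by measurable
    have Z0: "0 \<le> Z y" for y unfolding Z_def by (intro sum_nonneg) auto
    have cn: "0 < c * n" using c n by simp
    let ?K = "(c * n) powr (- (\<rho> / 2))"
    \<comment> \<open>If Z >= c n, the ratio t is at most x^2 / (c n), and t^2 <= t^(\<rho>/2)
      because t <= 1 and \<rho> <= 4. Otherwise the second summand is at least 1 and the bound is
      trivial.\<close>
    have pt: "(normed n (y(0 := x)) 0) ^ 4 \<le> \<bar>x\<bar> powr \<rho> * ?K + exp (c * n) * exp (- Z y)" for x y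
    proof (cases "c * n \<le> Z y")
      case True
      then have Zp: "0 < Z y" using cn by linarith
      define t where "t = x\<^sup>2 / (x\<^sup>2 + Z y)"
      have xZ: "0 < x\<^sup>2 + Z y" using Zp by (simp add: add_nonneg_pos)
      have t: "0 \<le> t" "t \<le> 1" using xZ Zp by (auto simp: t_def)
      have "(normed n (y(0 := x)) 0) ^ 4 = t\<^sup>2"
        unfolding t_def Z_def using n xZ by (intro normed_zero_power4(2)) (auto simp: Z_def)
      also have "\<dots> = t powr 2" using t by simp
      also have "\<dots> \<le> t powr (\<rho> / 2)" using t \<rho> by (intro powr_mono') auto
      also have "\<dots> \<le> (x\<^sup>2 / (c * n)) powr (\<rho> / 2)"
        using t \<rho> cn True unfolding t_def by (intro powr_mono2 frac_le) (auto intro: add_increasing)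
      also have "\<dots> = \<bar>x\<bar> powr \<rho> * ?K" by (simp only: powr_divide sq_powr_half powr_minus_divide) simp
      also have "\<dots> \<le> \<bar>x\<bar> powr \<rho> * ?K + exp (c * n) * exp (- Z y)" by simp
      finally show ?thesis .
    next
      case False
      have "(normed n (y(0 := x)) 0) ^ 4 \<le> 1" using n by (intro normed_zero_power4(1)) auto
      also have "1 \<le> exp (c * n) * exp (- Z y)" using False by (simp flip: exp_add)
      also have "\<dots> \<le> \<bar>x\<bar> powr \<rho> * ?K + exp (c * n) * exp (- Z y)" by simp
      finally show ?thesis .
    qed
    have inner: "(\<integral>x. (normed n (y(0 := x)) 0) ^ 4 \<partial>\<mu>) \<le> E * ?K + exp (c * n) * exp (- Z y)" if y: "y \<in> space (rest n)" for y
    proof -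
      have "(\<integral>x. (normed n (y(0 := x)) 0) ^ 4 \<partial>\<mu>) \<le> (\<integral>x. \<bar>x\<bar> powr \<rho> * ?K + exp (c * n) * exp (- Z y) \<partial>\<mu>)"
      proof (rule integral_mono)
        show "integrable \<mu> (\<lambda>x. (normed n (y(0 := x)) 0) ^ 4)"
          using n y by (intro integrable_inner) auto
      qed (use pt integrable_abs_powr[OF \<rho>(1,2)] in auto)
      also have "\<dots> = E * ?K + exp (c * n) * exp (- Z y)"
        using integrable_abs_powr[OF \<rho>(1,2)] by (simp add: E_def prob_space)
      finally show ?thesis .
    qed
    have eZ: "exp (- Z y) = (\<Prod>k=1..<n. exp (- (y k)\<^sup>2))" for y
      by (simp add: Z_def exp_sum flip: sum_negf)
    have intZ: "integrable (rest n) (\<lambda>y. exp (- Z y))"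
    proof (rule R.integrable_bounded[of _ 1])
      show "(\<lambda>y. exp (- Z y)) \<in> borel_measurable (rest n)" by measurable
    qed (use Z0 in simp)
    have valZ: "(\<integral>y. exp (- Z y) \<partial>rest n) = \<theta> ^ (n - 1)"
      unfolding eZ using P.product_integral_prod[of "{1..<n}" "\<lambda>_ x. exp (- x\<^sup>2)"] int_e by (simp add: \<theta>_def)
    have "fourth_moment n = (\<integral>y. (\<integral>x. (normed n (y(0 := x)) 0) ^ 4 \<partial>\<mu>) \<partial>rest n)"
      using n by (intro fourth_moment_split) auto
    also have "\<dots> \<le> (\<integral>y. E * ?K + exp (c * n) * exp (- Z y) \<partial>rest n)"
    proof (rule integral_mono)
      show "integrable (rest n) (\<lambda>y. \<integral>x. (normed n (y(0 := x)) 0) ^ 4 \<partial>\<mu>)"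
        using n by (intro integrable_outer) auto
      show "integrable (rest n) (\<lambda>y. E * ?K + exp (c * n) * exp (- Z y))"
        by (intro Bochner_Integration.integrable_add R.integrable_const integrable_mult_right intZ)
    qed (rule inner)
    also have "\<dots> = E * ?K + exp (c * n) * \<theta> ^ (n - 1)"
      using intZ by (simp add: valZ R.prob_space del: One_nat_def)
    also have "exp (c * n) * \<theta> ^ (n - 1) = exp (2 * c) * exp (- (c * n))"
    proof -
      have "\<theta> = exp (- (2 * c))" using \<theta>0 by (simp add: c_def)
      then have "\<theta> ^ (n - 1) = exp (real (n - 1) * (- (2 * c)))" by (simp only: exp_of_nat_mult)
      also have "real (n - 1) = real n - 1" using n by simp
      finally show ?thesis by (simp add: algebra_simps flip: exp_add)
    qed
    finally show ?thesis .
  qed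
  have "(\<lambda>n. exp (- (c * real n)) * real n powr (\<rho> / 2)) \<longlonglongrightarrow> 0" using c by real_asymp
  then have "\<forall>\<^sub>F n in sequentially. exp (- (c * real n)) * real n powr (\<rho> / 2) < 1"
    by (rule order_tendstoD(2)) simp
  then have "\<forall>\<^sub>F n in sequentially. fourth_moment n \<le> (E * c powr (- (\<rho> / 2)) + exp (2 * c)) * n powr (- (\<rho> / 2))"
    using eventually_ge_at_top[of 2]
  proof eventually_elim
    case (elim n)
    have "exp (- (c * n)) \<le> n powr (- (\<rho> / 2))" using elim by (simp add: powr_minus field_simps)
    then have "exp (2 * c) * exp (- (c * n)) \<le> exp (2 * c) * n powr (- (\<rho> / 2))" by (intro mult_left_mono) auto
    moreover have "E * (c * n) powr (- (\<rho> / 2)) = E * c powr (- (\<rho> / 2)) * n powr (- (\<rho> / 2))"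
      by (simp only: powr_mult mult.assoc)
    ultimately show ?case using bound[OF elim(2)] unfolding distrib_right by linarith
  qed
  then show ?thesis by blast
qed

end

subsection \<open>The trace statistic\<close>

text \<open>Blocks of independent variables are independent, and within a block the joint law is a
  product. The array is thus transported to a product of products, where the row is the observation
  of the U-statistic.\<close>

lemma rows_iid:
  fixes X :: "nat \<times> nat \<Rightarrow> 'a \<Rightarrow> real" and n p :: nat
  assumes M: "prob_space M" and n: "2 \<le> n" and p: "1 \<le> p"
    and \<mu>: "symmetric_law \<mu>"
    and ind: "prob_space.indep_vars M (\<lambda>_. borel) X ({..<p} \<times> {..<n})"
    and law: "\<And>i. i \<in> {..<p} \<times> {..<n} \<Longrightarrow> distr M borel (X i) = \<mu>"
  defines "\<Phi> \<equiv> \<lambda>\<omega>. \<lambda>i\<in>{..<p}. \<lambda>j\<in>{..<n}. X (i, j) \<omega>"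
  shows "\<Phi> \<in> measurable M (PiM {..<p} (\<lambda>_. PiM {..<n} (\<lambda>_. \<mu>)))"
    and "distr M (PiM {..<p} (\<lambda>_. PiM {..<n} (\<lambda>_. \<mu>))) \<Phi> = PiM {..<p} (\<lambda>_. PiM {..<n} (\<lambda>_. \<mu>))"
proof -
  interpret prob_space M by fact
  interpret \<mu>: symmetric_law \<mu> by fact
  let ?row = "PiM {..<n} (\<lambda>_. \<mu>)"
  have sB: "sets ?row = sets (PiM {..<n} (\<lambda>_. borel :: real measure))"
    by (intro sets_PiM_cong refl \<mu>.sets_eq)
  have rvX: "X k \<in> borel_measurable M" if "k \<in> {..<p} \<times> {..<n}" for k
    using ind that by (auto simp: indep_vars_def)
  have rowm: "(\<lambda>\<omega>. \<lambda>j\<in>{..<n}. X (i, j) \<omega>) \<in> measurable M ?row" if i: "i < p" for i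
  proof -
    have "(\<lambda>\<omega>. \<lambda>j\<in>{..<n}. X (i, j) \<omega>) \<in> measurable M (PiM {..<n} (\<lambda>_. borel))"
      using i by (intro measurable_restrict rvX) auto
    then show ?thesis using measurable_cong_sets[OF refl sB] by blast
  qed
  show meas: "\<Phi> \<in> measurable M (PiM {..<p} (\<lambda>_. ?row))"
    unfolding \<Phi>_def by (rule measurable_restrict) (simp add: rowm)
  have rows_ind: "indep_vars (\<lambda>_. ?row) (\<lambda>i \<omega>. \<lambda>j\<in>{..<n}. X (i, j) \<omega>) {..<p}"
  proof -
    have 1: "indep_vars (\<lambda>i. PiM ({i} \<times> {..<n}) (\<lambda>_. borel)) (\<lambda>i \<omega>. restrict (\<lambda>k. X k \<omega>) ({i} \<times> {..<n})) {..<p}"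
      using ind by (rule indep_vars_restrict) (auto simp: disjoint_family_on_def)
    have "indep_vars (\<lambda>_. ?row) (\<lambda>i. (\<lambda>z. \<lambda>j\<in>{..<n}. z (i, j)) \<circ> (\<lambda>\<omega>. restrict (\<lambda>k. X k \<omega>) ({i} \<times> {..<n}))) {..<p}"
      using 1
    proof (rule indep_vars_compose)
      fix i assume "i \<in> {..<p}"
      have "(\<lambda>z. \<lambda>j\<in>{..<n}. z (i, j)) \<in> measurable (PiM ({i} \<times> {..<n}) (\<lambda>_. borel)) (PiM {..<n} (\<lambda>_. borel :: real measure))"
        by (intro measurable_restrict measurable_component_singleton) auto
      then show "(\<lambda>z. \<lambda>j\<in>{..<n}. z (i, j)) \<in> measurable (PiM ({i} \<times> {..<n}) (\<lambda>_. borel)) ?row"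
        using measurable_cong_sets[OF refl sB] by blast
    qed
    moreover have "((\<lambda>z. \<lambda>j\<in>{..<n}. z (i, j)) \<circ> (\<lambda>\<omega>. restrict (\<lambda>k. X k \<omega>) ({i} \<times> {..<n}))) = (\<lambda>\<omega>. \<lambda>j\<in>{..<n}. X (i, j) \<omega>)" for i
      by (auto simp: fun_eq_iff)
    ultimately show ?thesis by simp
  qed
  have row_law: "distr M ?row (\<lambda>\<omega>. \<lambda>j\<in>{..<n}. X (i, j) \<omega>) = ?row" if i: "i < p" for i
  proof -
    have ind_i: "indep_vars (\<lambda>_. borel) (\<lambda>j. X (i, j)) {..<n}"
    proof -
      have 1: "indep_vars (\<lambda>j. PiM {(i, j)} (\<lambda>_. borel)) (\<lambda>j \<omega>. restrict (\<lambda>k. X k \<omega>) {(i, j)}) {..<n}"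
        using i by (intro indep_vars_restrict[OF ind]) (auto simp: disjoint_family_on_def)
      have "indep_vars (\<lambda>_. borel) (\<lambda>j. (\<lambda>z. z (i, j)) \<circ> (\<lambda>\<omega>. restrict (\<lambda>k. X k \<omega>) {(i, j)})) {..<n}"
        using 1 by (rule indep_vars_compose) (auto intro: measurable_component_singleton)
      then show ?thesis by (simp add: comp_def)
    qed
    have "distr M (PiM {..<n} (\<lambda>_. borel)) (\<lambda>\<omega>. \<lambda>j\<in>{..<n}. X (i, j) \<omega>) = PiM {..<n} (\<lambda>j. distr M borel (X (i, j)))"
      using ind_i rvX i n by (subst (asm) indep_vars_iff_distr_eq_PiM') (auto simp: lessThan_empty_iff)
    also have "\<dots> = ?row" using law i by (intro PiM_cong) auto
    finally show ?thesis by (subst distr_cong[OF refl sB refl])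
  qed
  have "distr M (PiM {..<p} (\<lambda>_. ?row)) \<Phi> = PiM {..<p} (\<lambda>i. distr M ?row (\<lambda>\<omega>. \<lambda>j\<in>{..<n}. X (i, j) \<omega>))"
    unfolding \<Phi>_def using rows_ind rowm p by (subst (asm) indep_vars_iff_distr_eq_PiM') (auto simp: lessThan_empty_iff)
  also have "\<dots> = PiM {..<p} (\<lambda>_. ?row)" using row_law by (intro PiM_cong) auto
  finally show "distr M (PiM {..<p} (\<lambda>_. ?row)) \<Phi> = PiM {..<p} (\<lambda>_. ?row)" .
qed

lemma R_mat_entry:
  assumes "i < p" "k < p"
  shows "R_mat p n X \<omega> $$ (i, k) = (\<Sum>j<n. X (i, j) \<omega> / sqrt (\<Sum>l<n. (X (i, l) \<omega>)\<^sup>2) * (X (k, j) \<omega> / sqrt (\<Sum>l<n. (X (k, l) \<omega>)\<^sup>2)))"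
  using assms by (simp add: R_mat_def Y_mat_def scalar_prod_def atLeast0LessThan)

text \<open>By symmetry of R, the trace of the square is the squared Frobenius norm.\<close>

lemma tr_R_sq: "tr (R_mat p n X \<omega> ^\<^sub>m 2) = (\<Sum>i<p. \<Sum>k<p. (R_mat p n X \<omega> $$ (i, k))\<^sup>2)"
proof -
  have d: "dim_row (R_mat p n X \<omega>) = p" "dim_col (R_mat p n X \<omega>) = p" by (auto simp: R_mat_def Y_mat_def)
  have "R_mat p n X \<omega> ^\<^sub>m 2 = R_mat p n X \<omega> * R_mat p n X \<omega>"
    using d by (simp add: numeral_2_eq_2)
  moreover have "R_mat p n X \<omega> $$ (k, i) = R_mat p n X \<omega> $$ (i, k)" if "i < p" "k < p" for i k
    using that by (simp add: R_mat_entry mult.commute)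
  ultimately show ?thesis
    using d by (simp add: tr_def scalar_prod_def power2_eq_square atLeast0LessThan)
qed

text \<open>The diagonal of R is 1, and each of the p (p - 1) other squared entries is h + 1/n; the
  centering removes exactly the deterministic part.\<close>

lemma tr_R_sq_eq_W:
  assumes p: "1 \<le> p"
    and nz: "\<And>i. i < p \<Longrightarrow> (\<Sum>l<n. (X (i, l) \<omega>)\<^sup>2) \<noteq> 0"
    and S: "exchangeable_sphere N (normed n) n b4 g flip"
  defines "\<Phi> \<equiv> \<lambda>\<omega>. \<lambda>i\<in>{..<p}. \<lambda>j\<in>{..<n}. X (i, j) \<omega>"
  shows "tr (R_mat p n X \<omega> ^\<^sub>m 2) - centering p n
    = 2 * degenerate_kernel.W (exchangeable_sphere.h (normed n) n) {..<p} (\<Phi> \<omega>)"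
proof -
  interpret S: exchangeable_sphere N "normed n" n b4 g flip by fact
  have norm: "normed n (\<Phi> \<omega> i) j = X (i, j) \<omega> / sqrt (\<Sum>l<n. (X (i, l) \<omega>)\<^sup>2)" if "i < p" "j < n" for i j
  proof -
    have "(\<Sum>l<n. (\<Phi> \<omega> i l)\<^sup>2) = (\<Sum>l<n. (X (i, l) \<omega>)\<^sup>2)" using that by (simp add: \<Phi>_def)
    then show ?thesis using nz[OF that(1)] that by (simp add: normed_def \<Phi>_def)
  qed
  have R: "R_mat p n X \<omega> $$ (i, k) = S.ip (\<Phi> \<omega> i) (\<Phi> \<omega> k)" if "i < p" "k < p" for i k
    using that by (simp add: R_mat_entry S.ip_def norm)
  have "tr (R_mat p n X \<omega> ^\<^sub>m 2) = (\<Sum>i<p. \<Sum>k<p. (S.ip (\<Phi> \<omega> i) (\<Phi> \<omega> k))\<^sup>2)"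
    unfolding tr_R_sq by (intro sum.cong refl) (simp add: R)
  also have "\<dots> = (\<Sum>i<p. 1 + ((\<Sum>k\<in>{..<p} - {i}. S.h (\<Phi> \<omega> i) (\<Phi> \<omega> k)) + (real p - 1) * (1 / n)))"
  proof (rule sum.cong[OF refl])
    fix i assume i: "i \<in> {..<p}"
    have "(\<Sum>k<p. (S.ip (\<Phi> \<omega> i) (\<Phi> \<omega> k))\<^sup>2) = (S.ip (\<Phi> \<omega> i) (\<Phi> \<omega> i))\<^sup>2 + (\<Sum>k\<in>{..<p} - {i}. (S.ip (\<Phi> \<omega> i) (\<Phi> \<omega> k))\<^sup>2)"
      using i by (intro sum.remove) auto
    also have "(\<Sum>k\<in>{..<p} - {i}. (S.ip (\<Phi> \<omega> i) (\<Phi> \<omega> k))\<^sup>2) = (\<Sum>k\<in>{..<p} - {i}. S.h (\<Phi> \<omega> i) (\<Phi> \<omega> k) + 1 / n)"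
      by (simp add: S.h_def)
    also have "\<dots> = (\<Sum>k\<in>{..<p} - {i}. S.h (\<Phi> \<omega> i) (\<Phi> \<omega> k)) + (real p - 1) * (1 / n)"
      using i p by (simp add: sum.distrib of_nat_diff)
    finally show "(\<Sum>k<p. (S.ip (\<Phi> \<omega> i) (\<Phi> \<omega> k))\<^sup>2) = 1 + ((\<Sum>k\<in>{..<p} - {i}. S.h (\<Phi> \<omega> i) (\<Phi> \<omega> k)) + (real p - 1) * (1 / n))"
      by (simp add: S.ip_self)
  qed
  also have "\<dots> = real p + (\<Sum>i<p. \<Sum>k\<in>{..<p} - {i}. S.h (\<Phi> \<omega> i) (\<Phi> \<omega> k)) + real p * ((real p - 1) * (1 / n))"
    by (simp only: sum.distrib sum_constant card_lessThan mult_1_right)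
  finally show ?thesis by (simp add: centering_def S.K.W_def)
qed

section \<open>Transfer of the hypotheses to the law of an entry\<close>

lemma symmetric_law_distr:
  fixes \<xi> :: "'b \<Rightarrow> real"
  assumes N: "prob_space N" and [measurable]: "\<xi> \<in> borel_measurable N" and sym: "symmetric_rv N \<xi>"
    and zero: "measure N {\<omega> \<in> space N. \<xi> \<omega> = 0} = 0"
  shows "symmetric_law (distr N borel \<xi>)"
proof -
  interpret N: prob_space N by fact
  interpret D: prob_space "distr N borel \<xi>" by (rule N.prob_space_distr) simp
  show ?thesis
  proof
    show "sets (distr N borel \<xi>) = sets borel" by simp
    have "distr (distr N borel \<xi>) (distr N borel \<xi>) uminus = distr (distr N borel \<xi>) borel uminus"
      by (rule distr_cong) auto
    also have "\<dots> = distr N borel (\<lambda>\<omega>. - \<xi> \<omega>)" by (subst distr_distr) (auto simp: comp_def)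
    also have "\<dots> = distr N borel \<xi>" using sym by (simp add: symmetric_rv_def)
    finally show "distr (distr N borel \<xi>) (distr N borel \<xi>) uminus = distr N borel \<xi>" .
    have "AE \<omega> in N. \<omega> \<notin> {\<omega> \<in> space N. \<xi> \<omega> = 0}"
      using zero by (intro AE_not_in) (simp add: null_sets_def N.emeasure_eq_measure)
    then have "AE \<omega> in N. \<xi> \<omega> \<noteq> 0" by (rule AE_mp) auto
    then show "AE x in distr N borel \<xi>. x \<noteq> 0" by (subst AE_distr_iff) auto
  qed
qed

lemma heavy_tail_distr:
  fixes \<xi> :: "'b \<Rightarrow> real"
  assumes N: "prob_space N" and [measurable]: "\<xi> \<in> borel_measurable N" and sym: "symmetric_rv N \<xi>"
    and zero: "measure N {\<omega> \<in> space N. \<xi> \<omega> = 0} = 0"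
    and rv: "regularly_varying N \<xi> \<alpha>" and \<alpha>: "0 < \<alpha>"
  shows "heavy_tail (distr N borel \<xi>) \<alpha>"
proof -
  interpret symmetric_law "distr N borel \<xi>" by (rule symmetric_law_distr) fact+
  obtain L where L: "\<And>x. 0 < x \<Longrightarrow> 0 < L x" "\<And>t. 0 < t \<Longrightarrow> ((\<lambda>x. L (t * x) / L x) \<longlongrightarrow> 1) at_top"
    and tail: "\<And>x. 0 < x \<Longrightarrow> measure N {\<omega> \<in> space N. x < \<bar>\<xi> \<omega>\<bar>} = x powr (- \<alpha>) * L x"
    using rv by (auto simp: regularly_varying_def slowly_varying_def)
  have m: "measure (distr N borel \<xi>) {y. x < \<bar>y\<bar>} = measure N {\<omega> \<in> space N. x < \<bar>\<xi> \<omega>\<bar>}" for x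
  proof -
    have "{y :: real. x < \<bar>y\<bar>} \<in> sets borel" by measurable
    then show ?thesis
      by (subst measure_distr) (auto intro!: arg_cong[where f = "measure N"])
  qed
  show ?thesis
  proof
    show "0 < \<alpha>" by fact
    show "0 < measure (distr N borel \<xi>) {y. x < \<bar>y\<bar>}" if "0 < x" for x
      using that L(1)[OF that] by (simp add: m tail)
    show "((\<lambda>x. measure (distr N borel \<xi>) {y. 2 * x < \<bar>y\<bar>} / measure (distr N borel \<xi>) {y. x < \<bar>y\<bar>}) \<longlongrightarrow> 2 powr (- \<alpha>)) at_top"
    proof (rule Lim_transform_eventually)
      show "((\<lambda>x. 2 powr (- \<alpha>) * (L (2 * x) / L x)) \<longlongrightarrow> 2 powr (- \<alpha>)) at_top"
        using tendsto_mult_left[OF L(2)[of 2], of "2 powr (- \<alpha>)"] by simp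
      show "\<forall>\<^sub>F x in at_top. 2 powr (- \<alpha>) * (L (2 * x) / L x)
          = measure (distr N borel \<xi>) {y. 2 * x < \<bar>y\<bar>} / measure (distr N borel \<xi>) {y. x < \<bar>y\<bar>}"
        using eventually_gt_at_top[of 0]
      proof eventually_elim
        case (elim x)
        then show ?case by (simp add: m tail powr_mult)
      qed
    qed
  qed
qed

text \<open>For \<alpha> <= 3 the threshold \<open>\<delta>_star \<alpha>\<close> is exactly
  \<alpha> / min \<alpha> 2 - 1/2. Above it there is room for a moment r below min \<alpha> 2 and a
  tail exponent s above \<alpha> with s / r = \<delta> + 1/2.\<close>

lemma (in heavy_tail) fourth_moment_condition:
  assumes \<alpha>4: "\<alpha> < 4"
    and rate: "\<alpha> \<le> 3 \<Longrightarrow> \<exists>\<delta>>\<delta>_star \<alpha>. filterlim (\<lambda>n. real (p n) / real n powr \<delta>) at_top sequentially"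
  shows "\<exists>q. 2 < q \<and> q \<le> 3 \<and> (filterlim (\<lambda>n. real (p n) * sqrt n * fourth_moment n) at_top sequentially
      \<or> (\<exists>C. \<forall>\<^sub>F n in sequentially. n powr (1 + q) * (fourth_moment n)\<^sup>2 \<le> C))"
proof (cases "\<alpha> \<le> 3")
  case True
  obtain \<delta> where \<delta>: "\<delta>_star \<alpha> < \<delta>" and lim: "filterlim (\<lambda>n. real (p n) / real n powr \<delta>) at_top sequentially"
    using rate[OF True] by blast
  define m0 where "m0 = min \<alpha> 2"
  define D where "D = \<delta> + 1 / 2"
  have m0: "0 < m0" "m0 \<le> 2" "m0 \<le> \<alpha>" using \<alpha> by (auto simp: m0_def)
  have D0: "0 < D" using \<delta> True by (auto simp: D_def \<delta>_star_def split: if_splits)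
  have D: "\<alpha> < D * m0"
  proof (cases "\<alpha> < 2")
    case True
    then have "1 < D" using \<delta> by (simp add: D_def \<delta>_star_def)
    then show ?thesis using True \<alpha> by (simp add: m0_def)
  next
    case False
    then have "(\<alpha> - 1) / 2 < \<delta>" using \<delta> True by (simp add: \<delta>_star_def)
    then show ?thesis using False by (simp add: D_def m0_def)
  qed
  \<comment> \<open>The midpoint of \<alpha> / D and min \<alpha> 2: an admissible moment for which
    s = r D still exceeds \<alpha>, so that the lower bound is n^(-D).\<close>
  define r where "r = (\<alpha> / D + m0) / 2"
  have aD: "\<alpha> / D < m0" using D D0 by (simp add: divide_less_eq mult.commute)
  have aD0: "0 < \<alpha> / D" using \<alpha> D0 by simp
  have r: "0 < r" "r < \<alpha>" "r \<le> 2" using aD aD0 m0 by (auto simp: r_def)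
  have "x < (x + y) / 2" if "x < y" for x y :: real using that by simp
  then have "\<alpha> / D < r" unfolding r_def using aD .
  then have s: "\<alpha> < r * D" using D0 by (simp add: divide_less_eq)
  obtain c where c: "0 < c" "\<And>n. 2 \<le> n \<Longrightarrow> c * n powr (- (r * D / r)) \<le> fourth_moment n"
    using fourth_moment_lower[OF r s] by blast
  have "filterlim (\<lambda>n. real (p n) * sqrt n * fourth_moment n) at_top sequentially"
  proof (rule filterlim_at_top_mono)
    show "filterlim (\<lambda>n. c * (real (p n) / real n powr \<delta>)) at_top sequentially"
      using c(1) by (intro filterlim_tendsto_pos_mult_at_top[OF tendsto_const _ lim])
    show "\<forall>\<^sub>F n in sequentially. c * (real (p n) / real n powr \<delta>) \<le> real (p n) * sqrt n * fourth_moment n"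
      using eventually_ge_at_top[of 2]
    proof eventually_elim
      case (elim n)
      have e: "n powr (- \<delta>) = sqrt n * n powr (- D)"
      proof -
        have "sqrt n * n powr (- D) = n powr (1 / 2) * n powr (- D)" by (simp add: powr_half_sqrt)
        also have "\<dots> = n powr (1 / 2 + - D)" by (rule powr_add[symmetric])
        also have "1 / 2 + - D = - \<delta>" by (simp add: D_def)
        finally show ?thesis ..
      qed
      have "c * (real (p n) / real n powr \<delta>) = real (p n) * (c * n powr (- \<delta>))"
        by (simp add: powr_minus divide_inverse)
      also have "\<dots> = real (p n) * sqrt n * (c * n powr (- D))" unfolding e by simp
      also have "\<dots> \<le> real (p n) * sqrt n * fourth_moment n"
        using c(2)[OF elim] r by (intro mult_left_mono) auto
      finally show ?case .
    qed
  qed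
  then show ?thesis by (intro exI[of _ 3]) auto
next
  case False
  \<comment> \<open>The midpoint of 3 and \<alpha>. The moment is finite as \<rho> < \<alpha>, and q
    = \<rho> - 1 exceeds 2; the power n^(1 + q) = n^\<rho> matches the squared bound on the fourth
    moment.\<close>
  define \<rho> where "\<rho> = (3 + \<alpha>) / 2"
  have \<rho>: "0 < \<rho>" "\<rho> < \<alpha>" "\<rho> \<le> 4" "3 < \<rho>" using False \<alpha>4 by (auto simp: \<rho>_def)
  obtain C where C: "\<forall>\<^sub>F n in sequentially. fourth_moment n \<le> C * n powr (- (\<rho> / 2))"
    using fourth_moment_upper[OF \<rho>(1-3)] by blast
  have "\<forall>\<^sub>F n in sequentially. n powr (1 + (\<rho> - 1)) * (fourth_moment n)\<^sup>2 \<le> C\<^sup>2"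
    using C eventually_ge_at_top[of 1]
  proof eventually_elim
    case (elim n)
    have "0 \<le> fourth_moment n" unfolding fourth_moment_def by (intro Bochner_Integration.integral_nonneg) auto
    then have "(fourth_moment n)\<^sup>2 \<le> (C * n powr (- (\<rho> / 2)))\<^sup>2" using elim by (intro power_mono) auto
    also have "\<dots> = C\<^sup>2 * (n powr (- (\<rho> / 2)) * n powr (- (\<rho> / 2)))" by (simp add: power2_eq_square)
    also have "n powr (- (\<rho> / 2)) * n powr (- (\<rho> / 2)) = n powr (- \<rho>)" by (simp flip: powr_add)
    finally have "n powr \<rho> * (fourth_moment n)\<^sup>2 \<le> n powr \<rho> * (C\<^sup>2 * n powr (- \<rho>))" by (intro mult_left_mono) auto
    also have "\<dots> = C\<^sup>2 * (n powr \<rho> * n powr (- \<rho>))" by simp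
    also have "n powr \<rho> * n powr (- \<rho>) = 1" using elim by (simp flip: powr_add)
    finally show ?case by simp
  qed
  then show ?thesis using \<rho> False \<alpha>4 by (intro exI[of _ "\<rho> - 1"]) (auto simp: \<rho>_def)
qed

text \<open>Nothing is assumed about the measure with index \<open>0\<close>, which need not be a probability measure.\<close>

lemma weak_conv_m_offset:
  assumes "weak_conv_m (\<lambda>n. M (n + k)) M'"
  shows "weak_conv_m M M'"
  using assms unfolding weak_conv_m_def weak_conv_def by (auto dest: LIMSEQ_offset)

theorem theorem3p1:
  fixes \<alpha> :: real
    and N :: "'b measure" and \<xi> :: "'b \<Rightarrow> real"
    and p :: "nat \<Rightarrow> nat"
    and M :: "nat \<Rightarrow> 'a measure" and X :: "nat \<Rightarrow> nat \<times> nat \<Rightarrow> 'a \<Rightarrow> real"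
  assumes "0 < \<alpha>" and "\<alpha> < 4"
    and "prob_space N" and "\<xi> \<in> borel_measurable N"
    and "nondegenerate N \<xi>"
    and "symmetric_rv N \<xi>"
    and "measure N {\<omega> \<in> space N. \<xi> \<omega> = 0} = 0"
    and "regularly_varying N \<xi> \<alpha>"
    and "\<And>n. n \<ge> 1 \<Longrightarrow> p n \<ge> 1"
    and "filterlim p at_top sequentially"
    and "\<alpha> \<le> 3 \<Longrightarrow>
           \<exists>\<delta>>\<delta>_star \<alpha>. filterlim (\<lambda>n. real (p n) / real n powr \<delta>) at_top sequentially"
    and "\<And>n. n \<ge> 1 \<Longrightarrow> prob_space (M n)"
    and "\<And>n. n \<ge> 1 \<Longrightarrow> iid_copies (M n) ({..<p n} \<times> {..<n}) (X n) N \<xi>"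
  shows "weak_conv_m
           (\<lambda>n. distr (M n) borel
              (\<lambda>\<omega>. (tr (R_mat (p n) n (X n) \<omega> ^\<^sub>m 2) - centering (p n) n)
                   / scaling (M n) (p n) n (X n)))
           std_normal_distribution"
proof -
  define \<mu> where "\<mu> = distr N borel \<xi>"
  interpret heavy_tail \<mu> \<alpha> unfolding \<mu>_def using assms by (intro heavy_tail_distr) auto
  define T where "T n \<omega> = (tr (R_mat (p n) n (X n) \<omega> ^\<^sub>m 2) - centering (p n) n) / scaling (M n) (p n) n (X n)" for n \<omega>
  define \<Phi> where "\<Phi> n \<omega> = (\<lambda>i\<in>{..<p n}. \<lambda>j\<in>{..<n}. X n (i, j) \<omega>)" for n \<omega>
  define \<sigma> where "\<sigma> n = sqrt (2 * (real (p n))\<^sup>2 * real n * ((fourth_moment n)\<^sup>2 + 2 / real n ^ 3))" for n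
  have X: "prob_space.indep_vars (M n) (\<lambda>_. borel) (X n) ({..<p n} \<times> {..<n})"
      "\<And>k. k \<in> {..<p n} \<times> {..<n} \<Longrightarrow> distr (M n) borel (X n k) = \<mu>" if "1 \<le> n" for n
    using assms(13)[OF that] by (auto simp: iid_copies_def \<mu>_def)
  have rvX: "X n k \<in> borel_measurable (M n)" if "1 \<le> n" "k \<in> {..<p n} \<times> {..<n}" for n k
  proof -
    interpret Mn: prob_space "M n" using that(1) by (rule assms(12))
    show ?thesis using X(1)[OF that(1)] that(2) unfolding Mn.indep_vars_def by blast
  qed
  have Tm: "T n \<in> borel_measurable (M n)" if n: "1 \<le> n" for n
  proof -
    have "(\<lambda>\<omega>. \<Sum>i<p n. \<Sum>k<p n. (R_mat (p n) n (X n) \<omega> $$ (i, k))\<^sup>2) \<in> borel_measurable (M n)"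
    proof (intro borel_measurable_sum borel_measurable_power)
      fix i k assume i: "i \<in> {..<p n}" and k: "k \<in> {..<p n}"
      have [measurable]: "X n (i, j) \<in> borel_measurable (M n)" "X n (k, j) \<in> borel_measurable (M n)" if "j \<in> {..<n}" for j
        using rvX[OF n] i k that by auto
      show "(\<lambda>\<omega>. R_mat (p n) n (X n) \<omega> $$ (i, k)) \<in> borel_measurable (M n)"
        using i k by (subst R_mat_entry) auto
    qed
    then show ?thesis unfolding T_def tr_R_sq by measurable
  qed
  \<comment> \<open>The sphere model needs two coordinates, hence n >= 2; finitely many n do not
    affect the limit.\<close>
  have \<beta>: "\<beta>\<^sub>4 (M n) (p n) n (X n) = fourth_moment n"
    and char_eq: "\<And>t. char (distr (M n) borel (T n)) t
      = degenerate_kernel.charf (row n) (exchangeable_sphere.h (normed n) n) {..<p n} (2 * t / \<sigma> n)"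
    if n: "2 \<le> n" for n
  proof -
    have n1: "1 \<le> n" using n by simp
    interpret Mn: prob_space "M n" using n1 by (rule assms(12))
    interpret S: exchangeable_sphere "row n" "normed n" n "fourth_moment n" "mixed_moment n" flip
      using n by (rule exchangeable_sphere_row)
    have pn: "1 \<le> p n" using n1 by (rule assms(9))
    let ?P = "PiM {..<p n} (\<lambda>_. row n)"
    have \<Phi>: "\<Phi> n \<in> measurable (M n) ?P" "distr (M n) ?P (\<Phi> n) = ?P"
      unfolding \<Phi>_def using rows_iid[OF Mn.prob_space_axioms n pn symmetric_law_axioms X[OF n1]] by auto
    \<comment> \<open>Zero rows are excluded almost surely in the product model, and this is pulled
      back along \<Phi>. The conventions of \<open>Y_mat\<close> and \<open>normed\<close> for a
      zero row differ, so the identities below hold only almost everywhere.\<close>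
    have "AE y in ?P. (\<Sum>l<n. (y i l)\<^sup>2) \<noteq> 0" if i: "i \<in> {..<p n}" for i
    proof -
      interpret PP: product_prob_space "\<lambda>_. row n" "{..<p n}" by unfold_locales
      show ?thesis using i n by (intro PP.AE_component AE_row_nonzero) auto
    qed
    then have "AE y in ?P. \<forall>i\<in>{..<p n}. (\<Sum>l<n. (y i l)\<^sup>2) \<noteq> 0" by (intro AE_finite_allI) auto
    then have "AE y in distr (M n) ?P (\<Phi> n). \<forall>i\<in>{..<p n}. (\<Sum>l<n. (y i l)\<^sup>2) \<noteq> 0" by (simp only: \<Phi>(2))
    from AE_distrD[OF \<Phi>(1) this]
    have nz: "AE \<omega> in M n. \<forall>i\<in>{..<p n}. (\<Sum>l<n. (X n (i, l) \<omega>)\<^sup>2) \<noteq> 0"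
      by (simp add: \<Phi>_def)
    show \<beta>: "\<beta>\<^sub>4 (M n) (p n) n (X n) = fourth_moment n"
    proof -
      have c0: "(\<lambda>y. y 0) \<in> measurable ?P (row n)"
        using pn by (intro measurable_component_singleton) auto
      have f: "(\<lambda>y. (normed n (y 0) 0) ^ 4) \<in> borel_measurable ?P"
        by (rule borel_measurable_power[OF measurable_compose[OF c0 normed_measurable]])
      have "\<beta>\<^sub>4 (M n) (p n) n (X n) = (\<integral>\<omega>. (normed n (\<Phi> n \<omega> 0) 0) ^ 4 \<partial>M n)"
        unfolding \<beta>\<^sub>4_def
      proof (rule integral_cong_AE)
        show "AE \<omega> in M n. (Y_mat (p n) n (X n) \<omega> $$ (0, 0)) ^ 4 = (normed n (\<Phi> n \<omega> 0) 0) ^ 4"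
          using nz by eventually_elim (use pn n in \<open>simp add: Y_mat_def normed_def \<Phi>_def\<close>)
        show "(\<lambda>\<omega>. (normed n (\<Phi> n \<omega> 0) 0) ^ 4) \<in> borel_measurable (M n)"
          using measurable_compose[OF \<Phi>(1) f] .
        have [measurable]: "X n (0, j) \<in> borel_measurable (M n)" if "j \<in> {..<n}" for j
          using rvX[OF n1] that pn by auto
        have "(\<lambda>\<omega>. (X n (0, 0) \<omega> / sqrt (\<Sum>k<n. (X n (0, k) \<omega>)\<^sup>2)) ^ 4) \<in> borel_measurable (M n)"
        proof -
          have [measurable]: "X n (0, 0) \<in> borel_measurable (M n)" using rvX[OF n1, of "(0, 0)"] n pn by auto
          show ?thesis by measurable
        qed
        then show "(\<lambda>\<omega>. (Y_mat (p n) n (X n) \<omega> $$ (0, 0)) ^ 4) \<in> borel_measurable (M n)"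
          using pn n by (simp add: Y_mat_def)
      qed
      also have "\<dots> = (\<integral>y. (normed n (y 0) 0) ^ 4 \<partial>?P)"
        using integral_distr[OF \<Phi>(1) f] \<Phi>(2) by simp
      also have "\<dots> = (\<integral>x. (normed n x 0) ^ 4 \<partial>row n)"
      proof -
        interpret PP: product_prob_space "\<lambda>_. row n" "{..<p n}" by unfold_locales
        have "distr ?P (row n) (\<lambda>y. y 0) = row n" using pn by (intro PP.PiM_component) auto
        then show ?thesis
          using integral_distr[OF c0, of "\<lambda>x. (normed n x 0) ^ 4"] by simp
      qed
      finally show ?thesis by (simp add: fourth_moment_def)
    qed
    have sc: "scaling (M n) (p n) n (X n) = \<sigma> n" by (simp add: scaling_def \<sigma>_def \<beta>)
    show "char (distr (M n) borel (T n)) t = S.K.charf {..<p n} (2 * t / \<sigma> n)" for t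
    proof -
      have W: "S.K.W {..<p n} \<in> borel_measurable ?P" by (rule S.K.W_measurable) simp
      have "char (distr (M n) borel (T n)) t = (\<integral>\<omega>. iexp (t * T n \<omega>) \<partial>M n)"
        unfolding char_def using Tm[OF n1] by (subst integral_distr) auto
      also have "\<dots> = (\<integral>\<omega>. iexp (2 * t / \<sigma> n * S.K.W {..<p n} (\<Phi> n \<omega>)) \<partial>M n)"
      proof (rule integral_cong_AE)
        show "AE \<omega> in M n. iexp (t * T n \<omega>) = iexp (2 * t / \<sigma> n * S.K.W {..<p n} (\<Phi> n \<omega>))"
          using nz
        proof eventually_elim
          case (elim \<omega>)
          have "T n \<omega> = 2 * S.K.W {..<p n} (\<Phi> n \<omega>) / \<sigma> n"
            unfolding T_def sc \<Phi>_def
            using tr_R_sq_eq_W[OF pn _ S.exchangeable_sphere_axioms, of "X n" \<omega>] elim by simp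
          then show ?case by (simp add: ac_simps)
        qed
        show "(\<lambda>\<omega>. iexp (t * T n \<omega>)) \<in> borel_measurable (M n)" using Tm[OF n1] by measurable
        have "(\<lambda>\<omega>. S.K.W {..<p n} (\<Phi> n \<omega>)) \<in> borel_measurable (M n)" by (rule measurable_compose[OF \<Phi>(1) W])
        then show "(\<lambda>\<omega>. iexp (2 * t / \<sigma> n * S.K.W {..<p n} (\<Phi> n \<omega>))) \<in> borel_measurable (M n)" by measurable
      qed
      also have "\<dots> = (\<integral>y. iexp (2 * t / \<sigma> n * S.K.W {..<p n} y) \<partial>?P)"
      proof -
        have "(\<lambda>y. iexp (2 * t / \<sigma> n * S.K.W {..<p n} y)) \<in> borel_measurable ?P" using W by measurable
        from integral_distr[OF \<Phi>(1) this] show ?thesis unfolding \<Phi>(2) by simp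
      qed
      finally show ?thesis by (simp add: S.K.charf_def)
    qed
  qed
  obtain q where q: "2 < q" "q \<le> 3"
    and cond: "filterlim (\<lambda>n. real (p n) * sqrt n * fourth_moment n) at_top sequentially
      \<or> (\<exists>C. \<forall>\<^sub>F n in sequentially. n powr (1 + q) * (fourth_moment n)\<^sup>2 \<le> C)"
    using fourth_moment_condition[OF assms(2), of p] assms(11) by blast
  have lim: "(\<lambda>n. char (distr (M n) borel (T n)) t) \<longlonglongrightarrow> char std_normal_distribution t" for t
  proof (rule Lim_transform_eventually)
    show "(\<lambda>n. degenerate_kernel.charf (row n) (exchangeable_sphere.h (normed n) n) {..<p n} (2 * t / \<sigma> n))
        \<longlonglongrightarrow> char std_normal_distribution t"
      unfolding char_std_normal_distribution \<sigma>_def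
      using charf_sphere_tendsto[where flip = "\<lambda>_. flip", OF exchangeable_sphere_row assms(10) q cond, of t] by simp
    show "\<forall>\<^sub>F n in sequentially. degenerate_kernel.charf (row n) (exchangeable_sphere.h (normed n) n) {..<p n} (2 * t / \<sigma> n)
        = char (distr (M n) borel (T n)) t"
      using eventually_ge_at_top[of 2] by eventually_elim (simp add: char_eq)
  qed
  have "weak_conv_m (\<lambda>n. distr (M (n + 1)) borel (T (n + 1))) std_normal_distribution"
  proof (rule levy_continuity)
    show "real_distribution (distr (M (n + 1)) borel (T (n + 1)))" for n
    proof -
      interpret Mn: prob_space "M (n + 1)" by (rule assms(12)) simp
      show ?thesis by (rule Mn.real_distribution_distr) (use Tm[of "n + 1"] in simp)
    qed
    show "real_distribution std_normal_distribution" by (rule real_dist_normal_dist)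
    show "(\<lambda>n. char (distr (M (n + 1)) borel (T (n + 1))) t) \<longlonglongrightarrow> char std_normal_distribution t" for t
      using LIMSEQ_ignore_initial_segment[OF lim[of t], of 1] .
  qed
  then have "weak_conv_m (\<lambda>n. distr (M n) borel (T n)) std_normal_distribution"
    by (rule weak_conv_m_offset)
  then show ?thesis unfolding T_def .
qed

end
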